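(* In the semisimple situation (over the field $\mathbb{C}(q)$, or over $\mathbb{C}$ with $q$ a non-zero complex number such that $q^2$ is not a root of unity whose order is between $2$ and $n$), a complete set of non-zero pairwise distinct (i.e. pairwise non-isomorphic) irreducible representations of $H^\mu(S_n)$ is $$\{e_{\mu}(V_{\lambda})\ :\ \lambda\vdash n,\ \lambda\geq\mu^{ord}\}\ ,$$ where $\mu^{ord}$ is the partition obtained from $\mu$ by ordering the parts in decreasing order and $\geq$ is the dominance order on partitions.
   Context: Let $\mu=(\mu_1,\dots,\mu_d)$, $d>1$, be a composition of $n$ with positive parts and $S_\mu=S_{\mu_1}\times\dots\times S_{\mu_d}\subseteq S_n$ the Young subgroup. The Hecke algebra $H(S_n)$ has basis $\{T_w\}_{w\in S_n}$ with, for a simple transposition $s$: $T_sT_w=T_{sw}$ if $\ell(sw)>\ell(w)$, $T_sT_w=(q-q^{-1})T_w+T_{sw}$ if $\ell(sw)<\ell(w)$. Let $$e_\mu=\frac{1}{\sum_{w\in S_\mu}q^{2\ell(w)}}\sum_{w\in S_\mu}q^{\ell(w)}T_w\,,$$ an idempotent, and $H^\mu(S_n)=e_\mu H(S_n)e_\mu$ (parabolic Hecke algebra, with unit $e_\mu$). In the semisimple situation, $\{V_\lambda\}_{\lambda\vdash n}$ denotes the irreducible representations of $H(S_n)$ with their standard indexation by partitions of $n$, for which the one-dimensional representation $T_w\mapsto q^{\ell(w)}$ is $V_{(n)}$ (and $V_\lambda$ is the $q$-analogue of the Specht module of shape $\lambda$). For a representation $V$ of $H(S_n)$, the space $e_\mu(V)$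 carries the natural action of $H^\mu(S_n)$. *)

theory Defs
  imports
    Complex_Main
    "HOL-Combinatorics.Permutations"
    "HOL-Computational_Algebra.Polynomial"
    "HOL-Computational_Algebra.Fraction_Field"
begin

section \<open>Symmetric groups, compositions and partitions\<close>

definition sym_group :: "nat \<Rightarrow> (nat \<Rightarrow> nat) set" where
  "sym_group n = {w. w permutes {1..n}}"

definition simple_transp :: "nat \<Rightarrow> nat \<Rightarrow> nat" where
  "simple_transp i = transpose i (Suc i)"

definition perm_length :: "nat \<Rightarrow> (nat \<Rightarrow> nat) \<Rightarrow> nat" where
  "perm_length n w =
     (LEAST k. \<exists>is. length is = k \<and> set is \<subseteq> {1..<n} \<and> w = foldr (\<lambda>i u. simple_transp i \<circ> u) is id)"

definition is_composition :: "nat \<Rightarrow> nat list \<Rightarrow> bool" where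
  "is_composition n mu \<longleftrightarrow> sum_list mu = n \<and> (\<forall>m\<in>set mu. 0 < m)"

definition is_partition :: "nat \<Rightarrow> nat list \<Rightarrow> bool" where
  "is_partition n lam \<longleftrightarrow> is_composition n lam \<and> sorted_wrt (\<ge>) lam"

definition ordered_parts :: "nat list \<Rightarrow> nat list" where
  "ordered_parts mu = rev (sort mu)"

text \<open>\<open>take k\<close> of a list shorter than \<open>k\<close> is the whole list, which amounts to padding by zeros.\<close>
definition dominates :: "nat list \<Rightarrow> nat list \<Rightarrow> bool" where
  "dominates lam mu \<longleftrightarrow> (\<forall>k. sum_list (take k mu) \<le> sum_list (take k lam))"

definition conjugate_partition :: "nat list \<Rightarrow> nat list" where
  "conjugate_partition lam =
     (case lam of [] \<Rightarrow> [] | a # _ \<Rightarrow> map (\<lambda>j. length (filter (\<lambda>r. j < r) lam)) [0..<a])"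

definition young_subgroup :: "nat list \<Rightarrow> (nat \<Rightarrow> nat) set" where
  "young_subgroup mu =
     {w \<in> sym_group (sum_list mu).
        \<forall>k<length mu. w ` {sum_list (take k mu)<..sum_list (take (Suc k) mu)}
                        = {sum_list (take k mu)<..sum_list (take (Suc k) mu)}}"

text \<open>
  The permutation sending the entry of each box in the tableau of shape \<open>lam\<close> filled row by row
  to the entry of that box in the tableau filled column by column. Boxes \<open>(i, j)\<close> are numbered
  from 0, entries from 1.
\<close>
definition row_to_column :: "nat list \<Rightarrow> nat \<Rightarrow> nat" where
  "row_to_column lam =
     (THE w. w \<in> sym_group (sum_list lam) \<and>
        (\<forall>i<length lam. \<forall>j<lam ! i.
           w (sum_list (take i lam) + j + 1) = sum_list (take j (conjugate_partition lam)) + i + 1))"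

section \<open>Hecke algebras\<close>

locale hecke_algebra = vector_space scale
  for scale :: "'k::field \<Rightarrow> 'h::ring_1 \<Rightarrow> 'h" +
  fixes n :: nat and q :: 'k and T :: "(nat \<Rightarrow> nat) \<Rightarrow> 'h"
  assumes scale_mult_left: "scale c x * y = scale c (x * y)"
    and scale_mult_right: "x * scale c y = scale c (x * y)"
    and T_inj: "inj_on T (sym_group n)"
    and T_independent: "independent (T ` sym_group n)"
    and T_span: "span (T ` sym_group n) = UNIV"
    and T_id: "T id = 1"
    and T_up: "\<lbrakk>i \<in> {1..<n}; w \<in> sym_group n; perm_length n w < perm_length n (simple_transp i \<circ> w)\<rbrakk>
       \<Longrightarrow> T (simple_transp i) * T w = T (simple_transp i \<circ> w)"
    and T_down: "\<lbrakk>i \<in> {1..<n}; w \<in> sym_group n; perm_length n (simple_transp i \<circ> w) < perm_length n w\<rbrakk>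
       \<Longrightarrow> T (simple_transp i) * T w = scale (q - inverse q) (T w) + T (simple_transp i \<circ> w)"

text \<open>
  For \<open>c = q\<close> this is the unnormalised symmetriser of the Young subgroup, for
  \<open>c = - inverse q\<close> the antisymmetriser: generators of the subgroup act on it by \<open>c\<close>.
\<close>
definition young_sum ::
  "('k::field \<Rightarrow> 'h::ring_1 \<Rightarrow> 'h) \<Rightarrow> ((nat \<Rightarrow> nat) \<Rightarrow> 'h) \<Rightarrow> 'k \<Rightarrow> nat list \<Rightarrow> 'h" where
  "young_sum scale T c mu =
     (\<Sum>w\<in>young_subgroup mu. scale (c ^ perm_length (sum_list mu) w) (T w))"

definition young_idempotent ::
  "('k::field \<Rightarrow> 'h::ring_1 \<Rightarrow> 'h) \<Rightarrow> 'k \<Rightarrow> ((nat \<Rightarrow> nat) \<Rightarrow> 'h) \<Rightarrow> nat list \<Rightarrow> 'h" where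
  "young_idempotent scale q T mu =
     scale (1 / (\<Sum>w\<in>young_subgroup mu. q ^ (2 * perm_length (sum_list mu) w)))
       (young_sum scale T q mu)"

definition parabolic_hecke ::
  "('k::field \<Rightarrow> 'h::ring_1 \<Rightarrow> 'h) \<Rightarrow> 'k \<Rightarrow> ((nat \<Rightarrow> nat) \<Rightarrow> 'h) \<Rightarrow> nat list \<Rightarrow> 'h set" where
  "parabolic_hecke scale q T mu =
     {young_idempotent scale q T mu * h * young_idempotent scale q T mu | h. True}"

text \<open>
  The Specht module of Dipper and James, as a left ideal. In this convention it is a submodule of
  the permutation module generated by \<open>young_sum scale T q lam\<close>, and the shape \<open>[n]\<close> gives the
  one-dimensional representation on which each \<open>T w\<close> acts by \<open>q ^ perm_length n w\<close>.
\<close>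
definition specht_module ::
  "('k::field \<Rightarrow> 'h::ring_1 \<Rightarrow> 'h) \<Rightarrow> 'k \<Rightarrow> ((nat \<Rightarrow> nat) \<Rightarrow> 'h) \<Rightarrow> nat list \<Rightarrow> 'h set" where
  "specht_module scale q T lam =
     {h * (young_sum scale T (- inverse q) (conjugate_partition lam)
           * T (row_to_column lam) * young_sum scale T q lam) | h. True}"

section \<open>Representations\<close>

text \<open>
  A representation of an algebra with carrier \<open>A\<close> and unit \<open>u\<close> (which need not be the unit of the
  ambient ring) on a subspace \<open>W\<close>; \<open>act\<close> is only constrained on \<open>A\<close> and \<open>W\<close>.
\<close>
definition algebra_rep ::
  "('k::field \<Rightarrow> 'h::ring_1 \<Rightarrow> 'h) \<Rightarrow> 'h set \<Rightarrow> 'h \<Rightarrow>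
   ('k \<Rightarrow> 'w::ab_group_add \<Rightarrow> 'w) \<Rightarrow> 'w set \<Rightarrow> ('h \<Rightarrow> 'w \<Rightarrow> 'w) \<Rightarrow> bool" where
  "algebra_rep scale A u sw W act \<longleftrightarrow>
     vector_space sw \<and> module.subspace sw W \<and>
     (\<forall>a\<in>A. \<forall>w\<in>W. act a w \<in> W) \<and>
     (\<forall>a\<in>A. \<forall>v\<in>W. \<forall>w\<in>W. act a (v + w) = act a v + act a w) \<and>
     (\<forall>a\<in>A. \<forall>c. \<forall>w\<in>W. act a (sw c w) = sw c (act a w)) \<and>
     (\<forall>a\<in>A. \<forall>b\<in>A. \<forall>w\<in>W. act (a + b) w = act a w + act b w) \<and>
     (\<forall>a\<in>A. \<forall>c. \<forall>w\<in>W. act (scale c a) w = sw c (act a w)) \<and>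
     (\<forall>a\<in>A. \<forall>b\<in>A. \<forall>w\<in>W. act (a * b) w = act a (act b w)) \<and>
     (\<forall>w\<in>W. act u w = w)"

definition irreducible_rep ::
  "('k::field \<Rightarrow> 'h::ring_1 \<Rightarrow> 'h) \<Rightarrow> 'h set \<Rightarrow> 'h \<Rightarrow>
   ('k \<Rightarrow> 'w::ab_group_add \<Rightarrow> 'w) \<Rightarrow> 'w set \<Rightarrow> ('h \<Rightarrow> 'w \<Rightarrow> 'w) \<Rightarrow> bool" where
  "irreducible_rep scale A u sw W act \<longleftrightarrow>
     algebra_rep scale A u sw W act \<and> W \<noteq> {0} \<and>
     (\<forall>U. module.subspace sw U \<and> U \<subseteq> W \<and> (\<forall>a\<in>A. \<forall>v\<in>U. act a v \<in> U) \<longrightarrow> U = {0} \<or> U = W)"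

definition isomorphic_reps ::
  "'h set \<Rightarrow> ('k::field \<Rightarrow> 'v::ab_group_add \<Rightarrow> 'v) \<Rightarrow> 'v set \<Rightarrow> ('h \<Rightarrow> 'v \<Rightarrow> 'v) \<Rightarrow>
   ('k \<Rightarrow> 'w::ab_group_add \<Rightarrow> 'w) \<Rightarrow> 'w set \<Rightarrow> ('h \<Rightarrow> 'w \<Rightarrow> 'w) \<Rightarrow> bool" where
  "isomorphic_reps A sv V actV sw W actW \<longleftrightarrow>
     (\<exists>f. bij_betw f V W \<and>
        (\<forall>x\<in>V. \<forall>y\<in>V. f (x + y) = f x + f y) \<and>
        (\<forall>c. \<forall>x\<in>V. f (sv c x) = sw c (f x)) \<and>
        (\<forall>a\<in>A. \<forall>x\<in>V. f (actV a x) = actW a (f x)))"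

text \<open>
  The argument of type \<open>'w itself\<close> is the type in which the arbitrary irreducible representation
  of the last clause lives; results are meant to be stated for an arbitrary \<open>'w\<close>.
\<close>
definition complete_irreducible_reps ::
  "'w::ab_group_add itself \<Rightarrow> ('k::field \<Rightarrow> 'h::ring_1 \<Rightarrow> 'h) \<Rightarrow> 'h set \<Rightarrow> 'h \<Rightarrow>
   ('k \<Rightarrow> 'v::ab_group_add \<Rightarrow> 'v) \<Rightarrow> ('h \<Rightarrow> 'v \<Rightarrow> 'v) \<Rightarrow> 'i set \<Rightarrow> ('i \<Rightarrow> 'v set) \<Rightarrow> bool" where
  "complete_irreducible_reps _ scale A u sv act I V \<longleftrightarrow>
     (\<forall>i\<in>I. irreducible_rep scale A u sv (V i) act) \<and>
     (\<forall>i\<in>I. \<forall>j\<in>I. i \<noteq> j \<longrightarrow> \<not> isomorphic_reps A sv (V i) act sv (V j) act) \<and>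
     (\<forall>(sw :: 'k \<Rightarrow> 'w \<Rightarrow> 'w) W actW.
        irreducible_rep scale A u sw W actW \<longrightarrow>
        (\<exists>i\<in>I. isomorphic_reps A sv (V i) act sw W actW))"

section \<open>The semisimple situation\<close>

definition root_of_unity_of_order :: "nat \<Rightarrow> 'a::monoid_mult \<Rightarrow> bool" where
  "root_of_unity_of_order m x \<longleftrightarrow> 0 < m \<and> x ^ m = 1 \<and> (\<forall>k. 0 < k \<and> k < m \<longrightarrow> x ^ k \<noteq> 1)"

definition rational_function_var :: "complex poly fract" where
  "rational_function_var = Fract [:0, 1:] 1"

end

theory Submission
  imports Defs
begin

text \<open>
  Put \<open>X\<^sub>1 = 0\<close> and \<open>X\<^sub>i\<^sub>+\<^sub>1 = T\<^sub>i X\<^sub>i T\<^sub>i + T\<^sub>i\<close>, and let \<open>\<phi>\<^sub>i = T\<^sub>i X\<^sub>i - X\<^sub>i T\<^sub>i\<close> be the intertwiners.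
  An induction in the style of Okounkov and Vershik shows that, for generic \<open>q\<close>, left multiplication
  by the commuting \<open>X\<^sub>i\<close> is diagonalisable on the Hecke algebra \<open>H\<close>, with joint eigenvalues the
  content sequences of standard tableaux; tableaux of the same shape \<open>\<lambda>\<close> are connected by invertible
  intertwiners. The row reading and the column reading of \<open>\<lambda>\<close> are eigenvectors for the generators of
  the row and of the column Young subgroup, so every joint eigenvector of shape \<open>\<lambda>\<close> lies in
  \<open>H z\<^sub>\<lambda> H\<close>, where \<open>z\<^sub>\<lambda>\<close> generates the Specht module. Hence \<open>1 \<in> \<Sum>\<^sub>\<lambda> H z\<^sub>\<lambda> H\<close>. Double coset
  representatives give \<open>z\<^sub>\<lambda> H z\<^sub>\<nu> = 0\<close> for \<open>\<lambda> \<noteq> \<nu>\<close> and show that \<open>z\<^sub>\<lambda> H z\<^sub>\<lambda>\<close> is spanned by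
  \<open>z\<^sub>\<lambda> \<noteq> 0\<close>. These three facts yield irreducibility, non-isomorphism and completeness for
  \<open>e H e\<close> with any idempotent \<open>e\<close>.

  Finally \<open>e\<^sub>\<mu> H z\<^sub>\<lambda> \<noteq> 0\<close> forces \<open>\<lambda> \<ge> \<mu>\<^sup>o\<^sup>r\<^sup>d\<close> by the pigeonhole argument on double cosets.
  Conversely, filling \<open>\<lambda>\<close> by horizontal strips of sizes given by \<open>\<mu>\<close> produces a joint
  eigenvector from which a vector invariant under the Young subgroup of \<open>\<mu>\<close> is obtained.
\<close>

section \<open>Generators and relations\<close>

text \<open>Apart from \<open>q\<close> being nonzero, genericity enters only through
  \<open>quantum_nonzero\<close>: the \<open>q\<^sup>2\<close>-integers up to \<open>n\<close> do
  not vanish. They are the factors of the Poincare polynomials by which symmetrisers act on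
  invariant vectors, and, up to powers of \<open>q\<close>, the differences of eigenvalues belonging
  to contents at distance at most \<open>n\<close>. As \<open>q\<^sup>2 = 1\<close> is admissible,
  the eigenvalues \<open>q^(2c)\<close> of the multiplicative Jucys-Murphy elements could not
  separate contents. Neither structure theory of semisimple algebras nor a dimension count is needed
  to pass from the three facts to modules: since \<open>1\<close> lies in the sum of the ideals
  generated by the \<open>z\<^sub>\<lambda>\<close>, a nonzero vector is not killed by all of them,
  and since \<open>z\<^sub>\<lambda> H z\<^sub>\<lambda>\<close> is a line,
  \<open>z\<^sub>\<lambda>\<close> can be recovered from any nonzero element of
  \<open>H z\<^sub>\<lambda>\<close>. The delicate point at the end is that a symmetrised weight
  vector could vanish by cancellation. A polynomial in a single Jucys-Murphy element is used to
  isolate one invertible product of intertwiners.\<close>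

locale hecke_generators = vector_space scale
  for scale :: "'k::field \<Rightarrow> 'h::ring_1 \<Rightarrow> 'h" +
  fixes n :: nat and q :: 'k and g :: "nat \<Rightarrow> 'h"
  assumes scale_mult_left: "scale c x * y = scale c (x * y)"
    and scale_mult_right: "x * scale c y = scale c (x * y)"
    and quadratic: "Suc i < n \<Longrightarrow> g i * g i = 1 + scale (q - inverse q) (g i)"
    and braid: "Suc (Suc i) < n \<Longrightarrow> g i * g (Suc i) * g i = g (Suc i) * g i * g (Suc i)"
    and far_commute: "Suc i < j \<Longrightarrow> Suc j < n \<Longrightarrow> g i * g j = g j * g i"
    and q_nonzero: "q \<noteq> 0"
    and quantum_nonzero: "m \<in> {1..n} \<Longrightarrow> (\<Sum>j<m. q ^ (2 * j)) \<noteq> 0"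
begin

definition h :: 'k where "h = q - inverse q"

lemma quadratic': "Suc i < n \<Longrightarrow> g i * (g i * x) = x + scale h (g i * x)"
  using quadratic[of i]
  by (simp add: h_def mult.assoc[symmetric] distrib_right scale_mult_left)

lemma quadratic_h: "Suc i < n \<Longrightarrow> g i * g i = 1 + scale h (g i)"
  using quadratic[of i] by (simp add: h_def)

lemma far_commute_sym: "Suc i < j \<or> Suc j < i \<Longrightarrow> Suc i < n \<Longrightarrow> Suc j < n \<Longrightarrow> g i * g j = g j * g i"
  using far_commute[of i j] far_commute[of j i] by auto

lemmas scale_simps = scale_mult_left scale_mult_right scale_right_distrib scale_left_distrib
  scale_right_diff_distrib scale_left_diff_distrib

section \<open>Jucys--Murphy elements\<close>

text \<open>
  The multiplicative Jucys--Murphy elements are \<open>1 + scale h (X i)\<close>; the additive ones stay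
  meaningful for \<open>q\<^sup>2 = 1\<close>. Indices start at 0: \<open>g i\<close> exchanges the entries \<open>i + 1\<close> and \<open>i + 2\<close>
  of a tableau, and \<open>X i\<close> belongs to the entry \<open>i + 1\<close>.
\<close>
fun X :: "nat \<Rightarrow> 'h" where
  "X 0 = 0"
| "X (Suc i) = g i * X i * g i + g i"

lemma commute_X:
  assumes "\<And>j. j < i \<Longrightarrow> a * g j = g j * a"
  shows "a * X i = X i * a"
  using assms
proof (induction i)
  case (Suc i)
  have 1: "a * X i = X i * a" and 2: "a * g i = g i * a" using Suc by auto
  have "a * (g i * X i * g i) = (a * g i) * X i * g i" by (simp add: mult.assoc)
  also have "\<dots> = g i * (a * X i) * g i" by (simp add: 2 mult.assoc)
  also have "\<dots> = g i * X i * (a * g i)" by (simp add: 1 mult.assoc)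
  also have "\<dots> = g i * X i * g i * a" by (simp add: 2 mult.assoc)
  finally show ?case by (simp add: algebra_simps 2)
qed simp

lemma g_X_below: "j < i \<Longrightarrow> Suc i < n \<Longrightarrow> g i * X j = X j * g i"
  by (rule commute_X) (auto intro: far_commute_sym)

lemma g_X_next: "Suc i < n \<Longrightarrow> g i * X (Suc i) = X i * g i + 1 + scale h (X (Suc i))"
  by (simp add: algebra_simps quadratic_h quadratic' scale_simps)

lemma X_next_g: "Suc i < n \<Longrightarrow> X (Suc i) * g i = g i * X i + 1 + scale h (X (Suc i))"
  by (simp add: algebra_simps quadratic_h scale_simps)

text \<open>Write \<open>X (Suc (Suc i))\<close> as \<open>b a x a b\<close> plus
  \<open>b a b + b\<close>. In the first term the braid relation turns an \<open>a\<close> entering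
  from the left into a \<open>b\<close> next to \<open>x\<close>; these commute, and the second
  braid move turns \<open>b\<close> back into an \<open>a\<close> leaving on the right.\<close>

lemma g_X_skip:
  assumes n: "Suc (Suc i) < n"
  shows "g i * X (Suc (Suc i)) = X (Suc (Suc i)) * g i"
proof -
  let ?a = "g i" and ?b = "g (Suc i)" and ?x = "X i"
  have br: "?a * ?b * ?a = ?b * ?a * ?b" using braid[OF n] .
  have bx: "?b * ?x = ?x * ?b" using g_X_below[of i "Suc i"] n by simp
  have br': "?a * (?b * (?a * y)) = ?b * (?a * (?b * y))" for y
    using arg_cong[OF br, of "\<lambda>z. z * y"] by (simp add: mult.assoc)
  have 1: "?a * (?b * (?a * ?x * ?a) * ?b) = (?b * (?a * ?x * ?a) * ?b) * ?a"
  proof -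
    have "?a * (?b * (?a * ?x * ?a) * ?b) = ?b * ?a * (?b * ?x) * ?a * ?b"
      by (simp add: mult.assoc br')
    also have "\<dots> = ?b * ?a * ?x * (?b * ?a * ?b)"
      unfolding bx by (simp add: mult.assoc)
    also have "\<dots> = (?b * (?a * ?x * ?a) * ?b) * ?a"
      unfolding br[symmetric] by (simp add: mult.assoc)
    finally show ?thesis .
  qed
  have 2: "?a * (?b * ?a * ?b + ?b) = (?b * ?a * ?b + ?b) * ?a"
  proof -
    have "?a * (?b * ?a * ?b + ?b) = ?a * (?a * ?b * ?a) + ?a * ?b"
      by (simp add: br distrib_left)
    also have "\<dots> = ?b * ?a + scale h (?a * ?b * ?a) + ?a * ?b"
      using n by (simp add: mult.assoc quadratic')
    also have "\<dots> = ?a * ?b * (?a * ?a) + ?b * ?a"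
      using n by (simp add: quadratic_h distrib_left scale_simps)
    also have "\<dots> = (?b * ?a * ?b + ?b) * ?a"
      unfolding br[symmetric] distrib_right by (simp add: mult.assoc)
    finally show ?thesis .
  qed
  have "X (Suc (Suc i)) = ?b * (?a * ?x * ?a) * ?b + (?b * ?a * ?b + ?b)"
    by (simp add: algebra_simps)
  then show ?thesis using 1 2 by (simp only: distrib_left distrib_right)
qed

lemma g_X_above:
  assumes "Suc i < j" "j < n"
  shows "g i * X j = X j * g i"
  using assms
proof (induction j)
  case (Suc j)
  show ?case
  proof (cases "j = Suc i")
    case True
    then show ?thesis using g_X_skip[of i] Suc.prems by simp
  next
    case False
    then have 1: "g i * X j = X j * g i" and 2: "g i * g j = g j * g i"
      using Suc by (auto intro: far_commute_sym)
    have "g i * (g j * X j * g j) = (g i * g j) * X j * g j" by (simp add: mult.assoc)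
    also have "\<dots> = g j * (g i * X j) * g j" by (simp add: 2 mult.assoc)
    also have "\<dots> = g j * X j * (g i * g j)" by (simp add: 1 mult.assoc)
    also have "\<dots> = g j * X j * g j * g i" by (simp add: 2 mult.assoc)
    finally show ?thesis by (simp add: algebra_simps 2)
  qed
qed simp

lemma g_X_commute: "j \<noteq> i \<Longrightarrow> j \<noteq> Suc i \<Longrightarrow> Suc i < n \<Longrightarrow> j < n \<Longrightarrow> g i * X j = X j * g i"
  using g_X_below[of j i] g_X_above[of i j] by (cases "j < i") auto

lemma X_commute:
  assumes "i < n" "j < n"
  shows "X i * X j = X j * X i"
proof -
  have *: "X i * X j = X j * X i" if "i < j" "j < n" for i j
    by (rule commute_X[of i "X j", symmetric]) (use that in \<open>auto intro: g_X_above[symmetric]\<close>)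
  show ?thesis using *[of i j] *[of j i] assms by (cases i j rule: linorder_cases) auto
qed

section \<open>Intertwiners\<close>

definition phi :: "nat \<Rightarrow> 'h" where "phi i = g i * X i - X i * g i"

text \<open>In this form \<open>phi i * v = 0\<close> can be solved for \<open>g i * v\<close> when
  \<open>v\<close> is a joint eigenvector; \<open>g_eigen\<close> does so.\<close>

lemma phi_eq:
  assumes "Suc i < n"
  shows "phi i = g i * (X i - X (Suc i)) + 1 + scale h (X (Suc i))"
  using g_X_next[OF assms] by (simp add: phi_def right_diff_distrib)

lemma X_next_phi:
  assumes "Suc i < n"
  shows "X (Suc i) * phi i = phi i * X i"
proof -
  note c = X_commute[of i "Suc i"]
  have "X (Suc i) * phi i = (X (Suc i) * g i) * X i - (X (Suc i) * X i) * g i"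
    by (simp only: phi_def right_diff_distrib mult.assoc)
  also have "(X (Suc i) * X i) * g i = X i * (X (Suc i) * g i)"
    using c assms by (simp add: mult.assoc[symmetric] del: X.simps)
  also have "(X (Suc i) * g i) * X i - X i * (X (Suc i) * g i) = phi i * X i"
    unfolding X_next_g[OF assms] phi_def using c assms
    by (simp add: algebra_simps scale_simps del: X.simps)
  finally show ?thesis .
qed

lemma X_phi:
  assumes "Suc i < n"
  shows "X i * phi i = phi i * X (Suc i)"
proof -
  have c: "X i * X (Suc i) = X (Suc i) * X i" using X_commute[of i "Suc i"] assms by simp
  have "phi i * X (Suc i) = g i * (X i * X (Suc i)) - X i * (g i * X (Suc i))"
    by (simp only: phi_def left_diff_distrib mult.assoc)
  also have "\<dots> = (g i * X (Suc i)) * X i - X i * (g i * X (Suc i))"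
    by (simp only: c mult.assoc)
  also have "\<dots> = X i * phi i"
    unfolding g_X_next[OF assms] phi_def using c
    by (simp add: algebra_simps scale_simps del: X.simps)
  finally show ?thesis by simp
qed

text \<open>The square is a polynomial in \<open>X i\<close> and \<open>X (Suc i)\<close>, hence a
  scalar on joint eigenvectors. By \<open>phi_phi_weight\<close> this scalar vanishes only where the
  eigenvalues are those of neighbouring contents.\<close>

lemma phi_square:
  assumes "Suc i < n"
  shows "phi i * phi i = (1 + scale h (X i)) * (1 + scale h (X (Suc i)))
           - (X i - X (Suc i)) * (X i - X (Suc i))"
proof -
  have c: "X i * X (Suc i) = X (Suc i) * X i" using X_commute[of i "Suc i"] assms by simp
  have g: "phi i * g i = X (Suc i) - X i - (1 + scale h (X i)) * g i"
    using assms by (simp add: phi_def algebra_simps quadratic_h scale_simps)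
  have L: "phi i * (1 + scale h (X (Suc i))) = (1 + scale h (X i)) * phi i"
    using X_phi[OF assms] by (simp add: algebra_simps scale_simps del: X.simps)
  have "phi i * phi i = phi i * (g i * (X i - X (Suc i))) + phi i * (1 + scale h (X (Suc i)))"
    by (subst (2) phi_eq[OF assms]) (simp add: algebra_simps del: X.simps)
  also have "\<dots> = (phi i * g i) * (X i - X (Suc i)) + (1 + scale h (X i)) * phi i"
    by (simp only: L mult.assoc)
  also have "\<dots> = (1 + scale h (X i)) * (1 + scale h (X (Suc i)))
           - (X i - X (Suc i)) * (X i - X (Suc i))"
    unfolding g unfolding phi_eq[OF assms] by (simp add: algebra_simps scale_simps del: X.simps)
  finally show ?thesis .
qed

lemma commute_phi:
  assumes "a * g i = g i * a" "a * X i = X i * a"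
  shows "a * phi i = phi i * a"
proof -
  have "a * (g i * X i) = g i * X i * a" "a * (X i * g i) = X i * g i * a"
    by (metis assms mult.assoc)+
  then show ?thesis by (simp add: phi_def left_diff_distrib right_diff_distrib)
qed

lemma phi_X_commute: "j \<noteq> i \<Longrightarrow> j \<noteq> Suc i \<Longrightarrow> Suc i < n \<Longrightarrow> j < n \<Longrightarrow> X j * phi i = phi i * X j"
  using g_X_commute[of j i] X_commute[of j i] by (intro commute_phi) auto

lemma phi_g_commute: "Suc i < j \<Longrightarrow> Suc j < n \<Longrightarrow> g j * phi i = phi i * g j"
  using far_commute[of i j] g_X_below[of i j] by (intro commute_phi) auto

section \<open>Eigenvalues attached to contents\<close>

text \<open>This is \<open>(q\<^bsup>2c\<^esup> - 1) / (q - q\<^bsup>-1\<^esup>)\<close> whenever the denominator is non-zero.\<close>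
definition kap :: "int \<Rightarrow> 'k" where
  "kap c = (if c \<ge> 0 then q * (\<Sum>j<nat c. q ^ (2 * j))
            else - inverse q * (\<Sum>j<nat (- c). inverse q ^ (2 * j)))"

lemma kap_0 [simp]: "kap 0 = 0" by (simp add: kap_def)

lemma qh: "q * h = q\<^sup>2 - 1"
  using q_nonzero by (simp add: h_def algebra_simps power2_eq_square)

lemma kap_Suc: "kap (c + 1) = q\<^sup>2 * kap c + q"
proof (cases "c \<ge> 0")
  case True
  then have "nat (c + 1) = Suc (nat c)" by simp
  then have "(\<Sum>j<nat (c + 1). q ^ (2 * j)) = 1 + q\<^sup>2 * (\<Sum>j<nat c. q ^ (2 * j))"
    by (simp only: sum.lessThan_Suc_shift)
       (simp add: sum_distrib_left power_add power2_eq_square mult.assoc)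
  then show ?thesis using True by (simp add: kap_def algebra_simps)
next
  case False
  define m where "m = nat (- c - 1)"
  have m: "nat (- c) = Suc m" "nat (- (c + 1)) = m" using False by (auto simp: m_def)
  have "(\<Sum>j<Suc m. inverse q ^ (2 * j)) = 1 + inverse q ^ 2 * (\<Sum>j<m. inverse q ^ (2 * j))"
    by (simp only: sum.lessThan_Suc_shift)
       (simp add: sum_distrib_left power_add power2_eq_square mult.assoc)
  then have "q\<^sup>2 * kap c + q = - inverse q * (\<Sum>j<m. inverse q ^ (2 * j))"
    using False q_nonzero m(1) by (simp add: kap_def power2_eq_square field_simps)
  moreover have "kap (c + 1) = - inverse q * (\<Sum>j<m. inverse q ^ (2 * j))"
    using False m by (cases "c = -1") (auto simp: kap_def)
  ultimately show ?thesis by simp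
qed

lemma kap_pred: "kap (c - 1) = inverse q ^ 2 * kap c - inverse q"
  using kap_Suc[of "c - 1"] q_nonzero by (simp add: field_simps power2_eq_square)

text \<open>Since \<open>1 + h * kap c\<close> equals \<open>q^(2c)\<close>, this is
  multiplicativity of powers of \<open>q\<close>, divided by \<open>h\<close>. The divided form also
  covers \<open>h = 0\<close>.\<close>

lemma kap_add: "kap (c + d) = kap c + (1 + h * kap c) * kap d"
proof (induction d rule: int_induct[where k = 0])
  case (step1 i)
  have "kap (c + (i + 1)) = q\<^sup>2 * kap (c + i) + q" using kap_Suc[of "c + i"] by (simp add: add.assoc)
  also have "\<dots> = q\<^sup>2 * (kap c + (1 + h * kap c) * kap i) + q" by (simp add: step1)
  also have "\<dots> = kap c + (1 + h * kap c) * (q\<^sup>2 * kap i + q)"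
    using arg_cong[OF qh, of "\<lambda>x. x * kap c"] by (simp add: algebra_simps)
  finally show ?case by (simp add: kap_Suc)
next
  case (step2 i)
  have *: "inverse q * h = 1 - inverse q ^ 2"
    using q_nonzero by (simp add: h_def field_simps power2_eq_square)
  have "kap (c + (i - 1)) = inverse q ^ 2 * kap (c + i) - inverse q"
    using kap_pred[of "c + i"] by (simp add: add_diff_eq)
  also have "\<dots> = inverse q ^ 2 * (kap c + (1 + h * kap c) * kap i) - inverse q" by (simp add: step2)
  also have "\<dots> = kap c + (1 + h * kap c) * (inverse q ^ 2 * kap i - inverse q)"
    using arg_cong[OF *, of "\<lambda>x. x * kap c"] by (simp add: algebra_simps)
  finally show ?case by (simp add: kap_pred)
qed simp

lemma one_plus_kap: "1 + h * kap c \<noteq> 0"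
proof
  assume z: "1 + h * kap c = 0"
  have "1 + h * kap (c + d) = (1 + h * kap c) * (1 + h * kap d)" for d
    by (simp add: kap_add algebra_simps)
  from this[of "- c"] show False using z by simp
qed

text \<open>The difference \<open>kap d - kap c\<close> is \<open>q^(2c) * kap (d - c)\<close>, and
  for positive \<open>d - c\<close> the second factor is \<open>q\<close> times the
  \<open>q\<^sup>2\<close>-integer of \<open>d - c\<close>. This is where the bound \<open>n\<close>
  on distances of contents comes from.\<close>

lemma kap_eq_imp:
  assumes "kap c = kap d" "\<bar>c - d\<bar> \<le> int n"
  shows "c = d"
proof -
  have main: "d \<le> c" if "kap c = kap d" "\<bar>c - d\<bar> \<le> int n" for c d
  proof (rule ccontr)
    assume "\<not> d \<le> c"
    then have pos: "d - c > 0" by simp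
    have "kap d = kap c + (1 + h * kap c) * kap (d - c)"
      using kap_add[of c "d - c"] by simp
    then have "kap (d - c) = 0" using that one_plus_kap[of c] by simp
    moreover have "(\<Sum>j<nat (d - c). q ^ (2 * j)) \<noteq> 0"
      by (rule quantum_nonzero) (use pos that in auto)
    ultimately show False using pos q_nonzero by (simp add: kap_def)
  qed
  have "\<bar>d - c\<bar> \<le> int n" using assms(2) by (simp add: abs_minus_commute)
  then show ?thesis using main[OF assms] main[OF assms(1)[symmetric]] by simp
qed

end

section \<open>Young diagrams\<close>

type_synonym box = "nat \<times> nat"

definition box_content :: "box \<Rightarrow> int" where "box_content b = int (snd b) - int (fst b)"

definition right :: "box \<Rightarrow> box" where "right b = (fst b, Suc (snd b))"
definition down :: "box \<Rightarrow> box" where "down b = (Suc (fst b), snd b)"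

definition young_diagram :: "box set \<Rightarrow> bool" where
  "young_diagram D \<longleftrightarrow> (\<forall>r c r' c'. (r, c) \<in> D \<longrightarrow> r' \<le> r \<longrightarrow> c' \<le> c \<longrightarrow> (r', c') \<in> D)"

lemma young_diagramD: "young_diagram D \<Longrightarrow> (r, c) \<in> D \<Longrightarrow> r' \<le> r \<Longrightarrow> c' \<le> c \<Longrightarrow> (r', c') \<in> D"
  by (auto simp: young_diagram_def)

definition addable :: "box set \<Rightarrow> box \<Rightarrow> bool" where
  "addable D b \<longleftrightarrow> b \<notin> D \<and> (\<forall>b'. b = right b' \<or> b = down b' \<longrightarrow> b' \<in> D)"

lemma addable_iff:
  "addable D (r, c) \<longleftrightarrow> (r, c) \<notin> D \<and> (r > 0 \<longrightarrow> (r - 1, c) \<in> D) \<and> (c > 0 \<longrightarrow> (r, c - 1) \<in> D)"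
proof -
  have "(r, c) = down b' \<longleftrightarrow> r > 0 \<and> b' = (r - 1, c)" "(r, c) = right b' \<longleftrightarrow> c > 0 \<and> b' = (r, c - 1)" for b'
    by (cases b'; auto simp: down_def right_def)+
  then show ?thesis by (auto simp: addable_def)
qed

lemma young_diagram_insert: "young_diagram D \<Longrightarrow> addable D b \<Longrightarrow> young_diagram (insert b D)"
proof -
  assume D: "young_diagram D" and b: "addable D b"
  obtain r c where rc: "b = (r, c)" by (cases b)
  have "(r', c') \<in> insert b D" if "r' \<le> r" "c' \<le> c" for r' c'
  proof (cases "r' = r")
    case True
    then show ?thesis
      using b that young_diagramD[OF D, of r "c - 1" r' c'] by (cases "c' = c") (auto simp: rc addable_iff)
  next
    case False
    then show ?thesis
      using b that young_diagramD[OF D, of "r - 1" c r' c'] by (auto simp: rc addable_iff)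
  qed
  then show ?thesis using D by (auto simp: young_diagram_def rc)
qed

text \<open>No row has two addable boxes, and a lower addable box lies strictly further left, so
  both coordinates contribute at least one to the difference of contents.\<close>

lemma addable_content_diff:
  assumes D: "young_diagram D" and b: "addable D b" and b': "addable D b'" and ne: "b \<noteq> b'"
  shows "\<bar>box_content b - box_content b'\<bar> \<ge> 2"
proof -
  have row: False if "addable D (r, c)" "addable D (r, c')" "c < c'" for r c c'
    using that young_diagramD[OF D, of r "c' - 1" r c] by (force simp: addable_iff)
  have col: "c' < c" if "addable D (r, c)" "addable D (r', c')" "r < r'" for r c r' c'
    using that young_diagramD[OF D, of "r' - 1" c' r c] by (force simp: addable_iff)
  obtain r c r' c' where rc: "b = (r, c)" "b' = (r', c')" by (cases b, cases b')
  consider "r = r'" | "r < r'" | "r' < r" by linarith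
  then show ?thesis
    using row[of r c c'] row[of r c' c] col[of r c r' c'] col[of r' c' r c] b b' ne
    by cases (auto simp: rc box_content_def, meson linorder_neqE_nat)
qed

lemma addable_insertD:
  "addable (insert b D) b' \<Longrightarrow> b' = right b \<or> b' = down b \<or> addable D b'"
  by (auto simp: addable_def)

lemma addable_insertI: "addable D b' \<Longrightarrow> b' \<noteq> b \<Longrightarrow> addable (insert b D) b'"
  by (auto simp: addable_def)

lemma box_content_right [simp]: "box_content (right b) = box_content b + 1"
  and box_content_down [simp]: "box_content (down b) = box_content b - 1"
  by (auto simp: box_content_def right_def down_def)

text \<open>The first \<open>r\<close> boxes of the first column and the first \<open>c'\<close>
  boxes of the first row all lie in \<open>D\<close> and share at most the corner. Contents of
  addable boxes of a diagram with fewer than \<open>n\<close> boxes therefore stay within distance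
  \<open>n\<close>.\<close>

lemma addable_bound:
  assumes D: "young_diagram D" "finite D" and b: "addable D (r, c)" and b': "addable D (r', c')"
  shows "r + c' \<le> Suc (card D)"
proof -
  let ?A = "(\<lambda>i. (i, 0 :: nat)) ` {..<r}" and ?B = "(\<lambda>j. (0 :: nat, j)) ` {..<c'}"
  have A: "?A \<subseteq> D"
    using b young_diagramD[OF D(1), of "r - 1" c] by (auto simp: addable_iff)
  have B: "?B \<subseteq> D"
    using b' young_diagramD[OF D(1), of r' "c' - 1"] by (auto simp: addable_iff)
  have "r + c' = card ?A + card ?B" by (simp add: card_image inj_on_def)
  also have "\<dots> = card (?A \<union> ?B) + card (?A \<inter> ?B)" by (rule card_Un_Int) auto
  finally have *: "r + c' = card (?A \<union> ?B) + card (?A \<inter> ?B)" .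
  have "?A \<inter> ?B \<subseteq> {(0, 0)}" by auto
  then have "card (?A \<inter> ?B) \<le> 1" using card_mono[of "{(0::nat, 0::nat)}"] by fastforce
  moreover have "card (?A \<union> ?B) \<le> card D" using A B by (intro card_mono D) auto
  ultimately show ?thesis using * by linarith
qed

lemma addable_content_bound:
  assumes "young_diagram D" "finite D" "addable D b" "addable D b'"
  shows "\<bar>box_content b - box_content b'\<bar> \<le> int (card D) + 1"
proof -
  obtain r c r' c' where "b = (r, c)" "b' = (r', c')" by (cases b, cases b')
  then show ?thesis
    using addable_bound[OF assms(1,2), of r c r' c'] addable_bound[OF assms(1,2), of r' c' r c] assms(3,4)
    by (auto simp: box_content_def)
qed

section \<open>Standard tableaux\<close>

text \<open>A standard tableau is recorded as the list of its boxes in the order of their entries.\<close>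
definition std :: "box list \<Rightarrow> bool" where
  "std bs \<longleftrightarrow> (\<forall>i<length bs. addable (set (take i bs)) (bs ! i))"

lemma std_Nil [simp]: "std []" by (simp add: std_def)

lemma std_snoc [simp]: "std (bs @ [b]) \<longleftrightarrow> std bs \<and> addable (set bs) b"
  by (auto simp: std_def nth_append less_Suc_eq)

lemma std_append: "std (as @ bs) \<Longrightarrow> std as"
  by (induction bs rule: rev_induct) (auto simp flip: append_assoc)

lemma std_young_diagram: "std bs \<Longrightarrow> young_diagram (set bs)"
  by (induction bs rule: rev_induct) (auto simp: young_diagram_insert, simp add: young_diagram_def)

lemma std_distinct: "std bs \<Longrightarrow> distinct bs"
  by (induction bs rule: rev_induct) (auto simp: addable_def)

lemma std_card: "std bs \<Longrightarrow> card (set bs) = length bs"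
  by (simp add: std_distinct distinct_card)

lemma std_append_cong:
  assumes "set as = set as'" "std as'" "std (as @ cs)"
  shows "std (as' @ cs)"
  using assms(3) by (induction cs rule: rev_induct) (auto simp flip: append_assoc simp: assms)

text \<open>If \<open>b'\<close> does not touch \<open>b\<close>, both boxes are already addable to
  \<open>as\<close>. The resulting gap of two between the contents is what makes the intertwiner
  invertible in \<open>move_right\<close>.\<close>

lemma std_swap:
  assumes "std (as @ b # b' # cs)" "b' \<noteq> right b" "b' \<noteq> down b"
  shows "std (as @ b' # b # cs)" "\<bar>box_content b - box_content b'\<bar> \<ge> 2"
    "addable (set as) b" "addable (set as) b'"
proof -
  have s: "std ((as @ [b]) @ [b'])" using std_append[of "as @ [b, b']" cs] assms(1) by simp
  then show b: "addable (set as) b" and b': "addable (set as) b'"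
    using assms addable_insertD[of b "set as" b'] by (auto simp del: append_assoc)
  have ne: "b \<noteq> b'" using s by (auto simp: addable_def simp del: append_assoc)
  have "young_diagram (set as)" using std_young_diagram[OF std_append] assms(1) by blast
  from addable_content_diff[OF this b b' ne] show "\<bar>box_content b - box_content b'\<bar> \<ge> 2" .
  have "std as" using std_append assms(1) by blast
  then have "std (as @ [b', b])"
    using std_snoc[of "as @ [b']" b] b b' ne addable_insertI[of "set as" b b'] by simp
  then show "std (as @ b' # b # cs)"
    using std_append_cong[of "as @ [b, b']" "as @ [b', b]" cs] assms(1) by auto
qed

section \<open>The joint spectrum of the Jucys-Murphy elements\<close>

context hecke_generators
begin

declare X.simps(2) [simp del]

section \<open>Weight vectors\<close>

definition weight :: "box list \<Rightarrow> 'h \<Rightarrow> bool" where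
  "weight bs v \<longleftrightarrow> (\<forall>i<length bs. X i * v = scale (kap (box_content (bs ! i))) v)"

lemma weight_Nil [simp]: "weight [] v" by (simp add: weight_def)

lemma weight_snoc [simp]:
  "weight (bs @ [b]) v \<longleftrightarrow> weight bs v \<and> X (length bs) * v = scale (kap (box_content b)) v"
  by (auto simp: weight_def nth_append less_Suc_eq)

lemma weight_append: "weight (as @ bs) v \<Longrightarrow> weight as v"
  by (auto simp: weight_def nth_append)

lemma weight_mult:
  assumes "weight bs v" "\<And>i. i < length bs \<Longrightarrow> a * X i = X i * a"
  shows "weight bs (a * v)"
  unfolding weight_def
proof (intro allI impI)
  fix i assume i: "i < length bs"
  have "X i * (a * v) = a * (X i * v)" by (simp add: assms(2)[OF i] flip: mult.assoc)
  also have "\<dots> = scale (kap (box_content (bs ! i))) (a * v)"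
    using assms(1) i by (simp add: weight_def scale_mult_right)
  finally show "X i * (a * v) = scale (kap (box_content (bs ! i))) (a * v)" .
qed

lemma X_phi_v: "Suc i < n \<Longrightarrow> X (Suc i) * v = scale c v \<Longrightarrow> X i * (phi i * v) = scale c (phi i * v)"
  by (simp only: mult.assoc[symmetric] X_phi) (simp only: mult.assoc scale_mult_right)

lemma X_next_phi_v: "Suc i < n \<Longrightarrow> X i * v = scale c v \<Longrightarrow> X (Suc i) * (phi i * v) = scale c (phi i * v)"
  by (simp only: mult.assoc[symmetric] X_next_phi) (simp only: mult.assoc scale_mult_right)

lemma weight_swap:
  assumes "weight (as @ b # b' # cs) v" "length (as @ b # b' # cs) \<le> n"
  shows "weight (as @ b' # b # cs) (phi (length as) * v)"
  unfolding weight_def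
proof (intro allI impI)
  let ?i = "length as"
  fix k assume k: "k < length (as @ b' # b # cs)"
  have i: "Suc ?i < n" using assms(2) by simp
  have w: "X j * v = scale (kap (box_content ((as @ b # b' # cs) ! j))) v" if "j < length (as @ b # b' # cs)" for j
    using assms(1) that by (simp add: weight_def)
  consider "k = ?i" | "k = Suc ?i" | "k \<noteq> ?i" "k \<noteq> Suc ?i" by blast
  then show "X k * (phi ?i * v) = scale (kap (box_content ((as @ b' # b # cs) ! k))) (phi ?i * v)"
  proof cases
    case 1
    then show ?thesis using X_phi_v[OF i w[of "Suc ?i"]] by (simp add: nth_append)
  next
    case 2
    then show ?thesis using X_next_phi_v[OF i w[of ?i]] by (simp add: nth_append)
  next
    case 3
    then have e: "(as @ b' # b # cs) ! k = (as @ b # b' # cs) ! k"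
      by (cases "k < ?i") (auto simp: nth_append nth_Cons split: nat.splits)
    have "X k * (phi ?i * v) = phi ?i * (X k * v)"
      using phi_X_commute[of k ?i] 3 i k assms(2) by (simp flip: mult.assoc)
    then show ?thesis using w[of k] k by (simp add: e scale_mult_right)
  qed
qed

text \<open>Here \<open>v\<close> need not be an eigenvector of \<open>X (Suc i)\<close>. For
  \<open>a = kap c\<close> the two subtracted scalars are \<open>kap (c + 1)\<close> and
  \<open>kap (c - 1)\<close>, so the square of the intertwiner is minus a product of two linear
  factors in \<open>X (Suc i)\<close>; \<open>branching_step\<close> reads this as an annihilating
  polynomial.\<close>

lemma phi_phi_v:
  assumes i: "Suc i < n" and v: "X i * v = scale a v"
  shows "phi i * (phi i * v) =
    - (X (Suc i) * (X (Suc i) * v - scale (q\<^sup>2 * a + q) v)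
       - scale (inverse q ^ 2 * a - inverse q) (X (Suc i) * v - scale (q\<^sup>2 * a + q) v))"
proof -
  let ?Y = "X (Suc i)"
  have c: "X i * ?Y = ?Y * X i" using X_commute[of i "Suc i"] i by simp
  have 1: "(1 + scale h (X i)) * w = scale (1 + h * a) w" if "X i * w = scale a w" for w
    using that by (simp add: algebra_simps scale_simps)
  have 2: "(X i - ?Y) * w = scale a w - ?Y * w" if "X i * w = scale a w" for w
    using that by (simp add: algebra_simps)
  have Y: "X i * (?Y * w) = scale a (?Y * w)" if "X i * w = scale a w" for w
  proof -
    have "X i * (?Y * w) = ?Y * (X i * w)" by (simp only: c mult.assoc[symmetric])
    then show ?thesis using that by (simp only: scale_mult_right)
  qed
  have sc: "X i * scale b w = scale a (scale b w)" if "X i * w = scale a w" for b w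
    using that by (simp add: scale_simps mult.commute)
  have "phi i * (phi i * v) = ((1 + scale h (X i)) * (1 + scale h ?Y) - (X i - ?Y) * (X i - ?Y)) * v"
    using phi_square[OF i] by (simp add: mult.assoc[symmetric])
  also have "\<dots> = (1 + scale h (X i)) * (v + scale h (?Y * v)) - (X i - ?Y) * ((X i - ?Y) * v)"
    by (simp only: left_diff_distrib distrib_right mult.assoc scale_mult_left) simp
  also have "\<dots> = scale (1 + h * a) (v + scale h (?Y * v)) - (scale a (scale a v - ?Y * v) - ?Y * (scale a v - ?Y * v))"
  proof -
    have "X i * (v + scale h (?Y * v)) = scale a (v + scale h (?Y * v))"
      using v Y[OF v] sc[OF Y[OF v]] by (simp add: distrib_left scale_right_distrib)
    moreover have "X i * (scale a v - ?Y * v) = scale a (scale a v - ?Y * v)"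
      using sc[OF v] Y[OF v] by (simp add: right_diff_distrib scale_right_diff_distrib)
    ultimately show ?thesis by (simp only: 1 2 v)
  qed
  also have "\<dots> = scale (1 + h * a - a * a) v + scale (h + h * h * a + (a + a)) (?Y * v) - ?Y * (?Y * v)"
    by (simp add: algebra_simps scale_simps)
       (metis mult_2 mult_2_right scale_left_distrib)
  \<comment> \<open>The next two identities factor the quadratic polynomial in \<open>?Y\<close>:
    they give the product and the sum of its roots.\<close>
  also have "1 + h * a - a * a = - ((inverse q ^ 2 * a - inverse q) * (q\<^sup>2 * a + q))"
    using q_nonzero by (simp add: h_def field_simps power2_eq_square)
  also have "h + h * h * a + (a + a) = (inverse q ^ 2 * a - inverse q) + (q\<^sup>2 * a + q)"
    using q_nonzero by (simp add: h_def field_simps power2_eq_square)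
  finally show ?thesis
    by (simp add: algebra_simps scale_simps)
qed

lemma phi_phi_weight:
  assumes "Suc i < n" "X i * v = scale (kap c) v" "X (Suc i) * v = scale (kap d) v"
  shows "phi i * (phi i * v) = scale (- ((kap d - kap (c + 1)) * (kap d - kap (c - 1)))) v"
  unfolding phi_phi_v[OF assms(1,2)] kap_Suc kap_pred
  using assms(3) by (simp add: algebra_simps scale_simps)

text \<open>By \<open>phi_eq\<close>, \<open>g i * v\<close> is determined by a ratio of
  \<open>1 + h * kap d\<close> and \<open>kap d - kap c\<close>. For neighbouring contents this
  ratio is one of the two roots of the quadratic relation.\<close>

lemma g_eigen:
  assumes i: "Suc i < n" and c: "X i * v = scale (kap c) v"
    and d: "X (Suc i) * v = scale (kap d) v" and phi: "phi i * v = 0"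
  shows "d = c + 1 \<Longrightarrow> g i * v = scale q v" "d = c - 1 \<Longrightarrow> g i * v = scale (- inverse q) v"
proof -
  let ?u = "1 + h * kap c"
  have *: "scale (kap c - kap d) (g i * v) + scale (1 + h * kap d) v = 0"
    using phi c d unfolding phi_eq[OF i]
    by (simp add: algebra_simps scale_simps)
  have cancel: "x = y" if "scale a x = scale a y" "a \<noteq> 0" for a x y
    using that by simp
  show "g i * v = scale q v" if "d = c + 1"
  proof -
    have 1: "kap c - kap d = - (q * ?u)" and 2: "1 + h * kap d = q * ?u * q"
      using q_nonzero unfolding that kap_Suc by (simp_all add: h_def field_simps power2_eq_square)
    have "scale (q * ?u) (g i * v) = scale (q * ?u) (scale q v)"
      using * unfolding 1 2 by simp
    then show ?thesis by (rule cancel) (simp add: q_nonzero one_plus_kap)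
  qed
  show "g i * v = scale (- inverse q) v" if "d = c - 1"
  proof -
    have 1: "kap c - kap d = inverse q * ?u" and 2: "1 + h * kap d = inverse q * ?u * inverse q"
      using q_nonzero unfolding that kap_pred by (simp_all add: h_def field_simps power2_eq_square)
    have "scale (inverse q * ?u) (g i * v) = scale (inverse q * ?u) (scale (- inverse q) v)"
      using * unfolding 1 2 by (simp add: eq_neg_iff_add_eq_0)
    then show ?thesis by (rule cancel) (simp add: q_nonzero one_plus_kap)
  qed
qed

section \<open>Diagonalisation\<close>

text \<open>The monic polynomial with roots \<open>kap x\<close>, evaluated at \<open>a\<close> and
  applied to \<open>v\<close>. The list records contents, so that roots can be compared with
  boxes.\<close>

primrec ann :: "'h \<Rightarrow> int list \<Rightarrow> 'h \<Rightarrow> 'h" where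
  "ann a [] v = v"
| "ann a (x # xs) v = a * ann a xs v - scale (kap x) (ann a xs v)"

lemma ann_add: "ann a xs (v + w) = ann a xs v + ann a xs w"
  by (induction xs) (auto simp: algebra_simps scale_simps)

lemma ann_0 [simp]: "ann a xs 0 = 0" by (induction xs) auto

lemma ann_sum: "ann a xs (\<Sum>x\<in>S. f x) = (\<Sum>x\<in>S. ann a xs (f x))"
  by (induction S rule: infinite_finite_induct) (auto simp: ann_add)

lemma ann_eigen: "a * v = scale c v \<Longrightarrow> ann a xs v = scale (\<Prod>x\<leftarrow>xs. c - kap x) v"
  by (induction xs) (auto simp: scale_simps mult.commute left_diff_distrib)

lemma ann_intertwine: "a * p = p * b \<Longrightarrow> ann a xs (p * v) = p * ann b xs v"
  by (induction xs) (auto simp: algebra_simps scale_simps, metis mult.assoc)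

lemma ann_append: "ann a (xs @ ys) v = ann a xs (ann a ys v)"
  by (induction xs) auto

lemma ann_sum_eigen:
  assumes "\<And>x. x \<in> S \<Longrightarrow> a * u x = scale (kap x) (u x)" "S \<subseteq> set xs"
  shows "ann a xs (\<Sum>x\<in>S. u x) = 0"
  unfolding ann_sum
proof (rule sum.neutral, rule ballI)
  fix x assume x: "x \<in> S"
  then have "(\<Prod>y\<leftarrow>xs. kap x - kap y) = 0" using assms(2) by (force simp: prod_list_zero_iff)
  then show "ann a xs (u x) = 0" using ann_eigen[OF assms(1)[OF x], of xs] by simp
qed

lemma ann_eigen_eq_0:
  assumes "ann a xs v = 0" "a * v = scale (kap c) v" "\<And>x. x \<in> set xs \<Longrightarrow> kap x \<noteq> kap c"
  shows "v = 0"
proof -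
  have "(\<Prod>x\<leftarrow>xs. kap c - kap x) \<noteq> 0" using assms(3) by (force simp: prod_list_zero_iff)
  then show ?thesis using assms(1) ann_eigen[OF assms(2), of xs] by simp
qed

text \<open>Lagrange interpolation: a polynomial with distinct roots that annihilates
  \<open>v\<close> splits \<open>v\<close> into eigenvectors. The multipliers \<open>p\<close>
  commute with all that commutes with \<open>a\<close>, so each component keeps the eigenvalues
  which \<open>v\<close> has for operators commuting with \<open>a\<close>.\<close>

lemma ann_split:
  assumes "inj_on kap (set xs)" "distinct xs" "ann a xs v = 0"
  shows "\<exists>u. v = (\<Sum>x\<in>set xs. u x) \<and> (\<forall>x\<in>set xs. a * u x = scale (kap x) (u x) \<and>
           (\<exists>p. u x = p * v \<and> (\<forall>b. a * b = b * a \<longrightarrow> p * b = b * p)))"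
  using assms
proof (induction xs arbitrary: v)
  case Nil
  then show ?case by simp
next
  case (Cons y xs)
  let ?C = "\<lambda>p. \<forall>b. a * b = b * a \<longrightarrow> p * b = b * p"
  define e where "e = a - scale (kap y) 1"
  have e: "e * w = a * w - scale (kap y) w" for w by (simp add: e_def left_diff_distrib scale_simps)
  have eC: "?C e" by (simp add: e_def algebra_simps scale_simps)
  have "ann a xs (e * v) = 0"
    using Cons.prems(3) ann_intertwine[of a e a xs v] eC by (simp add: e)
  with Cons.IH[of "e * v"] Cons.prems obtain u where
    u: "e * v = (\<Sum>x\<in>set xs. u x)"
       "\<And>x. x \<in> set xs \<Longrightarrow> a * u x = scale (kap x) (u x)"
       "\<And>x. x \<in> set xs \<Longrightarrow> \<exists>p. u x = p * (e * v) \<and> ?C p"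
    by (auto simp: inj_on_insert)
  from u(3) obtain p where p: "\<And>x. x \<in> set xs \<Longrightarrow> u x = p x * (e * v)" "\<And>x. x \<in> set xs \<Longrightarrow> ?C (p x)"
    by metis
  \<comment> \<open>On the \<open>x\<close> component, \<open>e\<close> acts by
    \<open>kap x - kap y\<close>; dividing by it undoes the passage from \<open>v\<close> to
    \<open>e * v\<close>.\<close>
  define r where "r x = scale (inverse (kap x - kap y)) (p x * e)" for x
  have rC: "?C (r x)" if "x \<in> set xs" for x
  proof (intro allI impI)
    fix b assume b: "a * b = b * a"
    have "p x * e * b = p x * (b * e)" using eC b by (simp add: mult.assoc)
    also have "\<dots> = b * (p x * e)" using p(2)[OF that] b by (simp flip: mult.assoc)
    finally show "r x * b = b * r x" by (simp add: r_def scale_mult_left scale_mult_right)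
  qed
  have rv: "r x * v = scale (inverse (kap x - kap y)) (u x)" if "x \<in> set xs" for x
    using p(1)[OF that] by (simp add: r_def scale_simps mult.assoc)
  have ry: "a * (r x * v) = scale (kap x) (r x * v)" if "x \<in> set xs" for x
    by (simp add: rv[OF that] u(2)[OF that] scale_simps mult.commute)
  \<comment> \<open>What remains of \<open>v\<close> after the other components are removed is
    killed by \<open>e\<close>, so it is the component for \<open>y\<close>.\<close>
  define s where "s = 1 - (\<Sum>x\<in>set xs. r x)"
  have sC: "?C s" using rC by (auto simp: s_def algebra_simps sum_distrib_left sum_distrib_right)
  have ne: "kap x \<noteq> kap y" if "x \<in> set xs" for x
    using Cons.prems(1,2) that by (auto simp: inj_on_def)
  have "e * (r x * v) = u x" if "x \<in> set xs" for x
    unfolding e ry[OF that] using ne[OF that]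
    by (simp add: rv[OF that] flip: scale_left_diff_distrib) (simp flip: left_diff_distrib)
  then have "e * (\<Sum>x\<in>set xs. r x * v) = (\<Sum>x\<in>set xs. u x)"
    by (simp add: sum_distrib_left)
  then have "e * (s * v) = 0"
    by (simp add: s_def left_diff_distrib right_diff_distrib sum_distrib_right u(1))
  then have sy: "a * (s * v) = scale (kap y) (s * v)" by (simp add: e)
  have y: "y \<notin> set xs" using Cons.prems by simp
  define w where "w = (\<lambda>x. if x = y then s * v else r x * v)"
  have "(\<Sum>x\<in>set (y # xs). w x) = s * v + (\<Sum>x\<in>set xs. r x * v)"
    using y by (auto simp: w_def intro!: sum.cong)
  also have "\<dots> = v" by (simp add: s_def left_diff_distrib sum_distrib_right)
  finally have "v = (\<Sum>x\<in>set (y # xs). w x)" by simp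
  moreover have "a * w x = scale (kap x) (w x) \<and> (\<exists>p. w x = p * v \<and> ?C p)" if "x \<in> set (y # xs)" for x
    using that sy ry sC rC unfolding w_def by auto
  ultimately show ?case by blast
qed

section \<open>Branching\<close>

text \<open>The branching rule in spectral form: the next Jucys-Murphy element only takes
  eigenvalues that extend the tableau to a standard one. Stating it by an annihilating product with
  simple roots includes diagonalisability.\<close>

definition branching :: "nat \<Rightarrow> bool" where
  "branching k \<longleftrightarrow> (\<forall>bs v. length bs = k \<longrightarrow> std bs \<longrightarrow> weight bs v \<longrightarrow>
     (\<exists>xs. distinct xs \<and> set xs \<subseteq> box_content ` Collect (addable (set bs)) \<and> ann (X k) xs v = 0))"

lemma branchingD:
  assumes "branching (length bs)" "std bs" "weight bs v"
  obtains xs where "distinct xs" "set xs \<subseteq> box_content ` Collect (addable (set bs))" "ann (X (length bs)) xs v = 0"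
  using assms unfolding branching_def by blast

lemma branching_vanish:
  assumes br: "branching (length bs)" and n: "Suc (length bs) < n" and bs: "std bs" "weight bs v"
    and X: "X (length bs) * v = scale (kap x) v" and b: "addable (set bs) b" and x: "\<bar>x - box_content b\<bar> = 1"
  shows "v = 0"
proof -
  obtain xs where xs: "set xs \<subseteq> box_content ` Collect (addable (set bs))" "ann (X (length bs)) xs v = 0"
    using branchingD[OF br bs] by metis
  show ?thesis
  proof (rule ann_eigen_eq_0[OF xs(2) X])
    fix y assume "y \<in> set xs"
    then obtain b' where b': "addable (set bs) b'" and y: "y = box_content b'" using xs(1) by auto
    have "\<bar>box_content b - box_content b'\<bar> \<le> int (length bs) + 1"
      using addable_content_bound[OF std_young_diagram[OF bs(1)] _ b b'] std_card[OF bs(1)] by simp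
    then have "\<bar>y - x\<bar> \<le> int n" using n x by (simp add: y)
    moreover have "x \<noteq> y"
      using addable_content_diff[OF std_young_diagram[OF bs(1)] b b'] x by (cases "b = b'") (auto simp: y)
    ultimately show "kap y \<noteq> kap x" using kap_eq_imp by blast
  qed
qed

text \<open>The vector \<open>phi (length bs) * v\<close> would have the content \<open>x\<close> in
  the place of \<open>b\<close>. But \<open>b\<close> is addable to \<open>bs\<close>, and no
  addable box has a content next to that of \<open>b\<close>.\<close>

lemma phi_vanish:
  assumes br: "branching (length bs)" and n: "Suc (length bs) < n" and bs: "std (bs @ [b])" "weight (bs @ [b]) v"
    and X: "X (Suc (length bs)) * v = scale (kap x) v" and x: "\<bar>x - box_content b\<bar> = 1"
  shows "phi (length bs) * v = 0"
proof (rule branching_vanish[OF br n])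
  show "std bs" "addable (set bs) b" using bs(1) by auto
  show "weight bs (phi (length bs) * v)"
    by (rule weight_mult) (use bs(2) phi_X_commute[of _ "length bs"] n in auto)
  show "X (length bs) * (phi (length bs) * v) = scale (kap x) (phi (length bs) * v)"
    using X_phi_v[OF n X] .
qed (fact x)

text \<open>The Okounkov-Vershik obstruction to the pattern \<open>x, x + 1, x\<close> or
  \<open>x, x - 1, x\<close> of contents: consecutive generators would act on \<open>v\<close> by
  \<open>a\<close> and \<open>- inverse a\<close>, and the braid relation would force
  \<open>a\<^sup>2 = - 1\<close>, against the \<open>q\<^sup>2\<close>-integer of 2 being
  nonzero.\<close>

lemma braid_clash:
  assumes i: "Suc (Suc i) < n"
    and v: "X i * v = scale (kap x) v" "X (Suc i) * v = scale (kap y) v" "X (Suc (Suc i)) * v = scale (kap x) v"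
    and xy: "\<bar>x - y\<bar> = 1" and phi: "phi i * v = 0" "phi (Suc i) * v = 0"
  shows "v = 0"
proof -
  have main: "v = 0" if a: "g i * v = scale a v" and b: "g (Suc i) * v = scale (- inverse a) v"
    and a0: "a \<noteq> 0" and a2: "a\<^sup>2 + 1 \<noteq> 0" for a
  proof -
    let ?s = "g i" and ?t = "g (Suc i)"
    have "?s * (?t * (?s * v)) = ?t * (?s * (?t * v))" using braid[OF i] by (metis mult.assoc)
    then have "scale (- a) v = scale (inverse a) v"
      using a0 by (simp add: a b scale_simps)
    then have "scale (inverse a + a) v = 0"
      unfolding scale_left_distrib by (metis add.commute neg_eq_iff_add_eq_0 scale_minus_left)
    moreover have "inverse a + a \<noteq> 0" using a0 a2 by (simp add: field_simps power2_eq_square add.commute)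
    ultimately show ?thesis by simp
  qed
  have "(\<Sum>j<2. q ^ (2 * j)) \<noteq> 0" by (rule quantum_nonzero) (use i in auto)
  then have q2: "q\<^sup>2 + 1 \<noteq> 0" by (simp add: numeral_2_eq_2 add.commute)
  have i': "Suc i < n" using i by simp
  consider "y = x + 1" "x = y - 1" | "y = x - 1" "x = y + 1" using xy by linarith
  then show ?thesis
  proof cases
    case 1
    have "g i * v = scale q v" "g (Suc i) * v = scale (- inverse q) v"
      using g_eigen(1)[OF i' v(1,2) phi(1) 1(1)] g_eigen(2)[OF i v(2,3) phi(2) 1(2)] .
    then show ?thesis using main[of q] q2 q_nonzero by simp
  next
    case 2
    have "(- inverse q)\<^sup>2 + 1 \<noteq> 0" using q2 q_nonzero by (simp add: field_simps)
    moreover have "g i * v = scale (- inverse q) v" "g (Suc i) * v = scale q v"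
      using g_eigen(2)[OF i' v(1,2) phi(1) 2(1)] g_eigen(1)[OF i v(2,3) phi(2) 2(2)] .
    ultimately show ?thesis
      using main[of "- inverse q"] q_nonzero by simp
  qed
qed

section \<open>Moving between standard tableaux of the same shape\<close>

text \<open>Satisfied by operations that only rearrange the first \<open>N\<close> entries; they
  leave the eigenvalues at later positions intact.\<close>

definition centralizing :: "nat \<Rightarrow> 'h \<Rightarrow> bool" where
  "centralizing N a \<longleftrightarrow> (\<forall>j\<ge>N. (Suc j < n \<longrightarrow> g j * a = a * g j) \<and> (j < n \<longrightarrow> X j * a = a * X j))"

lemma centralizing_1: "centralizing N 1" by (simp add: centralizing_def)

lemma centralizing_mult:
  assumes "centralizing N a" "centralizing N b" shows "centralizing N (a * b)"
proof -
  have "y * (a * b) = a * b * y" if "y * a = a * y" "y * b = b * y" for y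
    using that by (metis mult.assoc)
  then show ?thesis using assms by (simp add: centralizing_def)
qed

lemma centralizing_mono: "centralizing N a \<Longrightarrow> N \<le> N' \<Longrightarrow> centralizing N' a"
  by (simp add: centralizing_def)

lemma centralizing_phi: "Suc (Suc i) \<le> N \<Longrightarrow> Suc i < n \<Longrightarrow> centralizing N (phi i)"
  unfolding centralizing_def using phi_X_commute[of _ i] phi_g_commute[of i] by auto

text \<open>The product \<open>phi (i + m - 1) ... phi i\<close>, which carries the box at position
  \<open>i\<close> past the next \<open>m\<close> boxes.\<close>

primrec psi :: "nat \<Rightarrow> nat \<Rightarrow> 'h" where
  "psi i 0 = 1"
| "psi i (Suc m) = psi (Suc i) m * phi i"

lemma centralizing_psi: "Suc (i + m) \<le> N \<Longrightarrow> i + m < n \<Longrightarrow> centralizing N (psi i m)"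
proof (induction m arbitrary: i)
  case 0
  then show ?case by (simp add: centralizing_1)
next
  case (Suc m)
  have "centralizing N (psi (Suc i) m)" using Suc by simp
  moreover have "centralizing N (phi i)" using Suc.prems by (intro centralizing_phi) auto
  ultimately show ?case by (simp add: centralizing_mult)
qed

text \<open>At each exchange the contents of \<open>b\<close> and of the box it passes differ by at
  least 2, so the intertwiner squares to a nonzero scalar and can be undone on
  \<open>v\<close>.\<close>

lemma move_right:
  assumes "std (as @ b # cs @ ds)" "length (as @ b # cs @ ds) \<le> n"
    and "right b \<notin> set cs" "down b \<notin> set cs"
  shows "std (as @ cs @ b # ds) \<and> (\<forall>v. weight (as @ b # cs @ ds) v \<longrightarrow>
     weight (as @ cs @ b # ds) (psi (length as) (length cs) * v) \<and>
     (\<exists>a. a * (psi (length as) (length cs) * v) = v))"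
  using assms
proof (induction cs arbitrary: as)
  case Nil
  then show ?case by (auto intro: exI[of _ 1])
next
  case (Cons c cs)
  let ?i = "length as"
  have c: "c \<noteq> right b" "c \<noteq> down b" using Cons.prems by auto
  note s = std_swap[of as b c "cs @ ds", OF _ c]
  have i: "Suc ?i < n" using Cons.prems by simp
  have "std ((as @ [c]) @ b # cs @ ds)" using s(1) Cons.prems by simp
  then have IH: "std (as @ c # cs @ b # ds)"
    "\<And>v. weight (as @ c # b # cs @ ds) v \<Longrightarrow>
     weight (as @ c # cs @ b # ds) (psi (Suc ?i) (length cs) * v)"
    "\<And>v. weight (as @ c # b # cs @ ds) v \<Longrightarrow> (\<exists>a. a * (psi (Suc ?i) (length cs) * v) = v)"
    using Cons.IH[of "as @ [c]"] Cons.prems by auto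
  have "\<exists>a. a * (psi ?i (length (c # cs)) * v) = v"
    if v: "weight (as @ b # c # cs @ ds) v" for v
  proof -
    from IH(3)[OF weight_swap[OF v]] Cons.prems obtain a
      where a: "a * (psi (Suc ?i) (length cs) * (phi ?i * v)) = phi ?i * v" by auto
    let ?x = "box_content b" and ?y = "box_content c"
    let ?\<gamma> = "- ((kap ?y - kap (?x + 1)) * (kap ?y - kap (?x - 1)))"
    have w: "X j * v = scale (kap (box_content ((as @ b # c # cs @ ds) ! j))) v" if "j < length as + 2" for j
      using v that by (simp add: weight_def)
    have pp: "phi ?i * (phi ?i * v) = scale ?\<gamma> v"
      using phi_phi_weight[OF i, of v ?x ?y] w[of ?i] w[of "Suc ?i"] by (simp add: nth_append)
    have as: "std as" using std_append Cons.prems(1) by blast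
    have "\<bar>?x - ?y\<bar> \<le> int (length as) + 1"
      using addable_content_bound[OF std_young_diagram[OF as] _ s(3,4)] Cons.prems std_card[OF as] by simp
    then have "\<bar>?y - (?x + 1)\<bar> \<le> int n" "\<bar>?y - (?x - 1)\<bar> \<le> int n" using i by auto
    then have "?\<gamma> \<noteq> 0" using kap_eq_imp[of ?y "?x + 1"] kap_eq_imp[of ?y "?x - 1"] s(2) Cons.prems(1) by auto
    then have inv: "inverse ?\<gamma> * ?\<gamma> = 1" by (rule left_inverse)
    have "scale (inverse ?\<gamma>) (phi ?i * (a * (psi (Suc ?i) (length cs) * (phi ?i * v)))) = v"
      unfolding a pp scale_scale inv by (rule scale_one)
    then have "(scale (inverse ?\<gamma>) (phi ?i) * a) * (psi ?i (length (c # cs)) * v) = v"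
      by (simp add: mult.assoc scale_mult_left)
    then show ?thesis by blast
  qed
  moreover have "weight (as @ c # cs @ b # ds) (psi ?i (length (c # cs)) * v)"
    if v: "weight (as @ b # c # cs @ ds) v" for v
    using IH(2)[OF weight_swap[OF v]] Cons.prems by (simp add: mult.assoc)
  ultimately show ?case using IH(1) by auto
qed

text \<open>The transfer \<open>a\<close> may depend on \<open>v\<close>, and only has to be undone
  on \<open>v\<close> itself. The last condition lets further boxes be appended to both
  tableaux.\<close>

definition linked :: "nat \<Rightarrow> box list \<Rightarrow> box list \<Rightarrow> bool" where
  "linked N bs bs' \<longleftrightarrow> (\<forall>v. weight bs v \<longrightarrow>
     (\<exists>a a'. weight bs' (a * v) \<and> a' * (a * v) = v \<and> centralizing N a))"

lemma linkedE:
  assumes "linked N bs bs'" "weight bs v"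
  obtains a a' where "weight bs' (a * v)" "a' * (a * v) = v" "centralizing N a"
  using assms unfolding linked_def by blast

lemma linked_refl: "linked N bs bs"
  unfolding linked_def using centralizing_1 by (metis mult_1)

lemma linked_trans:
  assumes "linked N bs bs'" "linked N bs' bs''"
  shows "linked N bs bs''"
  unfolding linked_def
proof (intro allI impI)
  fix v assume v: "weight bs v"
  obtain a a' where a: "weight bs' (a * v)" "a' * (a * v) = v" "centralizing N a"
    by (rule linkedE[OF assms(1) v])
  obtain b b' where b: "weight bs'' (b * (a * v))" "b' * (b * (a * v)) = a * v" "centralizing N b"
    by (rule linkedE[OF assms(2) a(1)])
  show "\<exists>a a'. weight bs'' (a * v) \<and> a' * (a * v) = v \<and> centralizing N a"
    by (rule exI[of _ "b * a"], rule exI[of _ "a' * b'"])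
       (use a b centralizing_mult in \<open>simp add: mult.assoc\<close>)
qed

lemma linked_snoc:
  assumes "linked (length bs) bs bs'" "length bs = length bs'" "length bs < n"
  shows "linked (length (bs @ [b])) (bs @ [b]) (bs' @ [b])"
  unfolding linked_def
proof (intro allI impI)
  fix v assume v: "weight (bs @ [b]) v"
  then have "weight bs v" by simp
  from linkedE[OF assms(1) this] obtain a a' where
    a: "weight bs' (a * v)" "a' * (a * v) = v" "centralizing (length bs) a" by blast
  have "X (length bs) * (a * v) = a * (X (length bs) * v)"
    using a(3) assms(3) by (simp add: centralizing_def flip: mult.assoc)
  then have "weight (bs' @ [b]) (a * v)" using v a(1) assms(2) by (simp add: scale_mult_right)
  moreover have "centralizing (length (bs @ [b])) a" using centralizing_mono a(3) by simp
  ultimately show "\<exists>a a'. weight (bs' @ [b]) (a * v) \<and> a' * (a * v) = v \<and> centralizing (length (bs @ [b])) a"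
    using a(2) by blast
qed

lemma linked_move_right:
  assumes "std (as @ b # cs)" "length (as @ b # cs) \<le> n" "right b \<notin> set cs" "down b \<notin> set cs"
  shows "linked (length (as @ b # cs)) (as @ b # cs) (as @ cs @ [b])"
proof -
  have "centralizing (length (as @ b # cs)) (psi (length as) (length cs))"
    using assms(2) by (intro centralizing_psi) auto
  then show ?thesis using move_right[of as b cs "[]"] assms by (auto simp: linked_def)
qed

text \<open>The last box of \<open>bs'\<close> is a corner of the common shape, so neither its right
  nor its lower neighbour occurs in \<open>bs\<close>. It can be moved to the end of
  \<open>bs\<close>; the tableaux without it are linked by induction.\<close>

lemma linked_same_shape:
  assumes "std bs" "std bs'" "set bs = set bs'" "length bs' \<le> n"
  shows "linked (length bs') bs bs'"
  using assms
proof (induction bs' arbitrary: bs rule: rev_induct)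
  case Nil
  then show ?case by (simp add: linked_refl)
next
  case (snoc b cs')
  have len: "length bs = length (cs' @ [b])" using std_card snoc.prems by metis
  have "b \<in> set bs" using snoc.prems by simp
  then obtain as cs where bs: "bs = as @ b # cs" by (meson split_list)
  have b: "addable (set cs') b" and s: "std cs'" using snoc.prems by auto
  have notin: "right b \<notin> set bs" "down b \<notin> set bs"
    using young_diagramD[OF std_young_diagram[OF s], of _ _ "fst b" "snd b"] b snoc.prems(3)
    by (force simp: right_def down_def addable_def)+
  have m: "std (as @ cs @ [b])"
    using move_right[of as b cs "[]"] snoc.prems notin len bs by auto
  have 1: "linked (length bs) bs (as @ cs @ [b])"
    using linked_move_right[of as b cs] snoc.prems notin len bs by auto
  have "set (as @ cs) = set cs'"
  proof -
    have "b \<notin> set (as @ cs)" using std_distinct[OF snoc.prems(1)] bs by auto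
    moreover have "b \<notin> set cs'" using b by (auto simp: addable_def)
    moreover have "insert b (set (as @ cs)) = insert b (set cs')" using snoc.prems(3) bs by auto
    ultimately show ?thesis by (metis insert_ident)
  qed
  moreover have "std (as @ cs)" using m std_append[of "as @ cs" "[b]"] by simp
  ultimately have "linked (length cs') (as @ cs) cs'" using snoc.IH[of "as @ cs"] s snoc.prems by auto
  moreover have "length (as @ cs) = length cs'" using len bs by simp
  ultimately have "linked (length ((as @ cs) @ [b])) ((as @ cs) @ [b]) (cs' @ [b])"
    using linked_snoc[of "as @ cs" cs' b] snoc.prems by auto
  then show ?case using linked_trans[OF 1] len bs by simp
qed

text \<open>As \<open>c\<close> is a corner of \<open>bs\<close>, it can be moved to the place just
  before \<open>b\<close>. The last three contents then are those of \<open>c\<close>,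
  \<open>b\<close> and again \<open>c\<close>, both intertwiners vanish, and
  \<open>braid_clash\<close> applies.\<close>

lemma branching_neighbour:
  assumes br: "\<And>j. j \<le> length bs \<Longrightarrow> branching j"
    and n: "Suc (length bs) < n" and bs: "std (bs @ [b])" "weight (bs @ [b]) v"
    and X: "X (Suc (length bs)) * v = scale (kap (box_content c)) v"
    and c: "c \<in> set bs" "right c \<notin> set bs" "down c \<notin> set bs" "\<bar>box_content c - box_content b\<bar> = 1"
  shows "v = 0"
proof -
  obtain as cs where asc: "bs = as @ c # cs" using c(1) by (meson split_list)
  let ?ds = "as @ cs"
  have len: "length bs = Suc (length ?ds)" by (simp add: asc)
  have "std (as @ c # cs)" using bs asc std_append by auto
  then have "linked (length bs) bs (as @ cs @ [c])" and s': "std (as @ cs @ [c])"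
    using linked_move_right[of as c cs] move_right[of as c cs "[]"] c n by (auto simp: asc)
  moreover from s' have s: "std (?ds @ [c])" by simp
  have sb: "std ((?ds @ [c]) @ [b])"
    using bs(1) s unfolding std_snoc[of bs] std_snoc[of "?ds @ [c]"] by (simp add: asc insert_commute)
  from \<open>linked _ _ _\<close> have L: "linked (length bs) bs (?ds @ [c])" by simp
  obtain a a' where a: "weight (?ds @ [c]) (a * v)" "a' * (a * v) = v" "centralizing (length bs) a"
    using linkedE[OF L] bs(2) by auto
  let ?w = "a * v"
  have comm: "X j * ?w = a * (X j * v)" if "j \<ge> length bs" "j < n" for j
    using a(3) that by (simp add: centralizing_def flip: mult.assoc)
  have X1: "X (length bs) * ?w = scale (kap (box_content b)) ?w"
    using comm[of "length bs"] n bs(2) by (simp add: scale_mult_right)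
  have X2: "X (Suc (length bs)) * ?w = scale (kap (box_content c)) ?w"
    using comm[of "Suc (length bs)"] n X by (simp add: scale_mult_right)
  have w: "weight ((?ds @ [c]) @ [b]) ?w"
    unfolding weight_snoc[of "?ds @ [c]"] using a(1) X1 len by simp
  have p1: "phi (length ?ds) * ?w = 0"
    by (rule phi_vanish[of ?ds c ?w "box_content b"])
       (use br[of "length ?ds"] n s a(1) X1[unfolded len] len c(4) in \<open>simp_all del: append_assoc\<close>)
  have p2: "phi (Suc (length ?ds)) * ?w = 0"
    using phi_vanish[of "?ds @ [c]" b ?w "box_content c"] br[of "length bs"] n sb w X2[unfolded len] len c(4)
    by (simp del: append_assoc)
  have X0: "X (length ?ds) * ?w = scale (kap (box_content c)) ?w"
    using a(1) unfolding weight_snoc by blast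
  have "Suc (Suc (length ?ds)) < n" using n len by simp
  from braid_clash[OF this X0 X1[unfolded len] X2[unfolded len] c(4) p1 p2] have "?w = 0" .
  then show ?thesis using a(2) by simp
qed

text \<open>Let \<open>k = length bs\<close>. By \<open>g_X_next\<close>, \<open>X k - kap c\<close>
  sends \<open>g k * v\<close> to a nonzero multiple of \<open>v\<close>, where \<open>c\<close> is
  the content of \<open>b\<close>. A nonzero \<open>v\<close> would thus give a Jordan block of
  \<open>X k\<close>, but \<open>g k * v\<close> still has weight \<open>bs\<close>, where
  \<open>branching\<close> makes \<open>X k\<close> diagonalisable.\<close>

lemma branching_same_content:
  assumes br: "branching (length bs)" and n: "Suc (length bs) < n"
    and bs: "std (bs @ [b])" "weight (bs @ [b]) v"
    and X: "X (Suc (length bs)) * v = scale (kap (box_content b)) v"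
  shows "v = 0"
proof -
  let ?k = "length bs" and ?c = "box_content b"
  have "weight bs (g ?k * v)"
    by (rule weight_mult) (use bs(2) n in \<open>simp_all add: g_X_below\<close>)
  then obtain xs where
    xs: "distinct xs" "set xs \<subseteq> box_content ` Collect (addable (set bs))" "ann (X ?k) xs (g ?k * v) = 0"
    using branchingD[OF br] bs(1) by (metis std_snoc)
  have ne: "kap x \<noteq> kap y" if xy: "x \<in> set xs \<union> {?c}" "y \<in> set xs \<union> {?c}" "x \<noteq> y" for x y
  proof -
    have "x \<in> box_content ` Collect (addable (set bs))" "y \<in> box_content ` Collect (addable (set bs))"
      using xy xs(2) bs(1) by auto
    then obtain b1 b2 where "addable (set bs) b1" "addable (set bs) b2" "x = box_content b1" "y = box_content b2"
      by blast
    then have "\<bar>x - y\<bar> \<le> int n"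
      using addable_content_bound[OF std_young_diagram, of bs b1 b2] bs(1) std_card[of bs] n by simp
    then show ?thesis using kap_eq_imp xy(3) by blast
  qed
  have "inj_on kap (set xs)" using ne by (force simp: inj_on_def)
  from ann_split[OF this xs(1,3)] obtain u where u: "g ?k * v = (\<Sum>x\<in>set xs. u x)"
    "\<And>x. x \<in> set xs \<Longrightarrow> X ?k * u x = scale (kap x) (u x)" by blast
  let ?w = "\<lambda>x. scale (kap x - kap ?c) (u x)"
  have "(\<Sum>x\<in>set xs. ?w x) = X ?k * (g ?k * v) - scale (kap ?c) (g ?k * v)"
    by (simp add: u sum_distrib_left scale_sum_right scale_left_diff_distrib sum_subtractf)
  also have "X ?k * (g ?k * v) = g ?k * (X (Suc ?k) * v) - v - scale h (X (Suc ?k) * v)"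
    using g_X_next[OF n] by (simp add: algebra_simps scale_simps flip: mult.assoc)
  also have "\<dots> - scale (kap ?c) (g ?k * v) = scale (- (1 + h * kap ?c)) v"
    unfolding X by (simp add: scale_simps)
  \<comment> \<open>The \<open>?c\<close> component has coefficient zero. Hence a multiple of
    \<open>v\<close>, which has eigenvalue \<open>kap ?c\<close>, is a sum of eigenvectors with
    other eigenvalues.\<close>
  finally have *: "scale (- (1 + h * kap ?c)) v = (\<Sum>x\<in>set xs - {?c}. ?w x)"
    using sum.mono_neutral_left[of "set xs" "set xs - {?c}" ?w] by auto
  have "ann (X ?k) (filter (\<lambda>x. x \<noteq> ?c) xs) (scale (- (1 + h * kap ?c)) v) = 0"
    unfolding *
  proof (rule ann_sum_eigen)
    fix x assume "x \<in> set xs - {?c}"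
    then have "X ?k * u x = scale (kap x) (u x)" using u(2) by blast
    then show "X ?k * ?w x = scale (kap x) (?w x)"
      by (simp only: scale_mult_right scale_scale mult.commute)
  qed auto
  moreover have "X ?k * (scale (- (1 + h * kap ?c)) v) = scale (kap ?c) (scale (- (1 + h * kap ?c)) v)"
    using bs(2) unfolding weight_snoc by (metis scale_mult_right scale_left_commute)
  ultimately have "scale (- (1 + h * kap ?c)) v = 0"
    by (rule ann_eigen_eq_0) (use ne in auto)
  then show "v = 0" using one_plus_kap[of ?c] by (simp add: add_eq_0_iff del: scale_minus_left)
qed

text \<open>The induction hypothesis applies to \<open>phi k * v\<close>, which again has weight
  \<open>cs\<close>. Intertwining turns its annihilating product for \<open>X k\<close> into one for
  \<open>X (Suc k)\<close> on \<open>phi k * (phi k * v)\<close>, and by \<open>phi_phi_v\<close>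
  that vector is a product of two linear factors applied to \<open>v\<close>. So besides old addable
  contents only \<open>?c - 1\<close> and \<open>?c + 1\<close> can occur; those without an addable
  box are then excluded.\<close>

lemma branching_step:
  assumes br: "\<And>j. j \<le> k \<Longrightarrow> branching j" and n: "Suc k < n"
  shows "branching (Suc k)"
  unfolding branching_def
proof (intro allI impI)
  fix bs v assume len: "length bs = Suc k" and bs: "std bs" "weight bs v"
  obtain cs b where bs_eq: "bs = cs @ [b]" using len by (cases bs rule: rev_cases) auto
  have k: "length cs = k" using len bs_eq by simp
  have s: "std cs" and b: "addable (set cs) b" using bs by (auto simp: bs_eq)
  note D = std_young_diagram[OF s]
  let ?c = "box_content b"
  have "weight cs (phi k * v)"
    by (rule weight_mult) (use bs(2) n k in \<open>simp_all add: bs_eq phi_X_commute\<close>)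
  then obtain xs where
    xs: "distinct xs" "set xs \<subseteq> box_content ` Collect (addable (set cs))" "ann (X k) xs (phi k * v) = 0"
    using branchingD[of cs "phi k * v"] br[of k] s k by (metis order_refl)
  have notin: "?c + 1 \<notin> set xs" "?c - 1 \<notin> set xs"
    using addable_content_diff[OF D b] xs(2) by fastforce+
  let ?ys = "xs @ [?c - 1, ?c + 1]"
  have ne: "kap x \<noteq> kap y" if xy: "x \<in> set ?ys" "y \<in> set ?ys" "x \<noteq> y" for x y
  proof -
    have bd: "\<bar>z - z'\<bar> \<le> int k + 1" if z: "z \<in> set xs \<union> {?c}" "z' \<in> set xs \<union> {?c}" for z z'
    proof -
      have "z \<in> box_content ` Collect (addable (set cs))" "z' \<in> box_content ` Collect (addable (set cs))"
        using z xs(2) b by auto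
      then obtain b1 b2 where "addable (set cs) b1" "addable (set cs) b2" "z = box_content b1" "z' = box_content b2"
        by blast
      then show ?thesis using addable_content_bound[OF D, of b1 b2] std_card[OF s] k by simp
    qed
    have "\<bar>x - y\<bar> \<le> int k + 2"
      using bd[of x y] bd[of x ?c] bd[of y ?c] bd[of ?c ?c] xy by auto
    then show ?thesis using kap_eq_imp[of x y] xy(3) n by auto
  qed
  have v: "X k * v = scale (kap ?c) v" using bs k by (simp add: bs_eq)
  have "ann (X (Suc k)) xs (phi k * (phi k * v)) = 0"
    unfolding ann_intertwine[OF X_next_phi[OF n]] xs(3) by simp
  moreover have "phi k * (phi k * v) = - ann (X (Suc k)) [?c - 1, ?c + 1] v"
    unfolding phi_phi_v[OF n v] by (simp add: kap_Suc kap_pred)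
  ultimately have "ann (X (Suc k)) ?ys v = 0"
    unfolding ann_append using ann_add[of "X (Suc k)" xs "- ann (X (Suc k)) [?c - 1, ?c + 1] v" "ann (X (Suc k)) [?c - 1, ?c + 1] v"]
    by (simp del: ann.simps)
  moreover have "inj_on kap (set ?ys)" using ne by (force simp: inj_on_def)
  moreover have "distinct ?ys" using xs(1) notin by simp
  ultimately obtain u where u: "v = (\<Sum>x\<in>set ?ys. u x)"
    "\<And>x. x \<in> set ?ys \<Longrightarrow> X (Suc k) * u x = scale (kap x) (u x)"
    "\<And>x. x \<in> set ?ys \<Longrightarrow> \<exists>p. u x = p * v \<and> (\<forall>a. X (Suc k) * a = a * X (Suc k) \<longrightarrow> p * a = a * p)"
    using ann_split[of ?ys "X (Suc k)" v] by blast
  have zero: "u x = 0" if x: "x \<in> set ?ys" "x \<notin> box_content ` Collect (addable (set bs))" for x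
  proof -
    obtain p where p: "u x = p * v" "\<And>a. X (Suc k) * a = a * X (Suc k) \<Longrightarrow> p * a = a * p"
      using u(3)[OF x(1)] by blast
    have w: "weight (cs @ [b]) (u x)"
      unfolding p(1)
    proof (rule weight_mult)
      show "weight (cs @ [b]) v" using bs(2) by (simp add: bs_eq)
      fix i assume "i < length (cs @ [b])"
      then show "p * X i = X i * p" using n k by (intro p(2) X_commute) auto
    qed
    have Xu: "X (Suc (length cs)) * u x = scale (kap x) (u x)" using u(2)[OF x(1)] k by simp
    have br': "branching j" if "j \<le> length cs" for j using br that k by simp
    have n': "Suc (length cs) < n" using n k by simp
    have sb: "std (cs @ [b])" using bs by (simp add: bs_eq)
    have bd: "(i, j) \<in> set cs" if "i \<le> fst b" "j \<le> snd b" "(i, j) \<noteq> b" for i j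
      using young_diagramD[OF std_young_diagram[OF sb], of "fst b" "snd b" i j] that by auto
    have not_addable: "\<not> addable (insert b (set cs)) d" if "box_content d = x" for d
      using x(2) that by (auto simp: bs_eq)
    \<comment> \<open>Old addable boxes other than \<open>b\<close> stay addable, so only the
      content of \<open>b\<close> itself and its two neighbours need an argument.\<close>
    consider "x = ?c" | "x \<noteq> ?c" "x \<in> set xs" | "x = ?c + 1" | "x = ?c - 1" using x(1) by auto
    then show ?thesis
    proof cases
      case 1
      then show ?thesis using branching_same_content[OF _ n' sb w] br' Xu by simp
    next
      case 2
      then obtain b' where "addable (set cs) b'" "x = box_content b'" using xs(2) by auto
      then show ?thesis using addable_insertI[of "set cs" b' b] not_addable[of b'] 2 by auto
    next
      case 3
      obtain r j where rj: "b = (r, j)" by (cases b)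
      have nr: "(r, Suc j) \<notin> set cs"
        using young_diagramD[OF D, of r "Suc j" r j] b by (auto simp: rj addable_def)
      have "\<not> addable (insert b (set cs)) (r, Suc j)"
        by (rule not_addable) (simp add: 3 rj box_content_def)
      \<comment> \<open>The right neighbour of \<open>b\<close> is blocked by a missing box above
        it. So the box above \<open>b\<close> is a corner of \<open>cs\<close>, and its content is
        exactly \<open>x\<close>. The case of the lower neighbour is the transposed one.\<close>
      then have r: "r > 0" "(r - 1, Suc j) \<notin> set cs" using nr by (auto simp: addable_iff rj)
      have e: "box_content (r - 1, j) = x" using 3 r(1) by (simp add: rj box_content_def of_nat_diff)
      have Xu': "X (Suc (length cs)) * u x = scale (kap (box_content (r - 1, j))) (u x)" using Xu e by simp
      show ?thesis
        by (rule branching_neighbour[OF br' n' sb w Xu'])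
           (use 3 e r bd[of "r - 1" j] b in
             \<open>auto simp: rj box_content_def right_def down_def addable_def of_nat_diff\<close>)
    next
      case 4
      obtain r j where rj: "b = (r, j)" by (cases b)
      have nr: "(Suc r, j) \<notin> set cs"
        using young_diagramD[OF D, of "Suc r" j r j] b by (auto simp: rj addable_def)
      have "\<not> addable (insert b (set cs)) (Suc r, j)"
        by (rule not_addable) (simp add: 4 rj box_content_def)
      then have r: "j > 0" "(Suc r, j - 1) \<notin> set cs" using nr by (auto simp: addable_iff rj)
      have e: "box_content (r, j - 1) = x" using 4 r(1) by (simp add: rj box_content_def of_nat_diff)
      have Xu': "X (Suc (length cs)) * u x = scale (kap (box_content (r, j - 1))) (u x)" using Xu e by simp
      show ?thesis
        by (rule branching_neighbour[OF br' n' sb w Xu'])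
           (use 4 e r bd[of r "j - 1"] b in
             \<open>auto simp: rj box_content_def right_def down_def addable_def of_nat_diff\<close>)
    qed
  qed
  let ?zs = "filter (\<lambda>x. x \<in> box_content ` Collect (addable (set bs))) ?ys"
  have "v = (\<Sum>x\<in>set ?zs. u x)"
    unfolding u(1) by (rule sum.mono_neutral_right) (use zero in auto)
  moreover have "ann (X (Suc k)) ?zs (\<Sum>x\<in>set ?zs. u x) = 0"
  proof (rule ann_sum_eigen[OF _ subset_refl])
    fix x assume "x \<in> set ?zs"
    then have "x \<in> set ?ys" unfolding set_filter by blast
    then show "X (Suc k) * u x = scale (kap x) (u x)" by (rule u(2))
  qed
  ultimately have "ann (X (Suc k)) ?zs v = 0" by metis
  moreover have "distinct ?zs" using \<open>distinct ?ys\<close> by (rule distinct_filter)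
  ultimately show "\<exists>xs. distinct xs \<and> set xs \<subseteq> box_content ` Collect (addable (set bs)) \<and> ann (X (Suc k)) xs v = 0"
    by (intro exI[of _ ?zs]) auto
qed

lemma branching_0: "branching 0"
  unfolding branching_def
  by (auto simp: addable_iff box_content_def intro!: exI[of _ "[0]"] image_eqI[of _ _ "(0, 0)"])

lemma branching: "k < n \<Longrightarrow> branching k"
proof (induction k rule: less_induct)
  case (less k)
  show ?case
  proof (cases k)
    case (Suc j)
    then show ?thesis using branching_step[of j] less by simp
  qed (simp add: branching_0)
qed

section \<open>Decomposition into weight vectors\<close>

text \<open>The vector is split by \<open>X 0\<close>, \<open>X 1\<close>, ... in turn. Each
  component is a left multiple of the vector being split, so it stays in \<open>N\<close>, and it
  keeps the earlier eigenvalues by the commutation property in \<open>ann_split\<close>. An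
  induction rule replaces a direct sum over standard tableaux.\<close>

lemma weight_induct:
  assumes closed: "\<And>a v. v \<in> N \<Longrightarrow> a * v \<in> N"
    and P0: "P 0" and Padd: "\<And>v w. P v \<Longrightarrow> P w \<Longrightarrow> P (v + w)"
    and P: "\<And>bs v. std bs \<Longrightarrow> length bs = n \<Longrightarrow> weight bs v \<Longrightarrow> v \<in> N \<Longrightarrow> P v"
    and v: "v \<in> N"
  shows "P v"
proof -
  have "P v" if "k \<le> n" "std bs" "length bs = n - k" "weight bs v" "v \<in> N" for k bs v
    using that
  proof (induction k arbitrary: bs v)
    case 0
    then show ?case using P by simp
  next
    case (Suc k)
    let ?l = "length bs"
    have l: "?l < n" using Suc.prems by simp
    note D = std_young_diagram[OF Suc.prems(2)]
    obtain xs where xs: "distinct xs" "set xs \<subseteq> box_content ` Collect (addable (set bs))" "ann (X ?l) xs v = 0"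
      using branchingD[OF branching[OF l] Suc.prems(2,4)] by blast
    have "x = y" if xy: "x \<in> set xs" "y \<in> set xs" "kap x = kap y" for x y
    proof -
      obtain b1 b2 where "addable (set bs) b1" "addable (set bs) b2" "x = box_content b1" "y = box_content b2"
        using xy xs(2) by blast
      then have "\<bar>x - y\<bar> \<le> int n"
        using addable_content_bound[OF D, of b1 b2] std_card[OF Suc.prems(2)] l by simp
      then show ?thesis using kap_eq_imp xy(3) by blast
    qed
    then have "inj_on kap (set xs)" by (simp add: inj_on_def)
    from ann_split[OF this xs(1,3)] obtain u where u: "v = (\<Sum>x\<in>set xs. u x)"
      "\<And>x. x \<in> set xs \<Longrightarrow> X ?l * u x = scale (kap x) (u x)"
      "\<And>x. x \<in> set xs \<Longrightarrow> \<exists>p. u x = p * v \<and> (\<forall>a. X ?l * a = a * X ?l \<longrightarrow> p * a = a * p)"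
      by blast
    have Pu: "P (u x)" if x: "x \<in> set xs" for x
    proof -
      obtain p where p: "u x = p * v" "\<And>a. X ?l * a = a * X ?l \<Longrightarrow> p * a = a * p"
        using u(3)[OF x] by blast
      obtain b where b: "addable (set bs) b" "x = box_content b" using x xs(2) by blast
      have "weight bs (u x)"
        unfolding p(1) using Suc.prems(4)
        by (rule weight_mult) (use l in \<open>auto intro!: p(2) X_commute\<close>)
      then have "weight (bs @ [b]) (u x)" using u(2)[OF x] b by simp
      moreover have "u x \<in> N" using closed Suc.prems p by simp
      ultimately show ?thesis using Suc.IH[of "bs @ [b]" "u x"] b Suc.prems by simp
    qed
    have "P (\<Sum>x\<in>S. u x)" if "S \<subseteq> set xs" for S
      using finite_subset[OF that finite_set] that
      by (induction S) (use P0 Padd Pu in auto)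
    then show ?case unfolding u(1) by blast
  qed
  from this[of n "[]" v] show ?thesis using v by simp
qed

text \<open>For entries in neighbouring boxes of a row or a column: this makes row and column
  readings eigenvectors of the generators of Young subgroups.\<close>

lemma g_adjacent_contents:
  assumes bs: "std bs" "weight bs v" "length bs \<le> n" and i: "Suc i < length bs"
  shows "box_content (bs ! Suc i) = box_content (bs ! i) + 1 \<Longrightarrow> g i * v = scale q v"
    and "box_content (bs ! Suc i) = box_content (bs ! i) - 1 \<Longrightarrow> g i * v = scale (- inverse q) v"
proof -
  let ?as = "take i bs" and ?b = "bs ! i" and ?c = "bs ! Suc i"
  have len: "length ?as = i" and n: "Suc i < n" using i bs(3) by auto
  have split: "(?as @ [?b]) @ drop (Suc i) bs = bs" using i by (simp add: Cons_nth_drop_Suc)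
  have s: "std (?as @ [?b])" using bs(1) std_append split by metis
  have w: "weight (?as @ [?b]) v" using bs(2) weight_append split by metis
  have X: "X i * v = scale (kap (box_content ?b)) v" "X (Suc i) * v = scale (kap (box_content ?c)) v"
    using bs(2) i by (auto simp: weight_def)
  have phi: "phi i * v = 0" if "\<bar>box_content ?c - box_content ?b\<bar> = 1"
    using phi_vanish[of ?as ?b v "box_content ?c", unfolded len, OF branching[OF Suc_lessD[OF n]] n s w X(2) that] .
  show "g i * v = scale q v" if "box_content ?c = box_content ?b + 1"
    using g_eigen(1)[OF n X phi] that by simp
  show "g i * v = scale (- inverse q) v" if "box_content ?c = box_content ?b - 1"
    using g_eigen(2)[OF n X phi] that by simp
qed

text \<open>One linear factor in \<open>X (Suc i)\<close> turns a generator into an intertwiner.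
  This is how intertwiners are extracted from a symmetriser in \<open>ann_Tcyc\<close>.\<close>

lemma X_next_g_eigen:
  assumes "Suc i < n" "X (Suc i) * w = scale a w"
  shows "X (Suc i) * (g i * w) - scale a (g i * w) = phi i * w"
proof -
  have "X (Suc i) * (g i * w) = (g i * X i + 1 + scale h (X (Suc i))) * w"
    by (simp only: X_next_g[OF assms(1)] mult.assoc[symmetric])
  then show ?thesis
    unfolding phi_eq[OF assms(1)] using assms(2) by (simp add: algebra_simps scale_simps)
qed

lemma ann_scale: "ann a xs (scale c v) = scale c (ann a xs v)"
  by (induction xs) (simp_all add: scale_simps mult.commute)

lemma psi_Suc: "psi i (Suc m) = phi (i + m) * psi i m"
  by (induction m arbitrary: i) (simp_all add: mult.assoc)

end

section \<open>Combinatorics of the symmetric group and of the standard basis\<close>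

section \<open>Length and inversions\<close>

definition inversions :: "(nat \<Rightarrow> nat) \<Rightarrow> (nat \<times> nat) set" where
  "inversions w = {(a, b). a < b \<and> w b < w a}"

lemma inversions_id [simp]: "inversions id = {}" by (auto simp: inversions_def)

lemma simple_transp_apply:
  "simple_transp i x = (if x = i then Suc i else if x = Suc i then i else x)"
  by (simp add: simple_transp_def transpose_def)

lemma simple_transp_invol [simp]: "simple_transp i (simple_transp i x) = x"
  by (simp add: simple_transp_def)

lemma simple_transp_comp_self [simp]: "simple_transp i \<circ> simple_transp i = id"
  by (simp add: fun_eq_iff)

lemma simple_transp_cancel [simp]:
  "simple_transp i \<circ> (simple_transp i \<circ> w) = w" "w \<circ> simple_transp i \<circ> simple_transp i = w"
  by (simp_all add: fun_eq_iff)

lemma inv_simple_transp [simp]: "inv (simple_transp i) = simple_transp i"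
  by (simp add: simple_transp_def)

lemma bij_simple_transp [simp]: "bij (simple_transp i)"
  by (simp add: simple_transp_def)

lemma simple_transp_less: "a < b \<Longrightarrow> (a, b) \<noteq> (i, Suc i) \<Longrightarrow> simple_transp i a < simple_transp i b"
  by (auto simp: simple_transp_apply split: if_splits)

lemma sym_group_bij: "w \<in> sym_group n \<Longrightarrow> bij w"
  by (simp add: sym_group_def permutes_bij)

lemma sym_group_id: "id \<in> sym_group n" by (simp add: sym_group_def permutes_id)

lemma sym_group_comp: "v \<in> sym_group n \<Longrightarrow> w \<in> sym_group n \<Longrightarrow> v \<circ> w \<in> sym_group n"
  by (simp add: sym_group_def permutes_compose)

lemma sym_group_inv: "w \<in> sym_group n \<Longrightarrow> inv w \<in> sym_group n"
  by (simp add: sym_group_def permutes_inv)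

lemma sym_group_simple: "i \<in> {1..<n} \<Longrightarrow> simple_transp i \<in> sym_group n"
  by (auto simp: sym_group_def simple_transp_def intro!: permutes_swap_id)

lemma finite_sym_group: "finite (sym_group n)"
  by (simp add: sym_group_def finite_permutations)

lemma sym_group_apply: "w \<in> sym_group n \<Longrightarrow> w p \<in> {1..n} \<longleftrightarrow> p \<in> {1..n}"
  unfolding sym_group_def mem_Collect_eq by (rule permutes_in_image)

lemma sym_group_fix: "w \<in> sym_group n \<Longrightarrow> p \<notin> {1..n} \<Longrightarrow> w p = p"
  by (simp add: sym_group_def permutes_not_in)

lemma inv_apply_self: "bij w \<Longrightarrow> inv w (w x) = x" "bij w \<Longrightarrow> w (inv w x) = x"
  by (simp_all add: bij_is_inj bij_is_surj surj_f_inv_f)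

lemma finite_inversions:
  assumes "w \<in> sym_group n" shows "finite (inversions w)"
proof -
  have "a \<in> {1..n} \<and> b \<in> {1..n}" if "a < b" "w b < w a" for a b
    using sym_group_apply[OF assms, of a] sym_group_apply[OF assms, of b]
      sym_group_fix[OF assms, of a] sym_group_fix[OF assms, of b] that
    by (cases "a \<in> {1..n}"; cases "b \<in> {1..n}") auto
  then have "inversions w \<subseteq> {1..n} \<times> {1..n}" unfolding inversions_def by blast
  then show ?thesis by (rule finite_subset) simp
qed

lemma inversions_comp_simple:
  assumes "w i < w (Suc i)"
  shows "inversions (w \<circ> simple_transp i) =
    insert (i, Suc i) (map_prod (simple_transp i) (simple_transp i) ` inversions w)"
proof (intro set_eqI iffI)
  fix p assume p: "p \<in> inversions (w \<circ> simple_transp i)"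
  obtain a b where ab: "p = (a, b)" by (cases p)
  show "p \<in> insert (i, Suc i) (map_prod (simple_transp i) (simple_transp i) ` inversions w)"
  proof (cases "p = (i, Suc i)")
    case False
    then have "simple_transp i a < simple_transp i b"
      using p simple_transp_less[of a b i] by (simp add: ab inversions_def)
    then have "(simple_transp i a, simple_transp i b) \<in> inversions w"
      using p by (simp add: ab inversions_def)
    then show ?thesis by (force simp: ab)
  qed simp
next
  fix p assume "p \<in> insert (i, Suc i) (map_prod (simple_transp i) (simple_transp i) ` inversions w)"
  then consider "p = (i, Suc i)" | a b where "(a, b) \<in> inversions w" "p = (simple_transp i a, simple_transp i b)"
    by auto
  then show "p \<in> inversions (w \<circ> simple_transp i)"
  proof cases
    case 1
    then show ?thesis using assms by (simp add: inversions_def simple_transp_apply)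
  next
    case 2
    then have "(a, b) \<noteq> (i, Suc i)" using assms by (auto simp: inversions_def)
    then show ?thesis using 2 simple_transp_less[of a b i] by (simp add: inversions_def)
  qed
qed

lemma card_inversions_comp_simple:
  assumes "w \<in> sym_group n" "w i < w (Suc i)"
  shows "card (inversions (w \<circ> simple_transp i)) = Suc (card (inversions w))"
proof -
  let ?m = "map_prod (simple_transp i) (simple_transp i)"
  have "inj ?m"
    by (rule inj_on_inverseI[of _ ?m]) auto
  then have "card (?m ` inversions w) = card (inversions w)"
    by (meson card_image inj_on_subset subset_UNIV)
  moreover have "(i, Suc i) \<notin> ?m ` inversions w"
  proof
    assume "(i, Suc i) \<in> ?m ` inversions w"
    then obtain a b where ab: "a < b" "simple_transp i a = i" "simple_transp i b = Suc i"
      by (auto simp: inversions_def)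
    have "a = simple_transp i i" "b = simple_transp i (Suc i)"
      using ab(2,3) by (metis simple_transp_invol)+
    then show False using ab(1) by (simp add: simple_transp_apply)
  qed
  ultimately show ?thesis
    unfolding inversions_comp_simple[OF assms(2)] using finite_inversions[OF assms(1)] by simp
qed

lemma card_inversions_inv:
  assumes "bij w" shows "card (inversions (inv w)) = card (inversions w)"
proof -
  have "bij_betw (\<lambda>(a, b). (w b, w a)) (inversions w) (inversions (inv w))"
    by (rule bij_betw_byWitness[of _ "\<lambda>(a, b). (inv w b, inv w a)"])
       (auto simp: inversions_def inv_apply_self[OF assms])
  then show ?thesis by (simp add: bij_betw_same_card)
qed

lemma card_inversions_simple_comp:
  assumes "w \<in> sym_group n" "inv w i < inv w (Suc i)"
  shows "card (inversions (simple_transp i \<circ> w)) = Suc (card (inversions w))"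
proof -
  have b: "bij w" using assms(1) by (rule sym_group_bij)
  have "inv (simple_transp i \<circ> w) = inv w \<circ> simple_transp i"
    using o_inv_distrib[OF bij_simple_transp b] by simp
  then show ?thesis
    using card_inversions_comp_simple[OF sym_group_inv[OF assms(1)] assms(2)]
      card_inversions_inv[OF b] card_inversions_inv[OF bij_comp[OF b bij_simple_transp[of i]]] by simp
qed

section \<open>Parabolic subgroups\<close>

text \<open>
  A set \<open>I\<close> of indices of simple transpositions cuts \<open>{1..n}\<close> into the maximal intervals all of
  whose consecutive members are linked by \<open>I\<close>.
\<close>
definition same_block :: "nat set \<Rightarrow> nat \<Rightarrow> nat \<Rightarrow> bool" where
  "same_block I a b \<longleftrightarrow> {min a b..<max a b} \<subseteq> I"

lemma same_block_refl [simp]: "same_block I a a" by (simp add: same_block_def)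

lemma same_block_sym: "same_block I a b \<Longrightarrow> same_block I b a"
  by (simp add: same_block_def min.commute max.commute)

lemma same_block_trans: "same_block I a b \<Longrightarrow> same_block I b c \<Longrightarrow> same_block I a c"
proof -
  assume a: "same_block I a b" "same_block I b c"
  have "{min a c..<max a c} \<subseteq> {min a b..<max a b} \<union> {min b c..<max b c}" by auto
  then show ?thesis using a by (auto simp: same_block_def)
qed

lemma same_block_Suc: "i \<in> I \<Longrightarrow> same_block I i (Suc i)"
  by (auto simp: same_block_def)

definition parabolic :: "nat \<Rightarrow> nat set \<Rightarrow> (nat \<Rightarrow> nat) set" where
  "parabolic n I = {w \<in> sym_group n. \<forall>p. same_block I p (w p)}"

lemma parabolic_sym_group: "w \<in> parabolic n I \<Longrightarrow> w \<in> sym_group n" by (simp add: parabolic_def)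

lemma finite_parabolic: "finite (parabolic n I)"
  using finite_subset[OF _ finite_sym_group[of n]] by (auto simp: parabolic_def)

lemma parabolic_id: "id \<in> parabolic n I"
  by (simp add: parabolic_def sym_group_id)

lemma parabolic_comp:
  assumes "v \<in> parabolic n I" "w \<in> parabolic n I" shows "v \<circ> w \<in> parabolic n I"
proof -
  have "same_block I p (v (w p))" for p
    using assms same_block_trans[of I p "w p" "v (w p)"] by (simp add: parabolic_def)
  then show ?thesis using assms sym_group_comp by (simp add: parabolic_def)
qed

lemma parabolic_inv:
  assumes "w \<in> parabolic n I" shows "inv w \<in> parabolic n I"
proof -
  have b: "bij w" using assms sym_group_bij unfolding parabolic_def by blast
  have "same_block I (inv w p) (w (inv w p))" for p using assms by (simp add: parabolic_def)
  then have "same_block I p (inv w p)" for p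
    by (simp add: inv_apply_self(2)[OF b] same_block_sym)
  then show ?thesis using assms sym_group_inv by (simp add: parabolic_def)
qed

lemma parabolic_simple: "i \<in> I \<Longrightarrow> I \<subseteq> {1..<n} \<Longrightarrow> simple_transp i \<in> parabolic n I"
  unfolding parabolic_def using sym_group_simple same_block_Suc same_block_sym
  by (auto simp: simple_transp_apply)

lemma increasing_on_block:
  assumes "\<And>i. i \<in> I \<Longrightarrow> w i < w (Suc i)" "same_block I a b" "a < b"
  shows "w a < (w b :: nat)"
proof -
  have "a + k \<le> b \<longrightarrow> 0 < k \<longrightarrow> w a < w (a + k)" for k
  proof (induction k)
    case (Suc k)
    show ?case
    proof (intro impI)
      assume "a + Suc k \<le> b"
      then have "a + k \<in> I" using assms(2,3) by (auto simp: same_block_def)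
      from assms(1)[OF this] Suc \<open>a + Suc k \<le> b\<close> show "w a < w (a + Suc k)" by (cases k) auto
    qed
  qed simp
  from this[of "b - a"] show ?thesis using assms(3) by simp
qed

text \<open>At the least moved point \<open>p\<close>, the preimage of \<open>p\<close> lies further
  right in the same block, so monotonicity gives \<open>w p < p\<close>. Then \<open>w p\<close> is
  fixed by minimality, against injectivity.\<close>

lemma parabolic_no_descent:
  assumes w: "w \<in> parabolic n I" and inc: "\<And>i. i \<in> I \<Longrightarrow> w i < w (Suc i)"
  shows "w = id"
proof (rule ccontr)
  assume "w \<noteq> id"
  then obtain p where "w p \<noteq> p" and min: "\<And>p'. p' < p \<Longrightarrow> w p' = p'"
    using exists_least_iff[of "\<lambda>p. w p \<noteq> p"] by (auto simp: fun_eq_iff)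
  have b: "bij w" using w parabolic_sym_group sym_group_bij by blast
  obtain p' where p': "w p' = p" using inv_apply_self(2)[OF b] by blast
  have "p < p'" using min[of p'] p' \<open>w p \<noteq> p\<close> by (metis nat_neq_iff)
  moreover have "same_block I p p'" using w p' same_block_sym by (auto simp: parabolic_def)
  ultimately have "w p < p" using increasing_on_block[of I w p p'] inc p' by auto
  from min[OF this] have "w (w p) = w p" .
  then show False using \<open>w p \<noteq> p\<close> bij_is_inj[OF b] by (simp add: inj_eq)
qed

lemma parabolic_empty: "parabolic n {} = {id}"
  using parabolic_no_descent[of _ n "{}"] parabolic_id by auto

lemma parabolic_descent:
  assumes w: "w \<in> parabolic n I" and "w \<noteq> id"
  obtains i where "i \<in> I" "inv w (Suc i) < inv w i"
proof -
  have b: "bij w" using w parabolic_sym_group sym_group_bij by blast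
  have "inv w \<noteq> id" using assms(2) b by (metis inv_inv_eq inv_id)
  then obtain i where "i \<in> I" "\<not> inv w i < inv w (Suc i)"
    using parabolic_no_descent[OF parabolic_inv[OF w]] by blast
  moreover have "inv w i \<noteq> inv w (Suc i)" using b by (metis inv_apply_self(2) n_not_Suc_n)
  ultimately show ?thesis using that by fastforce
qed

lemma sym_group_parabolic: "sym_group n = parabolic n {1..<n}"
proof -
  have "same_block {1..<n} p (w p)" if "w \<in> sym_group n" for w p
    using sym_group_apply[OF that, of p] sym_group_fix[OF that, of p]
    by (cases "p \<in> {1..n}") (auto simp: same_block_def)
  then show ?thesis by (auto simp: parabolic_def)
qed

text \<open>Builds \<open>w\<close> from left factors in \<open>I\<close>, each of which raises the
  number of inversions; along such a product the basis elements multiply without lower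
  terms.\<close>

lemma parabolic_induct [consumes 2, case_names id step]:
  assumes w: "w \<in> parabolic n I" and I: "I \<subseteq> {1..<n}" and "P id"
    and step: "\<And>i w. i \<in> I \<Longrightarrow> w \<in> parabolic n I \<Longrightarrow> inv w i < inv w (Suc i) \<Longrightarrow> P w \<Longrightarrow> P (simple_transp i \<circ> w)"
  shows "P w"
  using w
proof (induction "card (inversions w)" arbitrary: w rule: less_induct)
  case less
  show ?case
  proof (cases "w = id")
    case False
    obtain i where i: "i \<in> I" "inv w (Suc i) < inv w i"
      using parabolic_descent[OF less.prems False] .
    let ?w = "simple_transp i \<circ> w"
    have w': "?w \<in> parabolic n I" using parabolic_comp[OF parabolic_simple[OF i(1) I] less.prems] .
    have b: "bij w" using less.prems parabolic_sym_group sym_group_bij by blast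
    have "inv ?w = inv w \<circ> simple_transp i" using o_inv_distrib[OF bij_simple_transp b] by simp
    then have up: "inv ?w i < inv ?w (Suc i)" using i(2) by (simp add: simple_transp_apply)
    have "card (inversions w) = Suc (card (inversions ?w))"
      using card_inversions_simple_comp[OF parabolic_sym_group[OF w'] up] by simp
    then have "P ?w" using less.hyps w' by simp
    from step[OF i(1) w' up this] show ?thesis by simp
  qed (use \<open>P id\<close> in simp)
qed

lemma foldr_simple_Cons:
  "foldr (\<lambda>i u. simple_transp i \<circ> u) (i # is) id = simple_transp i \<circ> foldr (\<lambda>i u. simple_transp i \<circ> u) is id"
  by (simp only: foldr_Cons comp_apply)

lemma foldr_simple_sym_group:
  "set is \<subseteq> {1..<n} \<Longrightarrow> foldr (\<lambda>i u. simple_transp i \<circ> u) is id \<in> sym_group n"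
proof (induction "is")
  case (Cons i "is")
  have "i \<in> {1..<n}" "set is \<subseteq> {1..<n}" using Cons.prems by auto
  then show ?case
    unfolding foldr_simple_Cons using sym_group_comp[OF sym_group_simple[of i n]] Cons.IH by blast
qed (simp add: sym_group_id)

lemma perm_length_eq:
  assumes "w \<in> sym_group n"
  shows "perm_length n w = card (inversions w)"
  unfolding perm_length_def
proof (rule Least_equality)
  have "w \<in> parabolic n {1..<n}" using assms by (simp add: sym_group_parabolic)
  then show "\<exists>is. length is = card (inversions w) \<and> set is \<subseteq> {1..<n} \<and> w = foldr (\<lambda>i u. simple_transp i \<circ> u) is id"
    using subset_refl
  proof (induction rule: parabolic_induct)
    case id
    show ?case by (rule exI[of _ "[]"]) (use inversions_id in \<open>simp add: id_def\<close>)
  next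
    case (step i w)
    then obtain "is" where is_props: "length is = card (inversions w)" "set is \<subseteq> {1..<n}"
      "w = foldr (\<lambda>i u. simple_transp i \<circ> u) is id" by blast
    have "length (i # is) = card (inversions (simple_transp i \<circ> w))"
      using card_inversions_simple_comp[OF parabolic_sym_group[OF step(2)] step(3)] is_props(1) by simp
    moreover have "set (i # is) \<subseteq> {1..<n}" using step(1) is_props(2) by simp
    moreover have "simple_transp i \<circ> w = foldr (\<lambda>i u. simple_transp i \<circ> u) (i # is) id"
      by (simp only: foldr_simple_Cons is_props(3)[symmetric])
    ultimately show ?case by blast
  qed
next
  have "card (inversions (foldr (\<lambda>i u. simple_transp i \<circ> u) is id)) \<le> length is" if "set is \<subseteq> {1..<n}" for "is"
    using that
  proof (induction "is")
    case (Cons i "is")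
    define w where "w = foldr (\<lambda>i u. simple_transp i \<circ> u) is id"
    have w: "w \<in> sym_group n" unfolding w_def using foldr_simple_sym_group Cons.prems by simp
    have b: "bij w" by (rule sym_group_bij[OF w])
    have i: "simple_transp i \<circ> w \<in> sym_group n" using sym_group_comp[OF sym_group_simple w] Cons.prems by simp
    have IH: "card (inversions w) \<le> length is"
      unfolding w_def by (rule Cons.IH) (use Cons.prems in simp)
    have "card (inversions (simple_transp i \<circ> w)) \<le> Suc (card (inversions w))"
    proof (cases "inv w i < inv w (Suc i)")
      case True
      then show ?thesis using card_inversions_simple_comp[OF w] by simp
    next
      case False
      moreover have "inv w i \<noteq> inv w (Suc i)" using b by (metis inv_apply_self(2) n_not_Suc_n)
      moreover have "inv (simple_transp i \<circ> w) = inv w \<circ> simple_transp i"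
        using o_inv_distrib[OF bij_simple_transp b] by simp
      ultimately show ?thesis using card_inversions_simple_comp[OF i, of i] by (simp add: simple_transp_apply)
    qed
    then show ?case
      unfolding foldr_simple_Cons w_def[symmetric] by (rule order_trans) (use IH in simp)
  qed (use inversions_id in \<open>simp add: id_def\<close>)
  then show "card (inversions w) \<le> k"
    if "\<exists>is. length is = k \<and> set is \<subseteq> {1..<n} \<and> w = foldr (\<lambda>i u. simple_transp i \<circ> u) is id" for k
    using that by blast
qed

lemma inv_simple_comp: "bij w \<Longrightarrow> inv (simple_transp i \<circ> w) = inv w \<circ> simple_transp i"
  using o_inv_distrib[OF bij_simple_transp, of w i] by simp

lemma perm_length_simple_comp:
  assumes "w \<in> sym_group n" "i \<in> {1..<n}" "inv w i < inv w (Suc i)"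
  shows "perm_length n (simple_transp i \<circ> w) = Suc (perm_length n w)"
  using card_inversions_simple_comp[OF assms(1,3)] perm_length_eq assms(1)
    perm_length_eq[OF sym_group_comp[OF sym_group_simple[OF assms(2)] assms(1)]] by simp

lemma perm_length_comp_simple:
  assumes "w \<in> sym_group n" "i \<in> {1..<n}" "w i < w (Suc i)"
  shows "perm_length n (w \<circ> simple_transp i) = Suc (perm_length n w)"
  using card_inversions_comp_simple[OF assms(1,3)] perm_length_eq assms(1)
    perm_length_eq[OF sym_group_comp[OF assms(1) sym_group_simple[OF assms(2)]]] by simp

lemma perm_length_id [simp]: "perm_length n id = 0"
  using perm_length_eq[OF sym_group_id, of n] by simp

context hecke_algebra
begin

abbreviation s :: "nat \<Rightarrow> nat \<Rightarrow> nat" where "s \<equiv> simple_transp"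

abbreviation len :: "(nat \<Rightarrow> nat) \<Rightarrow> nat" where "len \<equiv> perm_length n"

lemma T_left_up:
  "w \<in> sym_group n \<Longrightarrow> i \<in> {1..<n} \<Longrightarrow> inv w i < inv w (Suc i) \<Longrightarrow> T (s i) * T w = T (s i \<circ> w)"
  using perm_length_simple_comp[of w n i] by (intro T_up) auto

lemma T_quadratic: "i \<in> {1..<n} \<Longrightarrow> T (s i) * T (s i) = 1 + scale (q - inverse q) (T (s i))"
proof -
  assume i: "i \<in> {1..<n}"
  have "len (s i) = Suc (len id)"
    using perm_length_simple_comp[OF sym_group_id i] by simp
  then have "T (s i) * T (s i) = scale (q - inverse q) (T (s i)) + T (s i \<circ> s i)"
    by (intro T_down i sym_group_simple) simp
  then show ?thesis by (simp only: simple_transp_comp_self T_id add.commute)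
qed

text \<open>The algebra is presented by left multiplications only; the rule for right
  multiplications is obtained by removing left factors from \<open>w\<close>.\<close>

lemma T_right_up:
  assumes w: "w \<in> sym_group n" and i: "i \<in> {1..<n}" and up: "w i < w (Suc i)"
  shows "T w * T (s i) = T (w \<circ> s i)"
proof -
  have "w \<in> parabolic n {1..<n}" using w by (simp add: sym_group_parabolic)
  then show ?thesis
    using subset_refl up
  proof (induction rule: parabolic_induct)
    case id
    show ?case by (simp only: T_id mult_1 id_comp)
  next
    case (step j w)
    have w: "w \<in> sym_group n" using step(2) by (rule parabolic_sym_group)
    have b: "bij w" by (rule sym_group_bij[OF w])
    \<comment> \<open>A simple transposition \<open>s j\<close> reverses only the pair
      \<open>j, Suc j\<close>. If \<open>w\<close> had a descent at \<open>i\<close> that disappears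
      after applying \<open>s j\<close>, the values there would be \<open>Suc j, j\<close>, contrary
      to the order of their preimages.\<close>
    have up': "w i < w (Suc i)"
    proof (rule ccontr)
      assume no: "\<not> w i < w (Suc i)"
      moreover have "w i \<noteq> w (Suc i)" using b by (metis inv_apply_self(1) n_not_Suc_n)
      ultimately have "w (Suc i) < w i" by simp
      then have eq: "w (Suc i) = j \<and> w i = Suc j"
        using simple_transp_less[of "w (Suc i)" "w i" j] step.prems by fastforce
      then have "inv w j = Suc i" "inv w (Suc j) = i"
        using inv_apply_self(1)[OF b, of i] inv_apply_self(1)[OF b, of "Suc i"] by auto
      then show False using step(3) by simp
    qed
    have ws: "w \<circ> s i \<in> sym_group n" by (rule sym_group_comp[OF w sym_group_simple[OF i]])
    have bws: "bij (w \<circ> s i)" by (rule sym_group_bij[OF ws])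
    have jw: "s j \<circ> w \<in> sym_group n" using sym_group_comp[OF sym_group_simple w] step(1) by blast
    have "len (s j \<circ> (w \<circ> s i)) = Suc (len (s j \<circ> w))"
      using perm_length_comp_simple[OF jw i] step.prems by (simp add: comp_assoc)
    also have "len (s j \<circ> w) = Suc (len w)" using perm_length_simple_comp[OF w step(1,3)] .
    also have "Suc (len w) = len (w \<circ> s i)" using perm_length_comp_simple[OF w i up'] by simp
    finally have e: "len (s j \<circ> (w \<circ> s i)) = Suc (len (w \<circ> s i))" .
    have "T (s j) * T (w \<circ> s i) = T (s j \<circ> (w \<circ> s i))"
      by (rule T_up[OF step(1) ws]) (unfold e, rule lessI)
    moreover have "T (s j \<circ> w) = T (s j) * T w" using T_left_up[OF w step(1,3)] by simp
    ultimately show ?case using step.IH[OF up'] by (metis mult.assoc comp_assoc)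
  qed
qed

lemma T_braid:
  assumes i: "i \<in> {1..<n}" "Suc i \<in> {1..<n}"
  shows "T (s i) * T (s (Suc i)) * T (s i) = T (s (Suc i)) * T (s i) * T (s (Suc i))"
proof -
  note S = sym_group_simple[OF i(1)] sym_group_simple[OF i(2)]
  have "T (s i) * T (s (Suc i)) = T (s i \<circ> s (Suc i))"
    by (rule T_right_up[OF S(1) i(2)]) (simp add: simple_transp_apply)
  moreover have "T (s i \<circ> s (Suc i)) * T (s i) = T (s i \<circ> s (Suc i) \<circ> s i)"
    by (rule T_right_up[OF sym_group_comp[OF S] i(1)]) (simp add: simple_transp_apply)
  moreover have "T (s (Suc i)) * T (s i) = T (s (Suc i) \<circ> s i)"
    by (rule T_right_up[OF S(2) i(1)]) (simp add: simple_transp_apply)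
  moreover have "T (s (Suc i) \<circ> s i) * T (s (Suc i)) = T (s (Suc i) \<circ> s i \<circ> s (Suc i))"
    by (rule T_right_up[OF sym_group_comp[OF S(2,1)] i(2)]) (simp add: simple_transp_apply)
  moreover have "s i \<circ> s (Suc i) \<circ> s i = s (Suc i) \<circ> s i \<circ> s (Suc i)"
    by (auto simp: fun_eq_iff simple_transp_apply)
  ultimately show ?thesis by simp
qed

lemma T_commute:
  assumes i: "i \<in> {1..<n}" "j \<in> {1..<n}" "Suc i < j"
  shows "T (s i) * T (s j) = T (s j) * T (s i)"
proof -
  have "T (s i) * T (s j) = T (s i \<circ> s j)"
    by (rule T_right_up[OF sym_group_simple[OF i(1)] i(2)]) (use i in \<open>simp add: simple_transp_apply\<close>)
  moreover have "T (s j) * T (s i) = T (s j \<circ> s i)"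
    by (rule T_right_up[OF sym_group_simple[OF i(2)] i(1)]) (use i in \<open>simp add: simple_transp_apply\<close>)
  moreover have "s i \<circ> s j = s j \<circ> s i" using i by (auto simp: fun_eq_iff simple_transp_apply)
  ultimately show ?thesis by simp
qed

lemma T_parabolic_left:
  assumes u: "u \<in> parabolic n I" and I: "I \<subseteq> {1..<n}" and d: "d \<in> sym_group n"
    and inc: "\<And>i. i \<in> I \<Longrightarrow> inv d i < inv d (Suc i)"
  shows "T u * T d = T (u \<circ> d)"
  using u I
proof (induction rule: parabolic_induct)
  case (step i u)
  have i: "i \<in> {1..<n}" using step(1) I by blast
  have u: "u \<in> sym_group n" using step(2) by (rule parabolic_sym_group)
  have b: "bij u" "bij d" using sym_group_bij u d by auto
  have "same_block I (inv u i) (inv u (Suc i))"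
    using parabolic_inv[OF step(2)] same_block_Suc[OF step(1)] same_block_trans same_block_sym
    unfolding parabolic_def by blast
  from increasing_on_block[of I "inv d", OF inc this step(3)]
  have "inv (u \<circ> d) i < inv (u \<circ> d) (Suc i)" using b by (simp add: o_inv_distrib)
  from T_left_up[OF sym_group_comp[OF u d] i this] T_left_up[OF u i step(3)] step.IH
  show ?case by (metis comp_assoc mult.assoc)
qed (simp only: T_id mult_1 id_comp)

lemma T_parabolic_right:
  assumes v: "v \<in> parabolic n I" and I: "I \<subseteq> {1..<n}" and d: "d \<in> sym_group n"
    and inc: "\<And>i. i \<in> I \<Longrightarrow> d i < d (Suc i)"
  shows "T d * T v = T (d \<circ> v)"
proof -
  have *: "T d * T (inv u) = T (d \<circ> inv u)" if "u \<in> parabolic n I" for u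
    using that I
  proof (induction rule: parabolic_induct)
    case id
    show ?case by (simp only: T_id mult_1_right inv_id comp_id)
  next
    case (step i u)
    have i: "i \<in> {1..<n}" using step(1) I by blast
    have u: "inv u \<in> sym_group n" using parabolic_inv[OF step(2)] by (rule parabolic_sym_group)
    have e: "inv (s i \<circ> u) = inv u \<circ> s i"
      using inv_simple_comp sym_group_bij parabolic_sym_group[OF step(2)] by blast
    have "same_block I (inv u i) (inv u (Suc i))"
      using parabolic_inv[OF step(2)] same_block_Suc[OF step(1)] same_block_trans same_block_sym
      unfolding parabolic_def by blast
    from increasing_on_block[of I d, OF inc this step(3)]
    have "(d \<circ> inv u) i < (d \<circ> inv u) (Suc i)" by simp
    from T_right_up[OF sym_group_comp[OF d u] i this] T_right_up[OF u i step(3)] step.IH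
    show ?case unfolding e by (metis comp_assoc mult.assoc)
  qed
  have "inv (inv v) = v" using v parabolic_sym_group sym_group_bij inv_inv_eq by blast
  then show ?thesis using *[OF parabolic_inv[OF v]] by simp
qed

section \<open>Parabolic symmetrisers\<close>

definition symmetriser :: "'k \<Rightarrow> nat set \<Rightarrow> 'h" where
  "symmetriser c I = (\<Sum>w\<in>parabolic n I. scale (c ^ len w) (T w))"

text \<open>The two roots of the quadratic relation are \<open>c = q\<close> and \<open>c = - inverse q\<close>.\<close>
definition is_root :: "'k \<Rightarrow> bool" where "is_root c \<longleftrightarrow> c * c = 1 + (q - inverse q) * c"

lemma is_root_q: "q \<noteq> 0 \<Longrightarrow> is_root q" "q \<noteq> 0 \<Longrightarrow> is_root (- inverse q)"
  by (simp_all add: is_root_def field_simps)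

text \<open>Cosets of the subgroup of order two generated by \<open>s i\<close>, represented by
  their shorter element. Claims about symmetrisers reduce to sums of two terms, where they become
  the quadratic equation for \<open>c\<close>.\<close>

lemma sum_parabolic_left:
  assumes i: "i \<in> I" and I: "I \<subseteq> {1..<n}"
  shows "(\<Sum>w\<in>parabolic n I. f w) =
    (\<Sum>w\<in>{w\<in>parabolic n I. inv w i < inv w (Suc i)}. f w + f (s i \<circ> w))"
proof -
  let ?U = "{w\<in>parabolic n I. inv w i < inv w (Suc i)}"
  let ?V = "{w\<in>parabolic n I. \<not> inv w i < inv w (Suc i)}"
  have b: "bij w" if "w \<in> parabolic n I" for w using that parabolic_sym_group sym_group_bij by blast
  have sw: "s i \<circ> w \<in> parabolic n I" if "w \<in> parabolic n I" for w
    using parabolic_comp[OF parabolic_simple[OF i I] that] .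
  have ne: "inv w i \<noteq> inv w (Suc i)" if "w \<in> parabolic n I" for w
    using b[OF that] by (metis inv_apply_self(2) n_not_Suc_n)
  have invs: "inv (s i \<circ> w) i = inv w (Suc i)" "inv (s i \<circ> w) (Suc i) = inv w i"
    if "w \<in> parabolic n I" for w
    using b[OF that] by (simp_all add: inv_simple_comp simple_transp_apply)
  have bij: "bij_betw ((\<circ>) (s i)) ?U ?V"
  proof (rule bij_betw_byWitness[of _ "(\<circ>) (s i)"])
    show "(\<circ>) (s i) ` ?U \<subseteq> ?V" using sw invs by auto
    show "(\<circ>) (s i) ` ?V \<subseteq> ?U"
    proof (rule image_subsetI)
      fix w assume w: "w \<in> ?V"
      then have "inv w (Suc i) < inv w i" using ne[of w] by auto
      then show "s i \<circ> w \<in> ?U" using w sw invs by simp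
    qed
  qed simp_all
  have "parabolic n I = ?U \<union> ?V" by auto
  then have "(\<Sum>w\<in>parabolic n I. f w) = (\<Sum>w\<in>?U \<union> ?V. f w)" by simp
  also have "\<dots> = (\<Sum>w\<in>?U. f w) + (\<Sum>w\<in>?V. f w)"
    by (rule sum.union_disjoint) (use finite_parabolic in auto)
  also have "(\<Sum>w\<in>?V. f w) = (\<Sum>w\<in>?U. f (s i \<circ> w))"
    using sum.reindex_bij_betw[OF bij, of f] by simp
  finally show ?thesis by (simp add: sum.distrib)
qed

lemma sum_parabolic_inv: "(\<Sum>w\<in>parabolic n I. f w) = (\<Sum>w\<in>parabolic n I. f (inv w))"
proof -
  have "bij_betw inv (parabolic n I) (parabolic n I)"
    by (rule bij_betw_byWitness[of _ inv])
       (auto simp: parabolic_inv inv_inv_eq sym_group_bij[OF parabolic_sym_group])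
  from sum.reindex_bij_betw[OF this, of f] show ?thesis by simp
qed

lemma symmetriser_empty: "symmetriser c {} = 1"
  unfolding symmetriser_def parabolic_empty
  by (simp only: sum.insert finite.emptyI empty_iff not_False_eq_True sum.empty
      perm_length_id power_0 T_id scale_one add_0_right)

lemma symmetriser_left:
  assumes c: "is_root c" and i: "i \<in> I" and I: "I \<subseteq> {1..<n}"
  shows "T (s i) * symmetriser c I = scale c (symmetriser c I)"
proof -
  let ?U = "{w\<in>parabolic n I. inv w i < inv w (Suc i)}"
  let ?f = "\<lambda>w. scale (c ^ len w) (T w)"
  have i': "i \<in> {1..<n}" using i I by blast
  have "T (s i) * (?f w + ?f (s i \<circ> w)) = scale c (?f w + ?f (s i \<circ> w))" if w: "w \<in> ?U" for w
  proof -
    have w': "w \<in> sym_group n" "inv w i < inv w (Suc i)" using w parabolic_sym_group by auto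
    have sw: "T (s i \<circ> w) = T (s i) * T w" using T_left_up[OF w'(1) i' w'(2)] by simp
    have "T (s i) * (T (s i) * T w) = T w + scale (q - inverse q) (T (s i) * T w)"
      using T_quadratic[OF i'] by (simp add: distrib_right scale_mult_left flip: mult.assoc)
    then have "T (s i) * (?f w + ?f (s i \<circ> w)) =
        scale (c ^ len w) (T (s i) * T w) +
        scale (c * c ^ len w) (T w + scale (q - inverse q) (T (s i) * T w))"
      by (simp only: perm_length_simple_comp[OF w'(1) i' w'(2)] sw distrib_left scale_mult_right power_Suc)
    also have "\<dots> = scale (c * c ^ len w) (T w) +
        scale (c ^ len w + c * c ^ len w * (q - inverse q)) (T (s i) * T w)"
      by (simp only: scale_right_distrib scale_left_distrib scale_scale add_ac)
    also have "c ^ len w + c * c ^ len w * (q - inverse q) = c * (c * c ^ len w)"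
      using c unfolding is_root_def by (simp add: distrib_right mult.assoc[symmetric])
    finally show ?thesis
      by (simp only: perm_length_simple_comp[OF w'(1) i' w'(2)] sw power_Suc scale_right_distrib scale_scale)
  qed
  then show ?thesis
    unfolding symmetriser_def sum_parabolic_left[OF i I] sum_distrib_left scale_sum_right by simp
qed

lemma sum_parabolic_right:
  assumes i: "i \<in> I" and I: "I \<subseteq> {1..<n}"
  shows "(\<Sum>w\<in>parabolic n I. f w) =
    (\<Sum>w\<in>{w\<in>parabolic n I. w i < w (Suc i)}. f w + f (w \<circ> s i))"
proof -
  let ?U = "{w\<in>parabolic n I. inv w i < inv w (Suc i)}"
  have b: "bij w" if "w \<in> parabolic n I" for w using that parabolic_sym_group sym_group_bij by blast
  have bij: "bij_betw inv ?U {w\<in>parabolic n I. w i < w (Suc i)}"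
    by (rule bij_betw_byWitness[of _ inv]) (auto simp: parabolic_inv inv_inv_eq b)
  have "(\<Sum>w\<in>parabolic n I. f w) = (\<Sum>w\<in>?U. f (inv w) + f (inv (s i \<circ> w)))"
    by (subst sum_parabolic_inv) (rule sum_parabolic_left[OF i I])
  also have "\<dots> = (\<Sum>w\<in>?U. f (inv w) + f (inv w \<circ> s i))"
    by (rule sum.cong) (use b in \<open>auto simp: inv_simple_comp\<close>)
  also have "\<dots> = (\<Sum>w\<in>{w\<in>parabolic n I. w i < w (Suc i)}. f w + f (w \<circ> s i))"
    using sum.reindex_bij_betw[OF bij, of "\<lambda>w. f w + f (w \<circ> s i)"] by simp
  finally show ?thesis .
qed

lemma symmetriser_right:
  assumes c: "is_root c" and i: "i \<in> I" and I: "I \<subseteq> {1..<n}"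
  shows "symmetriser c I * T (s i) = scale c (symmetriser c I)"
proof -
  let ?U = "{w\<in>parabolic n I. w i < w (Suc i)}"
  let ?f = "\<lambda>w. scale (c ^ len w) (T w)"
  have i': "i \<in> {1..<n}" using i I by blast
  have "(?f w + ?f (w \<circ> s i)) * T (s i) = scale c (?f w + ?f (w \<circ> s i))" if w: "w \<in> ?U" for w
  proof -
    have w': "w \<in> sym_group n" "w i < w (Suc i)" using w parabolic_sym_group by auto
    have sw: "T (w \<circ> s i) = T w * T (s i)" using T_right_up[OF w'(1) i' w'(2)] by simp
    have "T w * (T (s i) * T (s i)) = T w + scale (q - inverse q) (T w * T (s i))"
      using T_quadratic[OF i'] by (simp add: distrib_left scale_mult_right)
    then have "(?f w + ?f (w \<circ> s i)) * T (s i) =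
        scale (c ^ len w) (T w * T (s i)) +
        scale (c * c ^ len w) (T w + scale (q - inverse q) (T w * T (s i)))"
      by (simp only: perm_length_comp_simple[OF w'(1) i' w'(2)] sw distrib_right scale_mult_left power_Suc mult.assoc)
    also have "\<dots> = scale (c * c ^ len w) (T w) +
        scale (c ^ len w + c * c ^ len w * (q - inverse q)) (T w * T (s i))"
      by (simp only: scale_right_distrib scale_left_distrib scale_scale add_ac)
    also have "c ^ len w + c * c ^ len w * (q - inverse q) = c * (c * c ^ len w)"
      using c unfolding is_root_def by (simp add: distrib_right mult.assoc[symmetric])
    finally show ?thesis
      by (simp only: perm_length_comp_simple[OF w'(1) i' w'(2)] sw power_Suc scale_right_distrib scale_scale)
  qed
  then show ?thesis
    unfolding symmetriser_def sum_parabolic_right[OF i I] sum_distrib_right scale_sum_right by simp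
qed

definition poincare :: "'k \<Rightarrow> nat set \<Rightarrow> 'k" where
  "poincare c I = (\<Sum>w\<in>parabolic n I. c ^ (2 * len w))"

lemma T_parabolic_eigen:
  assumes w: "w \<in> parabolic n I" and I: "I \<subseteq> {1..<n}"
    and v: "\<And>i. i \<in> I \<Longrightarrow> T (s i) * v = scale c v"
  shows "T w * v = scale (c ^ len w) v"
  using w I
proof (induction rule: parabolic_induct)
  case (step i w)
  have w: "w \<in> sym_group n" and i: "i \<in> {1..<n}" using step parabolic_sym_group I by auto
  have "T (s i \<circ> w) * v = T (s i) * (T w * v)"
    using T_left_up[OF w i step(3)] by (simp flip: mult.assoc)
  also have "\<dots> = scale (c ^ len (s i \<circ> w)) v"
    unfolding step.IH perm_length_simple_comp[OF w i step(3)]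
    using v[OF step(1)] by (simp add: scale_mult_right mult.commute)
  finally show ?case .
qed (simp only: T_id mult_1 perm_length_id power_0 scale_one)

lemma symmetriser_eigen:
  assumes I: "I \<subseteq> {1..<n}" and v: "\<And>i. i \<in> I \<Longrightarrow> T (s i) * v = scale c v"
  shows "symmetriser c I * v = scale (poincare c I) v"
proof -
  have "symmetriser c I * v = (\<Sum>w\<in>parabolic n I. scale (c ^ len w) (T w * v))"
    by (simp add: symmetriser_def sum_distrib_right scale_mult_left)
  also have "\<dots> = (\<Sum>w\<in>parabolic n I. scale (c ^ (2 * len w)) v)"
    by (rule sum.cong) (simp_all add: T_parabolic_eigen[OF _ I v] mult_2 power_add)
  finally show ?thesis by (simp add: poincare_def scale_sum_left)
qed

lemma symmetriser_commute:
  assumes I: "I \<subseteq> {1..<n}" and a: "\<And>i. i \<in> I \<Longrightarrow> a * T (s i) = T (s i) * a"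
  shows "a * symmetriser c I = symmetriser c I * a"
proof -
  have "a * T w = T w * a" if "w \<in> parabolic n I" for w
    using that I
  proof (induction rule: parabolic_induct)
    case (step i w)
    have w: "w \<in> sym_group n" and i: "i \<in> {1..<n}" using step parabolic_sym_group I by auto
    show ?case unfolding T_left_up[OF w i step(3), symmetric]
      using a[OF step(1)] step.IH by (metis mult.assoc)
  qed (simp only: T_id mult_1 mult_1_right)
  then show ?thesis
    by (simp add: symmetriser_def sum_distrib_left sum_distrib_right scale_mult_left scale_mult_right)
qed

end

section \<open>Factorisation of a parabolic subgroup along its last generator\<close>

primrec cyc :: "nat \<Rightarrow> nat \<Rightarrow> nat \<Rightarrow> nat" where
  "cyc k 0 = id"
| "cyc k (Suc m) = cyc k m \<circ> simple_transp (k - m)"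

text \<open>\<open>cyc k m\<close> is the product of \<open>m\<close> simple transpositions with
  indices \<open>k, k - 1, ...\<close> from the left. These cycles are the minimal coset
  representatives once the largest generator \<open>k\<close> is dropped.\<close>

lemma cyc_apply: "m \<le> k \<Longrightarrow> cyc k m (Suc k - m) = Suc k"
  by (induction m) (auto simp: simple_transp_apply Suc_diff_le)

lemma cyc_fix: "p < Suc k - m \<Longrightarrow> cyc k m p = p"
  by (induction m) (auto simp: simple_transp_apply)

lemma same_blockD: "same_block I a b \<Longrightarrow> a \<le> x \<and> x < b \<or> b \<le> x \<and> x < a \<Longrightarrow> x \<in> I"
  unfolding same_block_def by (rule subsetD) auto

lemma same_blockI: "(\<And>x. a \<le> x \<and> x < b \<or> b \<le> x \<and> x < a \<Longrightarrow> x \<in> I) \<Longrightarrow> same_block I a b"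
  by (force simp: same_block_def min_def max_def split: if_splits)

lemma same_block_less:
  assumes v: "v \<in> parabolic n J" and p: "p < p'" "\<not> same_block J p p'"
  shows "v p < v p'"
proof -
  obtain k where k: "k \<in> {p..<p'}" "k \<notin> J" using p same_blockI[of p p' J] by fastforce
  have "same_block J p (v p)" "same_block J p' (v p')" using v by (auto simp: parabolic_def)
  then have "v p \<le> k" "k < v p'"
    using k same_blockD[of J p "v p" k] same_blockD[of J p' "v p'" k] by (force simp: not_le)+
  then show ?thesis by simp
qed

text \<open>Equivalently, the parabolic subgroup of \<open>I\<close> meets the
  \<open>d\<close>-conjugate of that of \<open>J\<close> trivially.\<close>

definition transversal :: "nat set \<Rightarrow> nat set \<Rightarrow> (nat \<Rightarrow> nat) \<Rightarrow> bool" where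
  "transversal I J d \<longleftrightarrow> (\<forall>p p'. same_block J p p' \<longrightarrow> same_block I (d p) (d p') \<longrightarrow> p = p')"

text \<open>The representatives of minimal length of the double cosets of the two parabolic
  subgroups.\<close>

definition reduced :: "nat \<Rightarrow> nat set \<Rightarrow> nat set \<Rightarrow> (nat \<Rightarrow> nat) \<Rightarrow> bool" where
  "reduced n I J d \<longleftrightarrow> d \<in> sym_group n \<and> (\<forall>i\<in>I. inv d i < inv d (Suc i)) \<and> (\<forall>i\<in>J. d i < d (Suc i))"

context hecke_algebra
begin

primrec Tcyc :: "nat \<Rightarrow> nat \<Rightarrow> 'h" where
  "Tcyc k 0 = 1"
| "Tcyc k (Suc m) = Tcyc k m * T (s (k - m))"

lemma Tcyc_Suc: "Tcyc (Suc k) (Suc m) = T (s (Suc k)) * Tcyc k m"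
  by (induction m) (simp_all add: mult.assoc)

lemma Tcyc_commute:
  assumes "\<And>i. i < m \<Longrightarrow> a * T (s (k - i)) = T (s (k - i)) * a"
  shows "a * Tcyc k m = Tcyc k m * a"
  using assms
proof (induction m)
  case (Suc m)
  then have "a * Tcyc k m = Tcyc k m * a" "a * T (s (k - m)) = T (s (k - m)) * a" by auto
  then show ?case by (metis Tcyc.simps(2) mult.assoc)
qed simp

text \<open>Here \<open>k\<close> is the largest element of \<open>I\<close> and
  \<open>{a..k}\<close> the maximal run ending in it, so \<open>Suc k\<close> is the last point of
  the block \<open>{a..Suc k}\<close>.\<close>

context
  fixes I k a
  assumes I: "I \<subseteq> {1..<n}" and k: "k \<in> I" "I \<subseteq> {..k}" and a: "{a..k} \<subseteq> I" "a - 1 \<notin> I" "a \<le> k"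
begin

lemma a_pos: "a \<ge> 1"
  using I a k by (cases a) auto

lemma cyc_parabolic: "m \<le> Suc k - a \<Longrightarrow> cyc k m \<in> parabolic n I"
proof (induction m)
  case 0
  show ?case unfolding cyc.simps by (rule parabolic_id)
next
  case (Suc m)
  then have "k - m \<in> I" using a by auto
  then show ?case unfolding cyc.simps
    using Suc by (intro parabolic_comp parabolic_simple I) auto
qed

lemma parabolic_smaller:
  assumes "u \<in> parabolic n (I - {k})"
  shows "u (Suc k) = Suc k" "p \<le> k \<Longrightarrow> u p \<le> k"
proof -
  have b: "same_block (I - {k}) p (u p)" for p using assms by (simp add: parabolic_def)
  show "u (Suc k) = Suc k"
  proof (rule ccontr)
    assume "u (Suc k) \<noteq> Suc k"
    then have "k \<in> I - {k} \<or> Suc k \<in> I - {k}"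
      using same_blockD[OF b[of "Suc k"], of k] same_blockD[OF b[of "Suc k"], of "Suc k"]
      by (metis less_Suc_eq less_Suc_eq_le linorder_neqE_nat order_refl)
    then show False using k(2) by auto
  qed
  show "u p \<le> k" if "p \<le> k"
  proof (rule ccontr)
    assume "\<not> u p \<le> k"
    then have "k \<in> I - {k}" using that same_blockD[OF b[of p], of k] by simp
    then show False by simp
  qed
qed

lemma parabolic_smaller_subset: "parabolic n (I - {k}) \<subseteq> parabolic n I"
  by (auto simp: parabolic_def same_block_def)

lemma T_cyc:
  assumes u: "u \<in> parabolic n (I - {k})" and m: "m \<le> Suc k - a"
  shows "T (u \<circ> cyc k m) = T u * Tcyc k m \<and> len (u \<circ> cyc k m) = len u + m"
  using m
proof (induction m)
  case 0
  show ?case by (simp only: cyc.simps Tcyc.simps comp_id mult_1_right add_0_right)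
next
  case (Suc m)
  have w: "u \<circ> cyc k m \<in> sym_group n"
    using parabolic_comp[OF subsetD[OF parabolic_smaller_subset u] cyc_parabolic] Suc.prems
    by (intro parabolic_sym_group[of _ n I]) auto
  have "k - m \<in> {a..k}" using Suc.prems by auto
  then have i: "k - m \<in> {1..<n}" using a(1) I by blast
  have "m \<le> k" using Suc.prems a_pos by simp
  then have "cyc k m (Suc (k - m)) = Suc k" using cyc_apply[of m k] by (simp add: Suc_diff_le)
  moreover have "cyc k m (k - m) = k - m" using cyc_fix[of "k - m" k m] \<open>m \<le> k\<close> by simp
  ultimately have up: "(u \<circ> cyc k m) (k - m) < (u \<circ> cyc k m) (Suc (k - m))"
    using parabolic_smaller(1)[OF u] parabolic_smaller(2)[OF u, of "k - m"] by simp
  have IH: "T (u \<circ> cyc k m) = T u * Tcyc k m" "len (u \<circ> cyc k m) = len u + m"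
    using Suc.IH[OF Suc_leD[OF Suc.prems]] by blast+
  show ?case
    unfolding cyc.simps Tcyc.simps comp_assoc[symmetric]
    using T_right_up[OF w i up] perm_length_comp_simple[OF w i up] unfolding IH by (metis add_Suc_right mult.assoc)
qed

text \<open>The factor \<open>cyc k m\<close> is determined by the preimage \<open>Suc k - m\<close>
  of \<open>Suc k\<close>; the remaining factor fixes \<open>Suc k\<close>, and therefore avoids the
  generator \<open>k\<close>.\<close>

lemma parabolic_factor_bij:
  "bij_betw (\<lambda>(m, u). u \<circ> cyc k m) ({..Suc k - a} \<times> parabolic n (I - {k})) (parabolic n I)"
proof (rule bij_betw_imageI)
  have le: "m \<le> k" if "m \<le> Suc k - a" for m using that a_pos by simp
  have bc: "bij (cyc k m)" if "m \<le> Suc k - a" for m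
    using cyc_parabolic[OF that] parabolic_sym_group sym_group_bij by blast
  have val: "(u \<circ> cyc k m) (Suc k - m) = Suc k" if "m \<le> Suc k - a" "u \<in> parabolic n (I - {k})" for m u
    using cyc_apply[OF le[OF that(1)]] parabolic_smaller(1)[OF that(2)] by simp
  show "inj_on (\<lambda>(m, u). u \<circ> cyc k m) ({..Suc k - a} \<times> parabolic n (I - {k}))"
  proof (intro inj_onI, clarify)
    fix m u m' u'
    assume m: "m \<le> Suc k - a" "m' \<le> Suc k - a" and u: "u \<in> parabolic n (I - {k})" "u' \<in> parabolic n (I - {k})"
      and eq: "u \<circ> cyc k m = u' \<circ> cyc k m'"
    have "bij (u \<circ> cyc k m)"
      using bij_comp[OF bc[OF m(1)]] u(1) parabolic_sym_group sym_group_bij by blast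
    then have "Suc k - m = Suc k - m'"
      using val[OF m(1) u(1)] val[OF m(2) u(2)] eq by (metis bij_is_inj injD)
    then have mm: "m = m'" using le m by (metis Suc_diff_le diff_diff_cancel le_Suc_eq)
    then have "u \<circ> cyc k m = u' \<circ> cyc k m" using eq by simp
    then have "u = u'" using bij_is_surj[OF bc[OF m(1)]] by (simp add: fun_eq_iff surj_def) (metis)
    then show "m = m' \<and> u = u'" using mm by simp
  qed
  show "(\<lambda>(m, u). u \<circ> cyc k m) ` ({..Suc k - a} \<times> parabolic n (I - {k})) = parabolic n I"
  proof (intro set_eqI iffI)
    fix w assume "w \<in> (\<lambda>(m, u). u \<circ> cyc k m) ` ({..Suc k - a} \<times> parabolic n (I - {k}))"
    then show "w \<in> parabolic n I"
      using parabolic_comp parabolic_smaller_subset cyc_parabolic by auto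
  next
    fix w assume w: "w \<in> parabolic n I"
    have bw: "bij w" using w parabolic_sym_group sym_group_bij by blast
    define p where "p = inv w (Suc k)"
    have wp: "w p = Suc k" by (simp add: p_def inv_apply_self(2)[OF bw])
    have blk: "same_block I p (Suc k)" using w wp by (metis (mono_tags, lifting) mem_Collect_eq parabolic_def)
    have p_le: "p \<le> Suc k"
    proof (rule ccontr)
      assume "\<not> p \<le> Suc k"
      then have "Suc k \<in> I" using same_blockD[OF blk, of "Suc k"] by simp
      then show False using k(2) by auto
    qed
    have p_ge: "a \<le> p"
    proof (rule ccontr)
      assume "\<not> a \<le> p"
      then have "a - 1 \<in> I" using a(3) by (intro same_blockD[OF blk, of "a - 1"]) auto
      then show False using a(2) by simp
    qed
    define m where "m = Suc k - p"
    have m: "m \<le> Suc k - a" using p_ge by (simp add: m_def)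
    define u where "u = w \<circ> inv (cyc k m)"
    have uc: "u \<circ> cyc k m = w" by (simp add: u_def fun_eq_iff inv_apply_self(1)[OF bc[OF m]])
    have uI: "u \<in> parabolic n I"
      unfolding u_def by (intro parabolic_comp w parabolic_inv cyc_parabolic m)
    have bu: "bij u" using uI parabolic_sym_group sym_group_bij by blast
    have "Suc k - m = p" using p_le by (simp add: m_def)
    then have "u (Suc k) = Suc k"
      using cyc_apply[OF le[OF m]] wp by (metis uc comp_apply)
    then have uk: "x = Suc k" if "u x = Suc k" for x using that bu by (metis bij_is_inj injD)
    have "same_block (I - {k}) x (u x)" for x
    proof -
      have bx: "same_block I x (u x)" using uI by (simp add: parabolic_def)
      have "k \<notin> {min x (u x)..<max x (u x)}"
      proof
        assume kin: "k \<in> {min x (u x)..<max x (u x)}"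
        have "max x (u x) - 1 \<in> {min x (u x)..<max x (u x)}" using kin by auto
        then have "max x (u x) - 1 \<le> k" using bx k(2) by (auto simp: same_block_def)
        then have "max x (u x) = Suc k" using kin by auto
        then have "x = Suc k \<or> u x = Suc k" by (auto simp: max_def split: if_splits)
        then have "x = Suc k \<and> u x = Suc k" using uk \<open>u (Suc k) = Suc k\<close> by auto
        then show False using kin by auto
      qed
      then show ?thesis using bx by (auto simp: same_block_def)
    qed
    then have "u \<in> parabolic n (I - {k})" using uI by (simp add: parabolic_def)
    then show "w \<in> (\<lambda>(m, u). u \<circ> cyc k m) ` ({..Suc k - a} \<times> parabolic n (I - {k}))"
      using m uc by (intro image_eqI[of _ _ "(m, u)"]) auto
  qed
qed

lemma sum_parabolic_factor:
  "(\<Sum>w\<in>parabolic n I. f w) = (\<Sum>m\<le>Suc k - a. \<Sum>u\<in>parabolic n (I - {k}). f (u \<circ> cyc k m))"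
  using sum.reindex_bij_betw[OF parabolic_factor_bij, of f]
  by (simp add: sum.cartesian_product split_beta)

lemma symmetriser_factor:
  "symmetriser c I = symmetriser c (I - {k}) * (\<Sum>m\<le>Suc k - a. scale (c ^ m) (Tcyc k m))"
  unfolding symmetriser_def sum_parabolic_factor sum_distrib_left sum_distrib_right
  by (intro sum.cong refl) (simp add: T_cyc power_add scale_mult_left scale_mult_right mult.commute)

lemma poincare_factor:
  "poincare c I = poincare c (I - {k}) * (\<Sum>m<Suc (Suc k - a). c ^ (2 * m))"
  unfolding poincare_def sum_parabolic_factor sum_distrib_left sum_distrib_right lessThan_Suc_atMost
  by (intro sum.cong refl) (simp add: T_cyc power_add distrib_left)

end

lemma block_start:
  assumes "I \<subseteq> {1..<n}" "k \<in> I"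
  obtains a where "{a..k} \<subseteq> I" "a - 1 \<notin> I" "a \<le> k"
proof -
  define a where "a = (LEAST a. {a..k} \<subseteq> I)"
  have ex: "{k..k} \<subseteq> I" using assms(2) by simp
  have 1: "{a..k} \<subseteq> I" unfolding a_def by (rule LeastI, rule ex)
  have 2: "a \<le> k" unfolding a_def by (rule Least_le, rule ex)
  have "a - 1 \<notin> I"
  proof
    assume "a - 1 \<in> I"
    moreover have "0 \<notin> I" using assms(1) by auto
    ultimately have pos: "a > 1" by (cases "a \<le> 1") auto
    have "{a - 1..k} = insert (a - 1) {a..k}" using pos 2 by auto
    then have "{a - 1..k} \<subseteq> I" using 1 \<open>a - 1 \<in> I\<close> by simp
    then have "a \<le> a - 1" unfolding a_def by (rule Least_le)
    then show False using pos by simp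
  qed
  then show ?thesis using that 1 2 by blast
qed

text \<open>Removing the largest generator repeatedly writes the Poincare polynomial as a product of
  quantum integers, each of the size of an initial part of a block and so at most
  \<open>n\<close>.\<close>

lemma poincare_nonzero:
  assumes "I \<subseteq> {1..<n}" and c: "\<And>m. m \<in> {1..n} \<Longrightarrow> (\<Sum>j<m. c ^ (2 * j)) \<noteq> 0"
  shows "poincare c I \<noteq> 0"
  using finite_subset[OF assms(1) finite_atLeastLessThan] assms(1)
proof (induction I rule: finite_psubset_induct)
  case (psubset I)
  show ?case
  proof (cases "I = {}")
    case True
    show ?thesis unfolding poincare_def True parabolic_empty
      by (simp only: sum.insert finite.emptyI empty_iff not_False_eq_True sum.empty
          perm_length_id mult_0_right power_0 add_0_right one_neq_zero)
  next
    case False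
    define k where "k = Max I"
    have k: "k \<in> I" "I \<subseteq> {..k}" using False psubset.hyps by (auto simp: k_def)
    obtain a where a: "{a..k} \<subseteq> I" "a - 1 \<notin> I" "a \<le> k" using block_start[OF psubset.prems k(1)] .
    have "poincare c (I - {k}) \<noteq> 0" using psubset k(1) by (intro psubset.IH) auto
    moreover have "a \<ge> 1" "k < n" using a_pos[OF psubset.prems k a] psubset.prems k by auto
    then have "(\<Sum>m<Suc (Suc k - a). c ^ (2 * m)) \<noteq> 0" by (intro c) auto
    ultimately show ?thesis using poincare_factor[OF psubset.prems k a] by simp
  qed
qed

section \<open>Double cosets\<close>

text \<open>A descent of \<open>d\<close> in \<open>I\<close> or \<open>J\<close> is absorbed by the
  adjacent symmetriser as a scalar. If a reduced \<open>d\<close> is not transversal, some generator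
  of \<open>I\<close> passes through \<open>T d\<close> into a generator of \<open>J\<close>; it
  acts by \<open>c\<close> on the left and by \<open>c'\<close> on the right, so the product is
  zero.\<close>

lemma sandwich_T:
  assumes I: "I \<subseteq> {1..<n}" and J: "J \<subseteq> {1..<n}" and c: "is_root c" "is_root c'" "c \<noteq> c'"
    and d: "d \<in> sym_group n"
  shows "symmetriser c I * T d * symmetriser c' J = 0 \<or>
    (\<exists>d' a. reduced n I J d' \<and> transversal I J d' \<and>
       symmetriser c I * T d * symmetriser c' J = scale a (symmetriser c I * T d' * symmetriser c' J))"
  using d
proof (induction "len d" arbitrary: d rule: less_induct)
  case less
  let ?Y = "symmetriser c I" and ?Z = "symmetriser c' J"
  have b: "bij d" by (rule sym_group_bij[OF less.prems])
  have step: ?case if "d' \<in> sym_group n" "len d = Suc (len d')" "?Y * T d * ?Z = scale x (?Y * T d' * ?Z)" for d' x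
    using less.hyps[of d'] that by (metis lessI scale_scale scale_zero_right)
  consider (J) i where "i \<in> J" "d (Suc i) < d i" | (I) i where "i \<in> I" "inv d (Suc i) < inv d i"
    | (red) "\<And>i. i \<in> J \<Longrightarrow> d i < d (Suc i)" "\<And>i. i \<in> I \<Longrightarrow> inv d i < inv d (Suc i)"
    using b by (metis inv_apply_self n_not_Suc_n nat_neq_iff)
  then show ?case
  proof cases
    case J
    have i: "i \<in> {1..<n}" using J \<open>J \<subseteq> {1..<n}\<close> by blast
    let ?d = "d \<circ> s i"
    have d': "?d \<in> sym_group n" by (rule sym_group_comp[OF less.prems sym_group_simple[OF i]])
    have up: "?d i < ?d (Suc i)" using J by (simp add: simple_transp_apply)
    have "T d = T ?d * T (s i)" using T_right_up[OF d' i up] by (simp only: simple_transp_cancel)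
    then have "?Y * T d * ?Z = ?Y * T ?d * (T (s i) * ?Z)" by (simp only: mult.assoc)
    also have "\<dots> = scale c' (?Y * T ?d * ?Z)"
      by (simp only: symmetriser_left[OF c(2) J(1) \<open>J \<subseteq> {1..<n}\<close>] scale_mult_right)
    finally show ?thesis
      by (intro step[OF d']) (use perm_length_comp_simple[OF d' i up] in \<open>simp only: simple_transp_cancel\<close>)
  next
    case I
    have i: "i \<in> {1..<n}" using I \<open>I \<subseteq> {1..<n}\<close> by blast
    let ?d = "s i \<circ> d"
    have d': "?d \<in> sym_group n" by (rule sym_group_comp[OF sym_group_simple[OF i] less.prems])
    have up: "inv ?d i < inv ?d (Suc i)" using I by (simp add: inv_simple_comp[OF b] simple_transp_apply)
    have "T d = T (s i) * T ?d" using T_left_up[OF d' i up] by (simp only: simple_transp_cancel)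
    then have "?Y * T d * ?Z = (?Y * T (s i)) * T ?d * ?Z" by (simp only: mult.assoc)
    also have "\<dots> = scale c (?Y * T ?d * ?Z)"
      by (simp only: symmetriser_right[OF c(1) I(1) \<open>I \<subseteq> {1..<n}\<close>] scale_mult_left)
    finally show ?thesis
      by (intro step[OF d']) (use perm_length_simple_comp[OF d' i up] in \<open>simp only: simple_transp_cancel\<close>)
  next
    case red
    then have R: "reduced n I J d" using less.prems by (simp add: reduced_def)
    show ?thesis
    proof (cases "transversal I J d")
      case True
      then show ?thesis using R by (metis scale_one)
    next
      case False
      then obtain p1 p2 where p12: "same_block J p1 p2" "same_block I (d p1) (d p2)" "p1 \<noteq> p2"
        by (auto simp: transversal_def)
      define p p' where "p = min p1 p2" and "p' = max p1 p2"
      have p: "same_block J p p'" "same_block I (d p) (d p')" "p < p'"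
        using p12 same_block_sym by (auto simp: p_def p'_def min_def max_def)
      have pJ: "p \<in> J" using p by (auto simp: same_block_def)
      have "same_block J (Suc p) p'" using p by (auto simp: same_block_def)
      then have "d (Suc p) \<le> d p'"
        using increasing_on_block[of J d "Suc p" p'] red(1) p(3) by (cases "Suc p = p'") auto
      moreover have dp: "d p < d (Suc p)" using red(1)[OF pJ] .
      ultimately have blk: "{d p..<d (Suc p)} \<subseteq> I" using p(2) by (auto simp: same_block_def)
      \<comment> \<open>A value strictly between \<open>d p\<close> and \<open>d (Suc p)\<close>
        would lie in the same \<open>I\<close>-block, and since \<open>inv d\<close> increases
        there, its preimage would lie strictly between \<open>p\<close> and
        \<open>Suc p\<close>.\<close>
      have nxt: "d (Suc p) = Suc (d p)"
      proof (rule ccontr)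
        assume "d (Suc p) \<noteq> Suc (d p)"
        then have y: "Suc (d p) < d (Suc p)" using dp by simp
        have "inv d (d p) < inv d (Suc (d p))" by (rule red(2)) (use blk dp in auto)
        moreover have "same_block I (Suc (d p)) (d (Suc p))"
          by (rule same_blockI) (use blk y in auto)
        then have "inv d (Suc (d p)) < inv d (d (Suc p))"
          using increasing_on_block[of I "inv d" "Suc (d p)" "d (Suc p)"] red(2) y by blast
        ultimately show False by (simp add: inv_apply_self(1)[OF b])
      qed
      let ?i = "d p"
      have iI: "?i \<in> I" using blk dp by auto
      have i: "?i \<in> {1..<n}" and pn: "p \<in> {1..<n}" using iI pJ I J by auto
      have comm: "s ?i \<circ> d = d \<circ> s p"
        using nxt bij_is_inj[OF b] by (auto simp: fun_eq_iff simple_transp_apply inj_eq) (metis inj_eq nxt)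
      have "inv d ?i < inv d (Suc ?i)" by (rule red(2)[OF iI])
      from T_left_up[OF less.prems i this] T_right_up[OF less.prems pn dp] comm
      have e: "T (s ?i) * T d = T d * T (s p)" by simp
      have "scale c (?Y * T d * ?Z) = ?Y * (T (s ?i) * T d) * ?Z"
        by (simp only: mult.assoc[symmetric] symmetriser_right[OF c(1) iI I] scale_mult_left)
      also have "\<dots> = ?Y * T d * (T (s p) * ?Z)" by (simp only: e mult.assoc)
      also have "\<dots> = scale c' (?Y * T d * ?Z)"
        by (simp only: symmetriser_left[OF c(2) pJ J] scale_mult_right)
      finally show ?thesis using c(3) by simp
    qed
  qed
qed

text \<open>Taking \<open>V\<close> to be zero gives vanishing, taking it to be a line gives
  proportionality to one double coset element.\<close>

lemma sandwich:
  assumes I: "I \<subseteq> {1..<n}" and J: "J \<subseteq> {1..<n}" and c: "is_root c" "is_root c'" "c \<noteq> c'"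
    and one: "\<And>d. reduced n I J d \<Longrightarrow> transversal I J d \<Longrightarrow> symmetriser c I * T d * symmetriser c' J \<in> V"
    and V: "subspace V"
  shows "symmetriser c I * h * symmetriser c' J \<in> V"
proof -
  have "h \<in> span (T ` sym_group n)" by (simp add: T_span)
  then show ?thesis
  proof (induction rule: span_induct_alt)
    case base
    then show ?case using V by (simp add: subspace_0)
  next
    case (step a x y)
    then obtain d where d: "d \<in> sym_group n" "x = T d" by auto
    have "symmetriser c I * x * symmetriser c' J \<in> V"
      using sandwich_T[OF I J c d(1)] one V d(2) by (auto simp: subspace_0 subspace_scale)
    then show ?case using step V
      by (simp add: distrib_left distrib_right scale_mult_left scale_mult_right subspace_add subspace_scale)
  qed
qed

lemma sandwich_zero:
  assumes "I \<subseteq> {1..<n}" "J \<subseteq> {1..<n}" "is_root c" "is_root c'" "c \<noteq> c'"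
    and "\<And>d. reduced n I J d \<Longrightarrow> \<not> transversal I J d"
  shows "symmetriser c I * h * symmetriser c' J = 0"
  using sandwich[OF assms(1-5), of "{0}" h] assms(6) by (auto simp: subspace_single_0)

lemma sandwich_one:
  assumes "I \<subseteq> {1..<n}" "J \<subseteq> {1..<n}" "is_root c" "is_root c'" "c \<noteq> c'"
    and "\<And>d. reduced n I J d \<Longrightarrow> transversal I J d \<Longrightarrow> d = d0"
  shows "\<exists>a. symmetriser c I * h * symmetriser c' J = scale a (symmetriser c I * T d0 * symmetriser c' J)"
proof -
  let ?z = "symmetriser c I * T d0 * symmetriser c' J"
  have "symmetriser c I * h * symmetriser c' J \<in> span {?z}"
    by (rule sandwich[OF assms(1-5) _ subspace_span]) (use assms(6) span_base in blast)
  then show ?thesis by (auto simp: span_singleton)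
qed

text \<open>For reduced transversal \<open>d\<close> the products \<open>u d v\<close> are pairwise
  distinct and their lengths add. Expanding both symmetrisers therefore gives distinct basis
  elements with nonzero coefficients.\<close>

lemma sandwich_nonzero:
  assumes I: "I \<subseteq> {1..<n}" and J: "J \<subseteq> {1..<n}" and c: "c \<noteq> 0" "c' \<noteq> 0"
    and d: "reduced n I J d" and tr: "transversal I J d"
  shows "symmetriser c I * T d * symmetriser c' J \<noteq> 0"
proof
  assume zero: "symmetriser c I * T d * symmetriser c' J = 0"
  have dS: "d \<in> sym_group n" and inc: "\<And>i. i \<in> I \<Longrightarrow> inv d i < inv d (Suc i)" "\<And>i. i \<in> J \<Longrightarrow> d i < d (Suc i)"
    using d by (auto simp: reduced_def)
  have bd: "bij d" by (rule sym_group_bij[OF dS])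
  let ?P = "parabolic n I \<times> parabolic n J"
  have Tud: "T u * T d * T v = T (u \<circ> (d \<circ> v))" if u: "u \<in> parabolic n I" and v: "v \<in> parabolic n J" for u v
  proof -
    have vS: "v \<in> sym_group n" using v by (rule parabolic_sym_group)
    have bv: "bij v" by (rule sym_group_bij[OF vS])
    \<comment> \<open>Transversality puts the preimages of \<open>i\<close> and \<open>Suc i\<close>
      under \<open>d\<close> into different \<open>J\<close>-blocks, so the permutation
      \<open>v\<close> of each block cannot reverse their order.\<close>
    have "inv (d \<circ> v) i < inv (d \<circ> v) (Suc i)" if i: "i \<in> I" for i
    proof -
      have "\<not> same_block J (inv d i) (inv d (Suc i))"
      proof
        assume "same_block J (inv d i) (inv d (Suc i))"
        moreover have "same_block I (d (inv d i)) (d (inv d (Suc i)))"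
          using same_block_Suc[OF i] by (simp add: inv_apply_self(2)[OF bd])
        ultimately have "inv d i = inv d (Suc i)" using tr unfolding transversal_def by blast
        then show False using inc(1)[OF i] by simp
      qed
      from same_block_less[OF parabolic_inv[OF v] inc(1)[OF i] this]
      show ?thesis by (simp add: o_inv_distrib[OF bd bv])
    qed
    from T_parabolic_left[OF u I sym_group_comp[OF dS vS] this] T_parabolic_right[OF v J dS inc(2)]
    show ?thesis by (simp only: mult.assoc)
  qed
  define F where "F = (\<lambda>(u, v). T (u \<circ> (d \<circ> v)))"
  have inj: "inj_on F ?P"
  proof (rule inj_onI, clarify)
    fix u v u' v'
    assume u: "u \<in> parabolic n I" "u' \<in> parabolic n I" and v: "v \<in> parabolic n J" "v' \<in> parabolic n J"
      and eq: "F (u, v) = F (u', v')"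
    have S: "u \<circ> (d \<circ> v) \<in> sym_group n" "u' \<circ> (d \<circ> v') \<in> sym_group n"
      using u v dS by (meson sym_group_comp parabolic_sym_group)+
    have e: "u \<circ> (d \<circ> v) = u' \<circ> (d \<circ> v')"
      using eq T_inj S by (auto simp: F_def inj_on_def)
    have bu': "bij u'" and bv: "bij v" using u v parabolic_sym_group sym_group_bij by blast+
    have ev: "v' x = v x" for x
    proof -
      have "u (d (v x)) = u' (d (v' x))" using fun_cong[OF e, of x] by simp
      then have "inv u' (u (d (v x))) = d (v' x)" by (simp add: inv_apply_self(1)[OF bu'])
      moreover have "same_block I (d (v x)) (inv u' (u (d (v x))))"
        using parabolic_comp[OF parabolic_inv[OF u(2)] u(1)] by (simp add: parabolic_def)
      ultimately have "same_block I (d (v x)) (d (v' x))" by simp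
      moreover have "same_block J (v x) (v' x)"
        using v same_block_trans same_block_sym unfolding parabolic_def by blast
      ultimately show ?thesis using tr unfolding transversal_def by metis
    qed
    then have "v = v'" by (simp add: fun_eq_iff)
    have bdv: "bij (d \<circ> v)" using bij_comp[OF bv bd] .
    have "u y = u' y" for y
      using fun_cong[OF e, of "inv (d \<circ> v) y"] inv_apply_self(2)[OF bdv, of y] \<open>v = v'\<close> by simp
    then show "u = u' \<and> v = v'" using \<open>v = v'\<close> by (simp add: fun_eq_iff)
  qed
  let ?c = "\<lambda>(u, v). c ^ len u * c' ^ len v"
  have "symmetriser c I * T d * symmetriser c' J =
    (\<Sum>u\<in>parabolic n I. \<Sum>v\<in>parabolic n J. scale (c ^ len u * c' ^ len v) (T u * T d * T v))"
    unfolding symmetriser_def sum_distrib_right unfolding sum_distrib_left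
    by (simp add: scale_mult_left scale_mult_right mult.commute)
  also have "\<dots> = (\<Sum>p\<in>?P. scale (?c p) (F p))"
    by (simp only: Tud F_def split_beta sum.cartesian_product fst_conv snd_conv cong: sum.cong)
  also have "\<dots> = (\<Sum>x\<in>F ` ?P. scale (?c (inv_into ?P F x)) x)"
    by (simp add: sum.reindex[OF inj] inv_into_f_f[OF inj])
  finally have sum0: "(\<Sum>x\<in>F ` ?P. scale (?c (inv_into ?P F x)) x) = 0" using zero by simp
  have sub: "F ` ?P \<subseteq> T ` sym_group n"
  proof -
    have "u \<circ> (d \<circ> v) \<in> sym_group n" if "u \<in> parabolic n I" "v \<in> parabolic n J" for u v
      using that dS by (meson sym_group_comp parabolic_sym_group)
    then show ?thesis by (auto simp: F_def)
  qed
  \<comment> \<open>Independence is contradicted at the basis element \<open>T d\<close>, whose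
    coefficient is 1.\<close>
  have idP: "(id, id) \<in> ?P" by (simp add: parabolic_id)
  have "?c (inv_into ?P F (F (id, id))) = 0"
    by (rule independentD[OF T_independent _ sub sum0]) (use finite_parabolic idP in blast)+
  then show False using c by (simp only: inv_into_f_f[OF inj idP]) (simp add: split_beta)
qed

end

section \<open>Combinatorics of compositions, partitions and dominance\<close>

section \<open>Compositions and their blocks\<close>

definition psum :: "nat list \<Rightarrow> nat \<Rightarrow> nat" where "psum mu k = sum_list (take k mu)"

definition block :: "nat list \<Rightarrow> nat \<Rightarrow> nat set" where "block mu k = {psum mu k<..psum mu (Suc k)}"

definition links :: "nat list \<Rightarrow> nat set" where
  "links mu = {1..<sum_list mu} - range (psum mu)"

lemma psum_0 [simp]: "psum mu 0 = 0" by (simp add: psum_def)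

lemma psum_Suc: "k < length mu \<Longrightarrow> psum mu (Suc k) = psum mu k + mu ! k"
  by (simp add: psum_def take_Suc_conv_app_nth)

lemma psum_length: "length mu \<le> k \<Longrightarrow> psum mu k = sum_list mu" by (simp add: psum_def)

lemma psum_mono: "j \<le> k \<Longrightarrow> psum mu j \<le> psum mu k"
proof (induction k)
  case (Suc k)
  have "psum mu k \<le> psum mu (Suc k)"
    by (cases "k < length mu") (simp_all add: psum_Suc psum_length)
  then show ?case using Suc by (cases "j = Suc k") auto
qed simp

lemma psum_le: "psum mu k \<le> sum_list mu"
  using psum_mono[of k "k + length mu" mu] psum_length[of mu "k + length mu"] by simp

lemma psum_eq_sum: "psum mu k = (\<Sum>i<min k (length mu). mu ! i)"
  by (simp add: psum_def sum_list_sum_nth atLeast0LessThan min.commute)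

lemma links_subset: "links mu \<subseteq> {1..<sum_list mu}" by (auto simp: links_def)

lemma block_subset: "block mu k \<subseteq> {1..sum_list mu}"
  using psum_le by (force simp: block_def intro: order_trans)

lemma block_ex:
  assumes "p \<in> {1..sum_list mu}"
  obtains k where "k < length mu" "p \<in> block mu k"
proof -
  define m where "m = (LEAST m. p \<le> psum mu m)"
  have ex: "p \<le> psum mu (length mu)" using assms by (simp add: psum_length)
  have m: "p \<le> psum mu m" unfolding m_def by (rule LeastI, rule ex)
  have mle: "m \<le> length mu" unfolding m_def by (rule Least_le, rule ex)
  have "m \<noteq> 0" using m assms by (cases m) auto
  then obtain k where k: "m = Suc k" by (cases m) auto
  have "\<not> p \<le> psum mu k"
    using not_less_Least[of k "\<lambda>m. p \<le> psum mu m"] k by (simp add: m_def)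
  then show ?thesis using that[of k] m mle k by (simp add: block_def)
qed

lemma block_card: "k < length mu \<Longrightarrow> card (block mu k) = mu ! k"
  by (simp add: block_def psum_Suc)

lemma block_less:
  assumes "p \<in> block mu k" "p' \<in> block mu k'" "k < k'"
  shows "p < p'"
proof -
  have "p \<le> psum mu (Suc k)" "psum mu k' < p'" using assms by (auto simp: block_def)
  then show ?thesis using psum_mono[of "Suc k" k' mu] assms(3) by simp
qed

lemma block_unique: "p \<in> block mu k \<Longrightarrow> p \<in> block mu k' \<Longrightarrow> k = k'"
  using block_less[of p mu k p k'] block_less[of p mu k' p k] by (metis less_irrefl linorder_neqE_nat)

lemma same_block_outside:
  assumes "same_block I p p'" "I \<subseteq> {1..<n}" "p \<noteq> p'"
  shows "p \<in> {1..n}" "p' \<in> {1..n}"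
proof -
  have *: "p \<in> {1..n} \<and> p' \<in> {1..n}" if "same_block I p p'" "p < p'" for p p'
    using same_blockD[OF that(1), of p] same_blockD[OF that(1), of "p' - 1"] that(2) assms(2) by force
  show "p \<in> {1..n}" "p' \<in> {1..n}"
    using *[of p p'] *[of p' p] assms(1,3) same_block_sym by (metis linorder_neqE_nat)+
qed

lemma same_block_links:
  assumes "p \<in> block mu k" "p' \<in> block mu k'"
  shows "same_block (links mu) p p' \<longleftrightarrow> k = k'"
proof
  assume eq: "k = k'"
  show "same_block (links mu) p p'"
  proof (rule same_blockI)
    fix x assume "p \<le> x \<and> x < p' \<or> p' \<le> x \<and> x < p"
    then have x: "psum mu k < x" "x < psum mu (Suc k)"
      using assms by (auto simp: eq block_def)
    have "x \<noteq> psum mu j" for j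
      using psum_mono[of j k mu] psum_mono[of "Suc k" j mu] x by (cases "j \<le> k") auto
    moreover have "x < sum_list mu" using x(2) psum_le[of mu "Suc k"] by simp
    ultimately show "x \<in> links mu" using x(1) by (auto simp: links_def)
  qed
next
  assume blk: "same_block (links mu) p p'"
  have *: False if "p \<in> block mu k" "p' \<in> block mu k'" "k < k'" "same_block (links mu) p p'" for p p' k k'
  proof -
    have "p \<le> psum mu (Suc k)" "psum mu (Suc k) < p'"
      using that psum_mono[of "Suc k" k' mu] by (auto simp: block_def)
    then have "psum mu (Suc k) \<in> links mu" using same_blockD[OF that(4)] by simp
    then show False by (simp add: links_def)
  qed
  show "k = k'"
    using *[of p k p' k'] *[of p' k' p k] assms blk same_block_sym by (metis linorder_neqE_nat)
qed

lemma young_subgroup_eq: "young_subgroup mu = parabolic (sum_list mu) (links mu)"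
proof (intro set_eqI iffI)
  fix w assume w: "w \<in> young_subgroup mu"
  then have wS: "w \<in> sym_group (sum_list mu)" by (simp add: young_subgroup_def)
  have "same_block (links mu) p (w p)" for p
  proof (cases "p \<in> {1..sum_list mu}")
    case True
    then obtain k where k: "k < length mu" "p \<in> block mu k" by (rule block_ex)
    have "w ` block mu k = block mu k" using w k(1) by (simp add: young_subgroup_def block_def psum_def)
    then have "w p \<in> block mu k" using k(2) by blast
    then show ?thesis using same_block_links[OF k(2)] by blast
  qed (simp add: sym_group_fix[OF wS])
  then show "w \<in> parabolic (sum_list mu) (links mu)" using wS by (simp add: parabolic_def)
next
  fix w assume w: "w \<in> parabolic (sum_list mu) (links mu)"
  then have wS: "w \<in> sym_group (sum_list mu)" by (rule parabolic_sym_group)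
  have "w ` block mu k = block mu k" for k
  proof (rule endo_inj_surj)
    show "w ` block mu k \<subseteq> block mu k"
    proof (rule image_subsetI)
      fix p assume p: "p \<in> block mu k"
      then have "w p \<in> {1..sum_list mu}" using sym_group_apply[OF wS, of p] block_subset[of mu k] by blast
      then obtain k' where k': "w p \<in> block mu k'" by (rule block_ex)
      have "same_block (links mu) p (w p)" using w by (simp add: parabolic_def)
      then show "w p \<in> block mu k" using same_block_links[OF p k'] k' by simp
    qed
    show "inj_on w (block mu k)"
      using bij_is_inj[OF sym_group_bij[OF wS]] by (rule inj_on_subset) simp
  qed (simp add: block_def)
  then show "w \<in> young_subgroup mu" using wS by (simp add: young_subgroup_def block_def psum_def)
qed

section \<open>Diagrams of partitions\<close>

definition diagram :: "nat list \<Rightarrow> box set" where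
  "diagram lam = {(i, j). i < length lam \<and> j < lam ! i}"

definition pos :: "nat list \<Rightarrow> box \<Rightarrow> nat" where "pos lam b = psum lam (fst b) + snd b + 1"

lemma pos_block: "(i, j) \<in> diagram lam \<Longrightarrow> pos lam (i, j) \<in> block lam i"
  by (auto simp: diagram_def pos_def block_def psum_Suc)

lemma pos_bij: "bij_betw (pos lam) (diagram lam) {1..sum_list lam}"
proof (rule bij_betw_imageI)
  show "inj_on (pos lam) (diagram lam)"
  proof (intro inj_onI, clarify)
    fix i j i' j' assume b: "(i, j) \<in> diagram lam" "(i', j') \<in> diagram lam" "pos lam (i, j) = pos lam (i', j')"
    have "i = i'" using block_unique pos_block[OF b(1)] pos_block[OF b(2)] b(3) by metis
    then show "i = i' \<and> j = j'" using b(3) by (simp add: pos_def)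
  qed
  show "pos lam ` diagram lam = {1..sum_list lam}"
  proof (intro set_eqI iffI)
    fix p assume "p \<in> pos lam ` diagram lam"
    then show "p \<in> {1..sum_list lam}" using pos_block block_subset by fast
  next
    fix p assume "p \<in> {1..sum_list lam}"
    then obtain k where k: "k < length lam" "p \<in> block lam k" by (rule block_ex)
    then have "p = pos lam (k, p - psum lam k - 1)" "(k, p - psum lam k - 1) \<in> diagram lam"
      by (auto simp: pos_def block_def diagram_def psum_Suc)
    then show "p \<in> pos lam ` diagram lam" by blast
  qed
qed

lemma finite_diagram: "finite (diagram lam)"
  using bij_betw_finite[OF pos_bij] by simp

lemma card_diagram: "card (diagram lam) = sum_list lam"
  using bij_betw_same_card[OF pos_bij, of lam] by simp

lemma posE:
  assumes "p \<in> {1..sum_list lam}"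
  obtains i j where "(i, j) \<in> diagram lam" "p = pos lam (i, j)"
  using assms pos_bij[of lam] unfolding bij_betw_def by (metis imageE surj_pair)

lemma links_pos:
  assumes "i \<in> links lam"
  obtains k j where "(k, j) \<in> diagram lam" "(k, Suc j) \<in> diagram lam" "i = pos lam (k, j)" "Suc i = pos lam (k, Suc j)"
proof -
  have "i \<in> {1..sum_list lam}" using assms by (auto simp: links_def)
  then obtain k j where kj: "(k, j) \<in> diagram lam" "i = pos lam (k, j)" by (rule posE)
  have "i \<noteq> psum lam (Suc k)" using assms by (auto simp: links_def)
  then have "Suc j < lam ! k" using kj by (auto simp: pos_def diagram_def psum_Suc)
  then show ?thesis using that[of k j] kj by (auto simp: diagram_def pos_def)
qed

lemma partition_antimono: "is_partition n lam \<Longrightarrow> i \<le> i' \<Longrightarrow> i' < length lam \<Longrightarrow> lam ! i' \<le> lam ! i"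
  using sorted_wrt_nth_less[of "(\<ge>)" lam i i'] by (cases "i = i'") (auto simp: is_partition_def)

lemma partition_sum: "is_partition n lam \<Longrightarrow> sum_list lam = n"
  by (simp add: is_partition_def is_composition_def)

lemma partition_pos: "is_partition n lam \<Longrightarrow> i < length lam \<Longrightarrow> 0 < lam ! i"
  by (simp add: is_partition_def is_composition_def)

lemma young_diagram_partition: "is_partition n lam \<Longrightarrow> young_diagram (diagram lam)"
  using partition_antimono by (fastforce simp: young_diagram_def diagram_def)

lemma down_closed_nat:
  assumes "finite S" "\<And>x y. x \<in> S \<Longrightarrow> y \<le> x \<Longrightarrow> y \<in> (S :: nat set)"
  shows "S = {..<card S}"
proof (cases "S = {}")
  case False
  have "S = {..Max S}" using assms Max_in[OF assms(1) False] by (auto intro: Max_ge)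
  then show ?thesis by (metis card_atMost lessThan_Suc_atMost)
qed simp

lemma partition_of_diagram:
  assumes "young_diagram D" "finite D"
  obtains lam where "is_partition (card D) lam" "diagram lam = D"
proof -
  note D = young_diagramD[OF assms(1)]
  define row where "row i = card {j. (i, j) \<in> D}" for i
  define m where "m = card {i. (i, 0) \<in> D}"
  have fin: "finite {j. (i, j) \<in> D}" "finite {i. (i, j) \<in> D}" for i j
    by (rule finite_subset[of _ "snd ` D"], force, simp add: assms(2))
       (rule finite_subset[of _ "fst ` D"], force, simp add: assms(2))
  have row: "{j. (i, j) \<in> D} = {..<row i}" for i
    unfolding row_def by (rule down_closed_nat) (use fin D in auto)
  have m: "{i. (i, 0) \<in> D} = {..<m}"
    unfolding m_def by (rule down_closed_nat) (use fin D in auto)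
  define lam where "lam = map row [0..<m]"
  have mem: "(i, j) \<in> D \<longleftrightarrow> j < row i" for i j using row[of i] by auto
  have memm: "(i, 0) \<in> D \<longleftrightarrow> i < m" for i using m by auto
  have dgm: "diagram lam = D"
  proof (intro set_eqI iffI; clarify)
    fix i j assume "(i, j) \<in> diagram lam"
    then show "(i, j) \<in> D" by (auto simp: diagram_def lam_def mem)
  next
    fix i j assume "(i, j) \<in> D"
    then have "i < m" "j < row i" using D[of i j i 0] memm[of i] mem[of i j] by auto
    then show "(i, j) \<in> diagram lam" by (simp add: diagram_def lam_def)
  qed
  have pos: "0 < row i" if "i < m" for i using that memm mem by auto
  have anti: "row i' \<le> row i" if "i \<le> i'" for i i'
    using D[of i' "row i' - 1" i "row i' - 1"] that mem by (cases "row i' = 0") auto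
  have "sum_list lam = card D" using card_diagram[of lam] dgm by simp
  then have "is_partition (card D) lam"
    using pos anti by (auto simp: is_partition_def is_composition_def lam_def sorted_wrt_iff_nth_less)
  then show ?thesis using that dgm by blast
qed

section \<open>Conjugate partitions\<close>

context
  fixes n lam assumes lam: "is_partition n lam"
begin

lemma conjugate_length: "length (conjugate_partition lam) = (if lam = [] then 0 else lam ! 0)"
  by (cases lam) (auto simp: conjugate_partition_def)

lemma conjugate_nth:
  assumes "j < length (conjugate_partition lam)"
  shows "conjugate_partition lam ! j = card {i. (i, j) \<in> diagram lam}"
proof -
  have "conjugate_partition lam ! j = length (filter (\<lambda>r. j < r) lam)"
    using assms by (cases lam) (auto simp: conjugate_partition_def)
  then show ?thesis by (simp add: length_filter_conv_card diagram_def)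
qed

lemma diagram_conjugate: "diagram (conjugate_partition lam) = prod.swap ` diagram lam"
proof -
  note D = young_diagramD[OF young_diagram_partition[OF lam]]
  have fin: "finite {i. (i, j) \<in> diagram lam}" for j
    by (rule finite_subset[of _ "{..<length lam}"]) (auto simp: diagram_def)
  have col: "{i. (i, j) \<in> diagram lam} = {..<card {i. (i, j) \<in> diagram lam}}" for j
    by (rule down_closed_nat) (use fin D in auto)
  have len: "j < length (conjugate_partition lam) \<longleftrightarrow> (0, j) \<in> diagram lam" for j
    unfolding conjugate_length by (auto simp: diagram_def)
  have "(j, i) \<in> diagram (conjugate_partition lam) \<longleftrightarrow> (i, j) \<in> diagram lam" for i j
  proof -
    have "(j, i) \<in> diagram (conjugate_partition lam) \<longleftrightarrow>
        (0, j) \<in> diagram lam \<and> i < card {i. (i, j) \<in> diagram lam}"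
      using len[of j] conjugate_nth[of j] by (auto simp: diagram_def[of "conjugate_partition lam"])
    also have "i < card {i. (i, j) \<in> diagram lam} \<longleftrightarrow> (i, j) \<in> diagram lam" using col[of j] by blast
    also have "(0, j) \<in> diagram lam \<and> (i, j) \<in> diagram lam \<longleftrightarrow> (i, j) \<in> diagram lam" using D[of i j 0 j] by auto
    finally show ?thesis .
  qed
  then show ?thesis by auto
qed

lemma conjugate_partition: "is_partition n (conjugate_partition lam)"
proof -
  let ?c = "conjugate_partition lam"
  note D = young_diagramD[OF young_diagram_partition[OF lam]]
  have fin: "finite {i. (i, j) \<in> diagram lam}" for j
    by (rule finite_subset[of _ "{..<length lam}"]) (auto simp: diagram_def)
  have "sum_list ?c = card (diagram lam)"
    using card_diagram[of ?c] by (simp add: diagram_conjugate card_image)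
  then have "sum_list ?c = n" using card_diagram[of lam] partition_sum[OF lam] by simp
  moreover have "0 < ?c ! j" if j: "j < length ?c" for j
  proof -
    have "lam \<noteq> [] \<and> j < lam ! 0" using j unfolding conjugate_length by (simp split: if_splits)
    then have "(0, j) \<in> diagram lam" by (simp add: diagram_def)
    then show ?thesis using conjugate_nth[OF j] fin[of j] by (auto simp: card_gt_0_iff)
  qed
  moreover have "?c ! j' \<le> ?c ! j" if "j < j'" "j' < length ?c" for j j'
  proof -
    have "{i. (i, j') \<in> diagram lam} \<subseteq> {i. (i, j) \<in> diagram lam}" using D that by auto
    then show ?thesis using conjugate_nth that card_mono[OF fin] by simp
  qed
  ultimately show ?thesis
    by (auto simp: is_partition_def is_composition_def in_set_conv_nth sorted_wrt_iff_nth_less)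
qed

text \<open>Both sides count the boxes in the first \<open>k\<close> rows of the diagram, the left
  one column by column.\<close>

lemma sum_min_conjugate:
  "(\<Sum>l<length (conjugate_partition lam). min k (conjugate_partition lam ! l)) = psum lam k"
proof -
  let ?c = "conjugate_partition lam"
  have "(\<Sum>l<length ?c. min k (?c ! l)) = card (SIGMA l:{..<length ?c}. {..<min k (?c ! l)})"
    by simp
  also have "\<dots> = card (SIGMA i:{..<min k (length lam)}. {..<lam ! i})"
  proof (rule bij_betw_same_card[of prod.swap], rule bij_betw_byWitness[of _ prod.swap])
    have d: "i < length lam \<and> j < lam ! i \<longleftrightarrow> j < length ?c \<and> i < ?c ! j" for i j
      using diagram_conjugate by (auto simp: diagram_def set_eq_iff image_iff)
    show "prod.swap ` (SIGMA l:{..<length ?c}. {..<min k (?c ! l)}) \<subseteq> (SIGMA i:{..<min k (length lam)}. {..<lam ! i})"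
      using d by fastforce
    show "prod.swap ` (SIGMA i:{..<min k (length lam)}. {..<lam ! i}) \<subseteq> (SIGMA l:{..<length ?c}. {..<min k (?c ! l)})"
      using d by fastforce
  qed auto
  also have "\<dots> = psum lam k" by (simp add: psum_eq_sum)
  finally show ?thesis .
qed

lemma row_to_column_props:
  "row_to_column lam \<in> sym_group n"
  "(i, j) \<in> diagram lam \<Longrightarrow> row_to_column lam (pos lam (i, j)) = pos (conjugate_partition lam) (j, i)"
  and row_to_column_unique:
  "w \<in> sym_group n \<Longrightarrow> (\<And>i j. (i, j) \<in> diagram lam \<Longrightarrow> w (pos lam (i, j)) = pos (conjugate_partition lam) (j, i)) \<Longrightarrow>
    w = row_to_column lam"
proof -
  let ?c = "conjugate_partition lam"
  let ?P = "\<lambda>w. w \<in> sym_group n \<and> (\<forall>i j. (i, j) \<in> diagram lam \<longrightarrow> w (pos lam (i, j)) = pos ?c (j, i))"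
  have n: "sum_list lam = n" "sum_list ?c = n" using partition_sum lam conjugate_partition by auto
  define f where "f = pos ?c \<circ> prod.swap \<circ> inv_into (diagram lam) (pos lam)"
  have "bij_betw prod.swap (diagram lam) (diagram ?c)"
    unfolding diagram_conjugate by (rule inj_on_imp_bij_betw) (auto simp: inj_on_def)
  then have f: "bij_betw f {1..n} {1..n}"
    unfolding f_def using pos_bij[of lam] pos_bij[of ?c] n
    by (metis bij_betw_inv_into bij_betw_trans comp_assoc)
  define w where "w p = (if p \<in> {1..n} then f p else p)" for p
  have "bij_betw w {1..n} {1..n}"
    using f bij_betw_cong[of "{1..n}" w f "{1..n}"] by (simp add: w_def)
  then have "w permutes {1..n}"
    by (rule bij_imp_permutes) (auto simp: w_def)
  then have w: "w \<in> sym_group n" by (simp add: sym_group_def)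
  have wf: "w (pos lam (i, j)) = pos ?c (j, i)" if "(i, j) \<in> diagram lam" for i j
    using that bij_betw_apply[OF pos_bij that] bij_betw_inv_into_left[OF pos_bij that] n
    by (simp add: w_def f_def)
  have uniq: "v = v'" if "?P v" "?P v'" for v v'
  proof
    fix p show "v p = v' p"
    proof (cases "p \<in> {1..n}")
      case True
      then obtain i j where "(i, j) \<in> diagram lam" "p = pos lam (i, j)" using posE[of p lam] n by auto
      then show ?thesis using that by simp
    qed (use that sym_group_fix in metis)
  qed
  have "?P w" using w wf by blast
  then have "?P (THE w. ?P w)" using uniq by (intro theI[of ?P w]) auto
  moreover have "row_to_column lam = (THE w. ?P w)"
    unfolding row_to_column_def n by (rule arg_cong[of _ _ The]) (auto simp: fun_eq_iff diagram_def pos_def psum_def)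
  ultimately have P: "?P (row_to_column lam)" by simp
  then show "row_to_column lam \<in> sym_group n" by blast
  show "row_to_column lam (pos lam (i, j)) = pos ?c (j, i)" if "(i, j) \<in> diagram lam" for i j
    using P that by blast
  show "w = row_to_column lam" if "w \<in> sym_group n"
    "\<And>i j. (i, j) \<in> diagram lam \<Longrightarrow> w (pos lam (i, j)) = pos ?c (j, i)" for w
    using that P by (intro uniq) auto
qed

end

section \<open>Dominance\<close>

text \<open>Pigeonhole: a block of \<open>nu\<close> receives at most one point from each of the
  chosen blocks of \<open>mu\<close>, and at most as many points as it has.\<close>

lemma transversal_dominance:
  assumes d: "d \<in> sym_group n" and tr: "transversal (links nu) (links mu) d"
    and sums: "sum_list mu = n" "sum_list nu = n" and K: "K \<subseteq> {..<length mu}"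
  shows "(\<Sum>k\<in>K. mu ! k) \<le> (\<Sum>l<length nu. min (card K) (nu ! l))"
proof -
  let ?U = "\<Union>k\<in>K. block mu k"
  have finK: "finite K" using K finite_subset by blast
  have finb: "finite (block mu k)" for mu k by (simp add: block_def)
  have injd: "inj d" using bij_is_inj[OF sym_group_bij[OF d]] .
  have finU: "finite ?U" using finK finb by blast
  have "(\<Sum>k\<in>K. mu ! k) = (\<Sum>k\<in>K. card (block mu k))"
    using K by (intro sum.cong) (auto simp: block_card)
  also have "\<dots> = card ?U"
    by (rule card_UN_disjoint[symmetric]) (use finK finb block_unique in blast)+
  also have "?U = (\<Union>l<length nu. {p \<in> ?U. d p \<in> block nu l})"
  proof -
    have "\<exists>l<length nu. d p \<in> block nu l" if "p \<in> ?U" for p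
    proof -
      have "p \<in> {1..n}" using that block_subset sums(1) by blast
      then have "d p \<in> {1..sum_list nu}" using sym_group_apply[OF d] sums(2) by simp
      then show ?thesis by (rule block_ex) blast
    qed
    then show ?thesis by auto
  qed
  also have "card \<dots> \<le> (\<Sum>l<length nu. card {p \<in> ?U. d p \<in> block nu l})"
    by (rule card_UN_le) simp
  also have "\<dots> \<le> (\<Sum>l<length nu. min (card K) (nu ! l))"
  proof (rule sum_mono)
    fix l assume l: "l \<in> {..<length nu}"
    let ?A = "{p \<in> ?U. d p \<in> block nu l}"
    have "card ?A = card (d ` ?A)" by (rule card_image[symmetric]) (rule inj_on_subset[OF injd], simp)
    also have "\<dots> \<le> card (block nu l)" by (rule card_mono) (use finb in auto)
    finally have 1: "card ?A \<le> nu ! l" using l by (simp add: block_card)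
    define f where "f p = (SOME k. k \<in> K \<and> p \<in> block mu k)" for p
    have f: "f p \<in> K \<and> p \<in> block mu (f p)" if "p \<in> ?U" for p
      unfolding f_def by (rule someI_ex) (use that in blast)
    have "card ?A \<le> card K"
    proof (rule card_inj_on_le[of f])
      show "inj_on f ?A"
      proof (rule inj_onI)
        fix p p' assume p: "p \<in> ?A" "p' \<in> ?A" and eq: "f p = f p'"
        then have "same_block (links mu) p p'"
          using f[of p] f[of p'] same_block_links[of p mu "f p" p' "f p'"] by auto
        moreover have "same_block (links nu) (d p) (d p')"
          using p same_block_links[of "d p" nu l "d p'" l] by auto
        ultimately show "p = p'" using tr unfolding transversal_def by blast
      qed
    qed (use f finK in auto)
    with 1 show "card ?A \<le> min (card K) (nu ! l)" by simp
  qed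
  finally show ?thesis .
qed

lemma transversal_inv:
  assumes "transversal I J d" "bij d" shows "transversal J I (inv d)"
  unfolding transversal_def
proof (intro allI impI)
  fix p p' assume "same_block I p p'" "same_block J (inv d p) (inv d p')"
  then have "inv d p = inv d p'"
    using assms(1) by (simp add: transversal_def inv_apply_self(2)[OF assms(2)])
  then show "p = p'" using inv_apply_self(2)[OF assms(2)] by metis
qed

text \<open>\<open>K\<close> holds the positions of the \<open>k\<close> largest parts; it is
  smaller than \<open>k\<close> if \<open>mu\<close> has fewer parts.\<close>

lemma ordered_parts_sum:
  obtains K where "K \<subseteq> {..<length mu}" "card K \<le> k" "(\<Sum>i\<in>K. mu ! i) = psum (ordered_parts mu) k"
proof -
  have "mset (ordered_parts mu) = mset mu" by (simp add: ordered_parts_def)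
  then obtain p where p: "p permutes {..<length mu}" "permute_list p mu = ordered_parts mu"
    by (rule mset_eq_permutation)
  let ?m = "min k (length mu)"
  have len: "length (ordered_parts mu) = length mu" by (simp add: ordered_parts_def)
  have "psum (ordered_parts mu) k = (\<Sum>i<?m. mu ! p i)"
    unfolding psum_eq_sum len p(2)[symmetric] by (rule sum.cong) (auto simp: permute_list_nth[OF p(1)])
  also have "\<dots> = (\<Sum>i\<in>p ` {..<?m}. mu ! i)"
    using permutes_inj_on[OF p(1)] by (simp add: sum.reindex)
  finally have "(\<Sum>i\<in>p ` {..<?m}. mu ! i) = psum (ordered_parts mu) k" by simp
  moreover have "p ` {..<?m} \<subseteq> p ` {..<length mu}" by (rule image_mono) auto
  then have "p ` {..<?m} \<subseteq> {..<length mu}" by (simp only: permutes_image[OF p(1)])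
  moreover have "card (p ` {..<?m}) \<le> k" using card_image_le[of "{..<?m}" p] by simp
  ultimately show ?thesis using that by blast
qed

lemma dominates_psum: "dominates lam mu \<longleftrightarrow> (\<forall>k. psum mu k \<le> psum lam k)"
  by (simp add: dominates_def psum_def)

lemma transversal_dominates:
  assumes lam: "is_partition n lam" and d: "d \<in> sym_group n" and mu: "sum_list mu = n"
    and tr: "transversal (links (conjugate_partition lam)) (links mu) d"
  shows "dominates lam (ordered_parts mu)"
  unfolding dominates_psum
proof
  fix k
  obtain K where K: "K \<subseteq> {..<length mu}" "card K \<le> k" "(\<Sum>i\<in>K. mu ! i) = psum (ordered_parts mu) k"
    by (rule ordered_parts_sum)
  have "psum (ordered_parts mu) k \<le> psum lam (card K)"
    using transversal_dominance[OF d tr mu partition_sum[OF conjugate_partition[OF lam]] K(1)]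
    by (simp add: K(3) sum_min_conjugate[OF lam])
  also have "\<dots> \<le> psum lam k" by (rule psum_mono[OF K(2)])
  finally show "psum (ordered_parts mu) k \<le> psum lam k" .
qed

lemma ordered_parts_partition: "is_partition n lam \<Longrightarrow> ordered_parts lam = lam"
proof -
  assume "is_partition n lam"
  then have "sorted (rev lam)" by (simp add: is_partition_def sorted_wrt_rev)
  then have "sort lam = rev lam" by (metis mset_rev properties_for_sort)
  then show ?thesis by (simp add: ordered_parts_def)
qed

lemma dominates_antisym:
  assumes lam: "is_partition n lam" and nu: "is_partition n nu"
    and "dominates lam nu" "dominates nu lam"
  shows "lam = nu"
proof -
  have eq: "psum lam k = psum nu k" for k using assms(3,4) by (simp add: dominates_psum order_antisym)
  have len: "length lam \<le> length nu" if "is_partition n lam" "is_partition n nu" "\<And>k. psum lam k = psum nu k" for lam nu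
  proof (rule ccontr)
    assume "\<not> length lam \<le> length nu"
    then have "psum lam (length nu) < psum lam (Suc (length nu))"
      using partition_pos[OF that(1)] by (simp add: psum_Suc)
    then show False using that(3) by (simp add: psum_length)
  qed
  have l: "length lam = length nu" using len[OF lam nu eq] len[OF nu lam eq[symmetric]] by simp
  show ?thesis
  proof (rule nth_equalityI[OF l])
    fix i assume "i < length lam"
    then show "lam ! i = nu ! i" using eq[of "Suc i"] eq[of i] l by (simp add: psum_Suc)
  qed
qed

section \<open>The distinguished double coset representative\<close>

lemma diagram_conjugate_iff:
  "is_partition n lam \<Longrightarrow> (j, i) \<in> diagram (conjugate_partition lam) \<longleftrightarrow> (i, j) \<in> diagram lam"
  using diagram_conjugate[of n lam] by simp

lemma row_to_column_reduced:
  assumes lam: "is_partition n lam"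
  shows "reduced n (links (conjugate_partition lam)) (links lam) (row_to_column lam)"
    and "transversal (links (conjugate_partition lam)) (links lam) (row_to_column lam)"
proof -
  let ?c = "conjugate_partition lam" and ?w = "row_to_column lam"
  note W = row_to_column_props[OF lam]
  have b: "bij ?w" by (rule sym_group_bij[OF W(1)])
  have n: "sum_list lam = n" by (rule partition_sum[OF lam])
  have invw: "inv ?w (pos ?c (j, i)) = pos lam (i, j)" if "(i, j) \<in> diagram lam" for i j
    using W(2)[OF that] inv_apply_self(1)[OF b] by metis
  have "inv ?w i < inv ?w (Suc i)" if i: "i \<in> links ?c" for i
  proof -
    obtain k j where kj: "(k, j) \<in> diagram ?c" "(k, Suc j) \<in> diagram ?c" "i = pos ?c (k, j)" "Suc i = pos ?c (k, Suc j)"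
      using links_pos[OF i] .
    then have d: "(j, k) \<in> diagram lam" "(Suc j, k) \<in> diagram lam" using diagram_conjugate_iff[OF lam] by auto
    have "pos lam (j, k) < pos lam (Suc j, k)"
      using block_less[OF pos_block[OF d(1)] pos_block[OF d(2)]] by simp
    then show ?thesis unfolding kj(3,4) using invw[OF d(1)] invw[OF d(2)] kj(3,4) by simp
  qed
  moreover have "?w i < ?w (Suc i)" if i: "i \<in> links lam" for i
  proof -
    obtain k j where kj: "(k, j) \<in> diagram lam" "(k, Suc j) \<in> diagram lam" "i = pos lam (k, j)" "Suc i = pos lam (k, Suc j)"
      using links_pos[OF i] .
    have "pos ?c (j, k) < pos ?c (Suc j, k)"
      using block_less[OF pos_block pos_block, of j k ?c "Suc j" k] kj diagram_conjugate_iff[OF lam] by simp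
    then show ?thesis using W(2)[OF kj(1)] W(2)[OF kj(2)] kj(3,4) by simp
  qed
  ultimately show "reduced n (links ?c) (links lam) ?w" using W(1) by (simp add: reduced_def)
  \<comment> \<open>Blocks of \<open>lam\<close> are rows and blocks of \<open>?c\<close> are
    columns, and a box is determined by its row and its column.\<close>
  show "transversal (links ?c) (links lam) ?w"
    unfolding transversal_def
  proof (intro allI impI, rule ccontr)
    fix p p' assume blk: "same_block (links lam) p p'" "same_block (links ?c) (?w p) (?w p')" and ne: "p \<noteq> p'"
    have "p \<in> {1..sum_list lam}" "p' \<in> {1..sum_list lam}"
      using same_block_outside[OF blk(1) links_subset ne] by auto
    then obtain i j i' j' where ij: "(i, j) \<in> diagram lam" "p = pos lam (i, j)" "(i', j') \<in> diagram lam" "p' = pos lam (i', j')"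
      by (metis posE)
    have "i = i'" using blk(1) same_block_links[OF pos_block[OF ij(1)] pos_block[OF ij(3)]] ij by simp
    moreover have "j = j'"
      using blk(2) same_block_links[OF pos_block pos_block, of j i ?c j' i'] ij
        diagram_conjugate_iff[OF lam] W(2)[OF ij(1)] W(2)[OF ij(3)] by simp
    ultimately show False using ne ij by simp
  qed
qed

lemma sum_le_bij_eq:
  fixes f :: "'a \<Rightarrow> nat"
  assumes "finite A" "bij_betw e A B" "\<And>b. b \<in> A \<Longrightarrow> f b \<le> g (e b)" "sum f A = sum g B" "b \<in> A"
  shows "f b = g (e b)"
proof (rule sum_mono_inv[of f A "\<lambda>b. g (e b)"])
  show "sum f A = (\<Sum>b\<in>A. g (e b))" using assms(4) sum.reindex_bij_betw[OF assms(2), of g] by simp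
qed (use assms in auto)

lemma reduced_transversal_unique:
  assumes lam: "is_partition n lam"
    and d: "reduced n (links (conjugate_partition lam)) (links lam) d"
    and tr: "transversal (links (conjugate_partition lam)) (links lam) d"
  shows "d = row_to_column lam"
proof (rule row_to_column_unique[OF lam])
  let ?c = "conjugate_partition lam"
  show dS: "d \<in> sym_group n" using d by (simp add: reduced_def)
  have bd: "bij d" by (rule sym_group_bij[OF dS])
  have inc: "i \<in> links ?c \<Longrightarrow> inv d i < inv d (Suc i)" "i \<in> links lam \<Longrightarrow> d i < d (Suc i)" for i
    using d by (auto simp: reduced_def)
  have n: "sum_list lam = n" "sum_list ?c = n" using partition_sum lam conjugate_partition by auto
  note D = young_diagramD[OF young_diagram_partition[OF lam]]
  \<comment> \<open>\<open>e\<close> is \<open>d\<close> read on boxes. Its coordinates are at least those of the transposed box, and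
    their totals agree, so \<open>e\<close> is the transposition.\<close>
  define e where "e b = inv_into (diagram ?c) (pos ?c) (d (pos lam b))" for b
  have bij_d: "bij_betw d {1..n} {1..n}" using dS by (simp add: sym_group_def permutes_imp_bij)
  have e: "bij_betw e (diagram lam) (diagram ?c)"
  proof -
    have "bij_betw (inv_into (diagram ?c) (pos ?c) \<circ> d \<circ> pos lam) (diagram lam) (diagram ?c)"
      using bij_d bij_betw_inv_into[OF pos_bij[of ?c]] pos_bij[of lam] unfolding n
      by (intro bij_betw_trans)
    then show ?thesis unfolding e_def[abs_def] by (simp add: comp_def)
  qed
  have mem: "e b \<in> diagram ?c" if "b \<in> diagram lam" for b using bij_betw_apply[OF e that] .
  have pos_e: "pos ?c (e b) = d (pos lam b)" if "b \<in> diagram lam" for b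
  proof -
    have "d (pos lam b) \<in> {1..sum_list ?c}"
      using bij_betw_apply[OF bij_d] bij_betw_apply[OF pos_bij that] n by simp
    then show ?thesis unfolding e_def by (rule bij_betw_inv_into_right[OF pos_bij])
  qed
  have blk: "d (pos lam b) \<in> block ?c (fst (e b))" if "b \<in> diagram lam" for b
    using pos_block[of "fst (e b)" "snd (e b)" ?c] mem[OF that] pos_e[OF that] by simp
  have swap: "bij_betw prod.swap (diagram lam) (diagram ?c)"
    unfolding diagram_conjugate[OF lam] by (rule inj_on_imp_bij_betw) (auto simp: inj_on_def)
  \<comment> \<open>Along a row of \<open>lam\<close> the column blocks reached by \<open>d\<close>
    increase weakly because \<open>d\<close> does, and strictly by transversality; so the box with
    index \<open>j\<close> lands in column \<open>j\<close> or later.\<close>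
  have le1: "snd b \<le> fst (e b)" if "b \<in> diagram lam" for b
  proof -
    have "(i, j) \<in> diagram lam \<Longrightarrow> j \<le> fst (e (i, j))" for i j
    proof (induction j)
      case (Suc j)
      have b: "(i, j) \<in> diagram lam" using D[OF Suc.prems] by simp
      let ?p = "pos lam (i, j)" and ?p' = "pos lam (i, Suc j)"
      have pp: "?p' = Suc ?p" by (simp add: pos_def)
      have same: "same_block (links lam) ?p ?p'"
        using same_block_links[OF pos_block[OF b] pos_block[OF Suc.prems]] by simp
      then have "?p \<in> links lam" using same_blockD[OF same, of ?p] pp by simp
      then have dp: "d ?p < d ?p'" using inc(2)[of ?p] pp by simp
      have "fst (e (i, j)) \<noteq> fst (e (i, Suc j))"
      proof
        assume "fst (e (i, j)) = fst (e (i, Suc j))"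
        then have "same_block (links ?c) (d ?p) (d ?p')"
          using same_block_links[OF blk[OF b] blk[OF Suc.prems]] by simp
        then have "?p = ?p'" using tr same unfolding transversal_def by blast
        then show False using pp by simp
      qed
      moreover have "\<not> fst (e (i, Suc j)) < fst (e (i, j))"
        using block_less[OF blk[OF Suc.prems] blk[OF b]] dp by auto
      ultimately show ?case using Suc.IH[OF b] by simp
    qed simp
    then show ?thesis using that by (cases b) auto
  qed
  have fst_e: "fst (e b) = snd b" if "b \<in> diagram lam" for b
    using sum_le_bij_eq[where f = snd and g = fst, OF finite_diagram e le1 _ that]
      sum.reindex_bij_betw[OF swap, of fst] by simp
  have le2: "fst b \<le> snd (e b)" if "b \<in> diagram lam" for b
  proof -
    have "(i, j) \<in> diagram lam \<Longrightarrow> i \<le> snd (e (i, j))" for i j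
    proof (induction i)
      case (Suc i)
      have b: "(i, j) \<in> diagram lam" using D[OF Suc.prems] by simp
      let ?p = "pos lam (i, j)" and ?p' = "pos lam (Suc i, j)"
      have pp: "?p < ?p'" using block_less[OF pos_block[OF b] pos_block[OF Suc.prems]] by simp
      have same: "same_block (links ?c) (d ?p') (d ?p)"
        using same_block_links[OF blk[OF Suc.prems] blk[OF b]] fst_e[OF b] fst_e[OF Suc.prems] by simp
      \<comment> \<open>Both images are now known to lie in one column block, where
        \<open>inv d\<close> is increasing.\<close>
      have "\<not> d ?p' < d ?p"
        using increasing_on_block[of "links ?c" "inv d" "d ?p'" "d ?p"] inc(1) same pp
        by (auto simp: inv_apply_self(1)[OF bd])
      moreover have "d ?p \<noteq> d ?p'" using pp bij_is_inj[OF bd] by (simp add: inj_eq)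
      ultimately have "pos ?c (e (i, j)) < pos ?c (e (Suc i, j))"
        using pos_e[OF b] pos_e[OF Suc.prems] by simp
      then have "snd (e (i, j)) < snd (e (Suc i, j))"
        using fst_e[OF b] fst_e[OF Suc.prems] by (simp add: pos_def)
      then show ?case using Suc.IH[OF b] by simp
    qed simp
    then show ?thesis using that by (cases b) auto
  qed
  have snd_e: "snd (e b) = fst b" if "b \<in> diagram lam" for b
    using sum_le_bij_eq[where f = fst and g = snd, OF finite_diagram e le2 _ that]
      sum.reindex_bij_betw[OF swap, of snd] by simp
  show "d (pos lam (i, j)) = pos ?c (j, i)" if "(i, j) \<in> diagram lam" for i j
    using pos_e[OF that] fst_e[OF that] snd_e[OF that] by (metis fst_conv snd_conv prod.collapse)
qed

section \<open>Row reading\<close>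

definition row_reading :: "nat list \<Rightarrow> box list" where
  "row_reading lam = concat (map (\<lambda>i. map (Pair i) [0..<lam ! i]) [0..<length lam])"

lemma row_reading_snoc: "row_reading (lam @ [a]) = row_reading lam @ map (Pair (length lam)) [0..<a]"
proof -
  have "concat (map (\<lambda>i. map (Pair i) [0..<(lam @ [a]) ! i]) [0..<length lam]) = row_reading lam"
    unfolding row_reading_def by (rule arg_cong[of _ _ concat], rule map_cong) (auto simp: nth_append)
  then show ?thesis by (simp add: row_reading_def[of "lam @ [a]"])
qed

lemma set_row_reading: "set (row_reading lam) = diagram lam"
  by (auto simp: row_reading_def diagram_def)

lemma length_row_reading: "length (row_reading lam) = sum_list lam"
proof (induction lam rule: rev_induct)
  case (snoc a lam)
  then show ?case by (simp add: row_reading_snoc)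
qed (simp add: row_reading_def)

lemma row_reading_nth: "(i, j) \<in> diagram lam \<Longrightarrow> row_reading lam ! (psum lam i + j) = (i, j)"
proof (induction lam rule: rev_induct)
  case (snoc a lam)
  show ?case
  proof (cases "i < length lam")
    case True
    then have b: "(i, j) \<in> diagram lam" using snoc.prems by (auto simp: diagram_def nth_append)
    have "pos lam (i, j) \<le> sum_list lam" using bij_betw_apply[OF pos_bij b] by simp
    then show ?thesis using snoc.IH[OF b] True
      by (simp add: row_reading_snoc nth_append length_row_reading pos_def psum_def)
  next
    case False
    then have "i = length lam" "j < a" using snoc.prems by (auto simp: diagram_def nth_append)
    then show ?thesis by (simp add: row_reading_snoc nth_append length_row_reading psum_def)
  qed
qed (simp add: diagram_def)

lemma std_row_reading: "is_partition n lam \<Longrightarrow> std (row_reading lam)"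
proof (induction lam arbitrary: n rule: rev_induct)
  case (snoc a lam)
  let ?l = "length lam"
  have lam: "is_partition (sum_list lam) lam"
    using snoc.prems by (auto simp: is_partition_def is_composition_def sorted_wrt_append)
  have "std (row_reading lam @ map (Pair ?l) [0..<k])" if "k \<le> a" for k
    using that
  proof (induction k)
    case 0
    then show ?case using snoc.IH[OF lam] by simp
  next
    case (Suc k)
    have "lam ! (?l - 1) \<ge> a" if "?l > 0"
      using partition_antimono[OF snoc.prems, of "?l - 1" ?l] that by (simp add: nth_append)
    then have "addable (set (row_reading lam @ map (Pair ?l) [0..<k])) (?l, k)"
      using Suc.prems by (auto simp: addable_iff set_row_reading diagram_def)
    then show ?case using Suc unfolding upt_Suc by (simp flip: append_assoc)
  qed
  then show ?case by (simp add: row_reading_snoc)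
qed (simp add: row_reading_def)

section \<open>Horizontal strips\<close>

definition row_length :: "nat list \<Rightarrow> nat \<Rightarrow> nat" where
  "row_length lam i = (if i < length lam then lam ! i else 0)"

lemma diagram_row_length: "(i, j) \<in> diagram lam \<longleftrightarrow> j < row_length lam i"
  by (auto simp: diagram_def row_length_def)

lemma psum_row_length: "psum lam k = (\<Sum>i<k. row_length lam i)"
proof (induction k)
  case (Suc k)
  then show ?case
    by (cases "k < length lam") (simp_all add: psum_Suc row_length_def psum_length)
qed simp

lemma row_length_antimono: "is_partition n lam \<Longrightarrow> i \<le> i' \<Longrightarrow> row_length lam i' \<le> row_length lam i"
  using partition_antimono[of n lam i i'] by (auto simp: row_length_def)

lemma partition_of_rows:
  assumes anti: "\<And>i i'. i \<le> i' \<Longrightarrow> L i' \<le> L i" and fin: "L K = 0"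
  obtains lam where "is_partition (\<Sum>i<K. L i) lam" "row_length lam = L"
proof -
  define D where "D = {(i, j). j < L i}"
  have yd: "young_diagram D" unfolding young_diagram_def D_def using anti by fastforce
  have D: "D = (SIGMA i:{..<K}. {..<L i})"
    using anti[of K] fin by (auto simp: D_def) (metis le_0_eq linorder_not_less not_less0)
  have "finite D" unfolding D by simp
  then obtain lam where lam: "is_partition (card D) lam" "diagram lam = D"
    using partition_of_diagram[OF yd] by blast
  have "card D = (\<Sum>i<K. L i)" unfolding D by simp
  moreover have "row_length lam = L"
  proof
    fix i
    have "j < row_length lam i \<longleftrightarrow> j < L i" for j
      using diagram_row_length[of i j lam] lam(2) by (auto simp: D_def)
    then show "row_length lam i = L i" by (meson linorder_neqE_nat less_irrefl)
  qed
  ultimately show ?thesis using that lam(1) by simp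
qed

lemma sorted_desc_unique:
  assumes "mset xs = mset ys" "sorted_wrt (\<ge>) xs" "sorted_wrt (\<ge>) (ys :: nat list)"
  shows "xs = ys"
proof -
  have "sorted (rev xs)" "sorted (rev ys)" using assms(2,3) by (simp_all add: sorted_wrt_rev)
  then have "rev xs = rev ys" using assms(1) by (metis mset_rev properties_for_sort)
  then show ?thesis by simp
qed

lemma sorted_ordered_parts: "sorted_wrt (\<ge>) (ordered_parts mu)"
proof -
  have "sorted (sort mu)" by simp
  then show ?thesis unfolding ordered_parts_def sorted_wrt_rev .
qed

lemma ordered_parts_remove:
  obtains j where "j < length (ordered_parts (mu @ [m]))" "ordered_parts (mu @ [m]) ! j = m"
    "\<And>k. k \<le> j \<Longrightarrow> psum (ordered_parts mu) k = psum (ordered_parts (mu @ [m])) k"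
    "\<And>k. k \<ge> j \<Longrightarrow> psum (ordered_parts mu) k + m = psum (ordered_parts (mu @ [m])) (Suc k)"
proof -
  let ?o = "ordered_parts (mu @ [m])"
  have "m \<in> set ?o" by (simp add: ordered_parts_def)
  then obtain j where j: "j < length ?o" "?o ! j = m" by (auto simp: in_set_conv_nth)
  let ?r = "take j ?o @ drop (Suc j) ?o"
  have split: "?o = take j ?o @ m # drop (Suc j) ?o" using id_take_nth_drop[OF j(1)] j(2) by simp
  have "mset ?o = mset (take j ?o @ m # drop (Suc j) ?o)" using split by simp
  then have "mset ?r + {#m#} = mset ?o" by simp
  also have "\<dots> = mset (ordered_parts mu) + {#m#}" by (simp add: ordered_parts_def)
  finally have "mset ?r = mset (ordered_parts mu)" by simp
  moreover have "sorted_wrt (\<ge>) ?r"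
    using sorted_ordered_parts[of "mu @ [m]"] by (subst (asm) split) (auto simp: sorted_wrt_append)
  ultimately have r: "ordered_parts mu = ?r"
    using sorted_desc_unique[OF _ _ sorted_ordered_parts] by metis
  have len: "length (take j ?o) = j" using j(1) by simp
  show ?thesis
  proof (rule that[OF j])
    fix k assume "k \<le> j"
    then show "psum (ordered_parts mu) k = psum ?o k" using len by (simp add: psum_def r min_def)
  next
    fix k assume k: "k \<ge> j"
    have "take (Suc k) ?o = take j ?o @ m # take (k - j) (drop (Suc j) ?o)"
      using k len by (subst split) (simp add: Suc_diff_le)
    moreover have "take k ?r = take j ?o @ take (k - j) (drop (Suc j) ?o)"
      using k len by simp
    ultimately show "psum (ordered_parts mu) k + m = psum ?o (Suc k)"
      by (simp add: psum_def r)
  qed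
qed

text \<open>
  The strip removed from \<open>lam\<close> merges the two consecutive rows whose lengths enclose \<open>m\<close> into one
  row that is shorter than their sum by \<open>m\<close>.
\<close>
lemma remove_strip:
  assumes lam: "is_partition (sum_list mu + m) lam" and m: "0 < m"
    and dom: "dominates lam (ordered_parts (mu @ [m]))"
  obtains lam' where "is_partition (sum_list mu) lam'" "dominates lam' (ordered_parts mu)"
    "diagram lam' \<subseteq> diagram lam"
    "\<And>i j. (i, j) \<in> diagram lam \<Longrightarrow> (i, j) \<notin> diagram lam' \<Longrightarrow> 0 < i \<Longrightarrow> (i - 1, j) \<in> diagram lam'"
proof -
  let ?o = "ordered_parts (mu @ [m])"
  define L where "L = row_length lam"
  note anti = row_length_antimono[OF lam, folded L_def]
  obtain j where j: "j < length ?o" "?o ! j = m"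
    "\<And>k. k \<le> j \<Longrightarrow> psum (ordered_parts mu) k = psum ?o k"
    "\<And>k. k \<ge> j \<Longrightarrow> psum (ordered_parts mu) k + m = psum ?o (Suc k)"
    using ordered_parts_remove[of mu m] by blast
  have o_anti: "?o ! k' \<le> ?o ! k" if "k \<le> k'" "k' < length ?o" for k k'
    using sorted_wrt_nth_less[OF sorted_ordered_parts[of "mu @ [m]"], of k k'] that by (cases "k = k'") auto
  have "psum ?o 1 \<le> psum lam 1" using dom by (simp add: dominates_psum)
  moreover have "psum ?o 1 = ?o ! 0" using psum_Suc[of 0 ?o] j(1) by (cases ?o) auto
  ultimately have L0: "m \<le> L 0" using o_anti[of 0 j] j(1,2) by (simp add: L_def psum_row_length)
  have Lfin: "L r = 0" if "length lam \<le> r" for r using that by (simp add: L_def row_length_def)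
  \<comment> \<open>The last row of length at least \<open>m\<close>; it exists because
    \<open>m\<close> is at most the largest part, and so at most the first row.\<close>
  define i where "i = Max {r. m \<le> L r}"
  have "r < length lam" if "m \<le> L r" for r
    using Lfin[of r] m that by (cases "r < length lam") auto
  then have fin: "finite {r. m \<le> L r}"
    by (intro finite_subset[of "{r. m \<le> L r}" "{..<length lam}"]) auto
  have i: "m \<le> L i" using Max_in[OF fin] L0 by (auto simp: i_def)
  have i': "L (Suc i) < m" using Max_ge[OF fin, of "Suc i"] by (force simp: i_def)
  define L' where "L' r = (if r < i then L r else if r = i then L i + L (Suc i) - m else L (Suc r))" for r
  have L'_le: "L' r \<le> L r" for r using i' anti[of r "Suc r"] by (auto simp: L'_def)
  \<comment> \<open>The new row lengths interlace the old ones, which says that the removed boxes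
    form a horizontal strip.\<close>
  have L'_ge: "L (Suc r) \<le> L' r" for r using i anti[of r "Suc r"] by (auto simp: L'_def)
  have anti': "L' r' \<le> L' r" if "r \<le> r'" for r r'
  proof (cases "r = r'")
    case False
    then have "L' r' \<le> L (Suc r)" using L'_le[of r'] anti[of "Suc r" r'] that by simp
    then show ?thesis using L'_ge[of r] by simp
  qed simp
  have sum_lo: "(\<Sum>r<k. L' r) = psum lam k" if "k \<le> i" for k
    unfolding psum_row_length L_def[symmetric] by (rule sum.cong) (use that in \<open>auto simp: L'_def\<close>)
  have sum_hi: "(\<Sum>r<k. L' r) + m = psum lam (Suc k)" if "i < k" for k
    using that
  proof (induction k)
    case (Suc k)
    show ?case
    proof (cases "k = i")
      case True
      then show ?thesis using sum_lo[of i] i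
        by (simp add: L'_def psum_row_length L_def[symmetric])
    next
      case False
      then show ?thesis using Suc by (simp add: L'_def psum_row_length L_def[symmetric])
    qed
  qed simp
  define K where "K = Suc (i + length lam)"
  have "L' K = 0" using Lfin by (simp add: K_def L'_def)
  then obtain lam' where lam': "is_partition (\<Sum>r<K. L' r) lam'" "row_length lam' = L'"
    using partition_of_rows[of L' K] anti' by blast
  have "(\<Sum>r<K. L' r) + m = sum_list mu + m"
    using sum_hi[of K] partition_sum[OF lam] psum_length[of lam "Suc K"] by (simp add: K_def)
  then have part: "is_partition (sum_list mu) lam'" using lam'(1) by simp
  have ps: "psum lam' k = (\<Sum>r<k. L' r)" for k by (simp add: psum_row_length lam'(2))
  have dom': "dominates lam' (ordered_parts mu)"
    unfolding dominates_psum
  proof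
    fix k
    have d: "psum ?o k \<le> psum lam k" for k using dom by (simp add: dominates_psum)
    have o_Suc: "psum ?o (Suc k) = psum ?o k + ?o ! k" if "k < length ?o" using that by (rule psum_Suc)
    have o_len: "psum ?o (Suc k) = psum ?o k" if "\<not> k < length ?o" using that by (simp add: psum_length)
    \<comment> \<open>The shape loses \<open>m\<close> boxes by row \<open>i\<close> and the next,
      the composition loses the part at index \<open>j\<close>. When \<open>k\<close> lies between
      \<open>i\<close> and \<open>j\<close>, the part at index \<open>k\<close> is compared with
      \<open>m\<close>: it is at most \<open>m\<close> after \<open>j\<close> and at least
      \<open>m\<close> before \<open>j\<close>.\<close>
    consider "k \<le> i" "k \<le> j" | "k \<le> i" "j < k" | "i < k" "j \<le> k" | "i < k" "k < j" by linarith
    then show "psum (ordered_parts mu) k \<le> psum lam' k"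
    proof cases
      case 1
      then show ?thesis using d[of k] j(3) sum_lo ps by simp
    next
      case 2
      have "psum ?o (Suc k) \<le> psum ?o k + m"
        using o_Suc o_len o_anti[of j k] 2 j(2) by (cases "k < length ?o") auto
      then show ?thesis using d[of k] j(4)[of k] sum_lo[of k] ps[of k] 2 by simp
    next
      case 3
      then show ?thesis using d[of "Suc k"] j(4)[of k] sum_hi[of k] ps[of k] by simp
    next
      case 4
      have "psum ?o k + m \<le> psum ?o (Suc k)" using o_Suc o_anti[of k j] 4 j(1,2) by simp
      then show ?thesis using d[of "Suc k"] j(3)[of k] sum_hi[of k] ps[of k] 4 by simp
    qed
  qed
  show ?thesis
  proof (rule that[OF part dom'])
    show "diagram lam' \<subseteq> diagram lam"
      using less_le_trans[OF _ L'_le] by (auto simp: diagram_row_length lam'(2) L_def[symmetric])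
    fix r c assume "(r, c) \<in> diagram lam" "(r, c) \<notin> diagram lam'" "0 < r"
    then show "(r - 1, c) \<in> diagram lam'"
      using L'_ge[of "r - 1"] by (simp add: diagram_row_length lam'(2) L_def[symmetric])
  qed
qed

text \<open>The strip is added in the order of increasing contents. When a box is reached, its left
  neighbour has a smaller content, and its upper neighbour lies in \<open>bs\<close> since the strip
  is horizontal.\<close>

lemma strip_list:
  assumes D: "young_diagram D" "finite D" and bs: "std bs" "set bs \<subseteq> D"
    and strip: "\<And>i j. (i, j) \<in> D \<Longrightarrow> (i, j) \<notin> set bs \<Longrightarrow> 0 < i \<Longrightarrow> (i - 1, j) \<in> set bs"
  obtains cs where "set cs = D - set bs" "std (bs @ cs)" "sorted_wrt (<) (map box_content cs)"
proof -
  let ?S = "D - set bs"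
  note yd = young_diagramD[OF std_young_diagram[OF bs(1)]]
  have inj: "inj_on box_content ?S"
  proof -
    \<comment> \<open>Of two strip boxes on one diagonal, the lower one has its upper neighbour in
      \<open>bs\<close>; the other box lies above and to the left of that neighbour, so it would be
      in \<open>bs\<close> too.\<close>
    have *: False if "(i, j) \<in> ?S" "(i', j') \<in> ?S" "int j - int i = int j' - int i'" "i < i'" for i j i' j'
    proof -
      have "(i' - 1, j') \<in> set bs" using strip[of i' j'] that by auto
      then have "(i, j) \<in> set bs" by (rule yd) (use that in auto)
      then show False using that(1) by simp
    qed
    show ?thesis
    proof (rule inj_onI, clarify)
      fix i j i' j' assume b: "(i, j) \<in> D" "(i', j') \<in> D" "(i, j) \<notin> set bs" "(i', j') \<notin> set bs"
        "box_content (i, j) = box_content (i', j')"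
      then have "i = i'" using *[of i j i' j'] *[of i' j' i j] by (auto simp: box_content_def intro: linorder_cases)
      then show "i = i' \<and> j = j'" using b(5) by (simp add: box_content_def)
    qed
  qed
  define xs where "xs = sorted_list_of_set (box_content ` ?S)"
  define cs where "cs = map (inv_into ?S box_content) xs"
  have fin: "finite (box_content ` ?S)" using D(2) by simp
  have setxs: "set xs = box_content ` ?S" using fin by (simp add: xs_def)
  have mapcs: "map box_content cs = xs"
    unfolding cs_def map_map by (rule map_idI) (use setxs in \<open>auto simp: f_inv_into_f\<close>)
  have setcs: "set cs = ?S"
    unfolding cs_def set_map setxs using inj by (simp add: inv_into_image_cancel)
  have sorted: "sorted_wrt (<) (map box_content cs)"
    unfolding mapcs xs_def by (rule strict_sorted_list_of_set)
  have "std (bs @ take k cs)" if "k \<le> length cs" for k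
    using that
  proof (induction k)
    case 0
    then show ?case using bs(1) by simp
  next
    case (Suc k)
    have k: "k < length cs" using Suc.prems by simp
    obtain i j where b: "cs ! k = (i, j)" by (cases "cs ! k")
    have mem: "(i, j) \<in> D" "(i, j) \<notin> set bs" using nth_mem[OF k] setcs b by auto
    have before: "b' \<in> set (take k cs)" if b': "b' \<in> set cs" "box_content b' < box_content (i, j)" for b'
    proof -
      obtain k' where k': "k' < length cs" "cs ! k' = b'" using b'(1) in_set_conv_nth[of b' cs] by blast
      have "k' < k"
      proof (rule ccontr)
        assume "\<not> k' < k"
        then have "box_content (cs ! k) \<le> box_content (cs ! k')"
          using sorted_wrt_nth_less[OF sorted, of k k'] k k' by (cases "k = k'") auto
        then show False using b'(2) b k' by simp
      qed
      then show ?thesis using k' k by (auto simp: in_set_conv_nth)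
    qed
    have "distinct cs" using sorted by (metis mapcs distinct_map strict_sorted_iff)
    then have "distinct (take (Suc k) cs)" by (rule distinct_take)
    then have "(i, j) \<notin> set (take k cs)" using b by (simp add: take_Suc_conv_app_nth[OF k])
    moreover have "(i, j - 1) \<in> set bs \<union> set (take k cs)" if "0 < j"
    proof (cases "(i, j - 1) \<in> set bs")
      case False
      have "(i, j - 1) \<in> D" using young_diagramD[OF D(1) mem(1)] by simp
      then have "(i, j - 1) \<in> set cs" using False setcs by simp
      then show ?thesis using before[of "(i, j - 1)"] that by (simp add: box_content_def of_nat_diff)
    qed simp
    moreover have "(i - 1, j) \<in> set bs" if "0 < i" using strip mem that by blast
    ultimately have "addable (set (bs @ take k cs)) (i, j)" using mem(2) by (auto simp: addable_iff)
    then have "std ((bs @ take k cs) @ [cs ! k])" using Suc b unfolding std_snoc by simp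
    then show ?case by (simp add: take_Suc_conv_app_nth[OF k])
  qed
  from this[of "length cs"] show ?thesis using that setcs sorted by simp
qed

section \<open>Orthogonality and nonvanishing of the Specht generators\<close>

section \<open>Generic parameters\<close>

locale generic_hecke = hecke_algebra +
  assumes q_nonzero: "q \<noteq> 0" and two_le_n: "2 \<le> n"
    and quantum_nonzero: "m \<in> {1..n} \<Longrightarrow> (\<Sum>j<m. q ^ (2 * j)) \<noteq> 0"

text \<open>The index shift is due to simple transpositions being numbered from 1 and the generators
  of \<open>hecke_generators\<close> from 0.\<close>

sublocale generic_hecke \<subseteq> gens: hecke_generators scale n q "\<lambda>i. T (simple_transp (Suc i))"
proof
  fix i assume "Suc i < n"
  then show "T (s (Suc i)) * T (s (Suc i)) = 1 + scale (q - inverse q) (T (s (Suc i)))"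
    by (intro T_quadratic) auto
next
  fix i assume "Suc (Suc i) < n"
  then show "T (s (Suc i)) * T (s (Suc (Suc i))) * T (s (Suc i)) =
      T (s (Suc (Suc i))) * T (s (Suc i)) * T (s (Suc (Suc i)))"
    by (intro T_braid) auto
next
  fix i j assume "Suc i < j" "Suc j < n"
  then show "T (s (Suc i)) * T (s (Suc j)) = T (s (Suc j)) * T (s (Suc i))"
    by (intro T_commute) auto
qed (use q_nonzero quantum_nonzero scale_mult_left scale_mult_right in auto)

context generic_hecke
begin

lemma roots: "is_root q" "is_root (- inverse q)"
  using is_root_q[OF q_nonzero] by blast+

lemma roots_distinct: "q \<noteq> - inverse q" "- inverse q \<noteq> q"
proof -
  have "(\<Sum>j<2. q ^ (2 * j)) \<noteq> 0" using two_le_n by (intro quantum_nonzero) auto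
  then have "q\<^sup>2 + 1 \<noteq> 0" by (simp add: numeral_2_eq_2 add.commute)
  then have qq: "q * q \<noteq> - 1" by (auto simp: power2_eq_square)
  show "q \<noteq> - inverse q"
  proof
    assume "q = - inverse q"
    then have "q * q = q * (- inverse q)" by simp
    then show False using qq q_nonzero by simp
  qed
  then show "- inverse q \<noteq> q" by metis
qed

lemma quantum_nonzero': "m \<in> {1..n} \<Longrightarrow> (\<Sum>j<m. (- inverse q) ^ (2 * j)) \<noteq> 0"
proof -
  assume m: "m \<in> {1..n}"
  \<comment> \<open>The sum for the other root is the sum for \<open>q\<close> with inverted powers;
    this power of \<open>q\<close> reverses its order.\<close>
  have "q ^ (2 * (m - 1)) * (\<Sum>j<m. (- inverse q) ^ (2 * j)) = (\<Sum>j<m. q ^ (2 * (m - Suc j)))"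
    unfolding sum_distrib_left
  proof (rule sum.cong)
    fix j assume "j \<in> {..<m}"
    then have "2 * (m - 1) = 2 * (m - Suc j) + 2 * j" by auto
    then have "q ^ (2 * (m - 1)) = q ^ (2 * (m - Suc j)) * q ^ (2 * j)" by (simp only: power_add)
    moreover have "q ^ (2 * j) * (- inverse q) ^ (2 * j) = 1"
      using q_nonzero by (simp add: power_mult_distrib[symmetric] power_mult)
    ultimately show "q ^ (2 * (m - 1)) * (- inverse q) ^ (2 * j) = q ^ (2 * (m - Suc j))"
      by (simp only: mult.assoc mult_1_right)
  qed simp
  also have "\<dots> = (\<Sum>j<m. q ^ (2 * j))" by (rule sum.nat_diff_reindex)
  finally show ?thesis using quantum_nonzero[OF m] by auto
qed

lemma poincare_q: "I \<subseteq> {1..<n} \<Longrightarrow> poincare q I \<noteq> 0"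
  and poincare_q': "I \<subseteq> {1..<n} \<Longrightarrow> poincare (- inverse q) I \<noteq> 0"
  using poincare_nonzero quantum_nonzero quantum_nonzero' by blast+

abbreviation sym :: "nat list \<Rightarrow> 'b" where "sym mu \<equiv> symmetriser q (links mu)"

abbreviation alt :: "nat list \<Rightarrow> 'b" where
  "alt lam \<equiv> symmetriser (- inverse q) (links (conjugate_partition lam))"

text \<open>The generator of the Specht module.\<close>
definition z :: "nat list \<Rightarrow> 'b" where "z lam = alt lam * T (row_to_column lam) * sym lam"

lemma links_n: "sum_list mu = n \<Longrightarrow> links mu \<subseteq> {1..<n}"
  using links_subset[of mu] by simp

lemma links_partition:
  assumes "is_partition n lam"
  shows "links lam \<subseteq> {1..<n}" "links (conjugate_partition lam) \<subseteq> {1..<n}"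
  using links_n partition_sum assms conjugate_partition by blast+

lemma young_sum_eq: "sum_list mu = n \<Longrightarrow> young_sum scale T c mu = symmetriser c (links mu)"
  by (simp add: young_sum_def symmetriser_def young_subgroup_eq)

lemma alt_sym:
  assumes lam: "is_partition n lam"
  shows "\<exists>a. alt lam * x * sym lam = scale a (z lam)"
  unfolding z_def using reduced_transversal_unique[OF lam]
  by (intro sandwich_one links_partition[OF lam] roots roots_distinct) auto

lemma z_nonzero: "is_partition n lam \<Longrightarrow> z lam \<noteq> 0"
  unfolding z_def using row_to_column_reduced q_nonzero
  by (intro sandwich_nonzero links_partition) auto

lemma alt_sym_dominates:
  assumes lam: "is_partition n lam" and mu: "sum_list mu = n" and ne: "alt lam * x * sym mu \<noteq> 0"
  shows "dominates lam (ordered_parts mu)"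
proof -
  obtain d where d: "reduced n (links (conjugate_partition lam)) (links mu) d"
    "transversal (links (conjugate_partition lam)) (links mu) d"
    using sandwich_zero[OF links_partition(2)[OF lam] links_n[OF mu] roots(2,1) roots_distinct(2)] ne by blast
  then show ?thesis using transversal_dominates[OF lam _ mu] by (auto simp: reduced_def)
qed

lemma sym_alt_dominates:
  assumes lam: "is_partition n lam" and mu: "sum_list mu = n" and ne: "sym mu * x * alt lam \<noteq> 0"
  shows "dominates lam (ordered_parts mu)"
proof -
  obtain d where d: "reduced n (links mu) (links (conjugate_partition lam)) d"
    "transversal (links mu) (links (conjugate_partition lam)) d"
    using sandwich_zero[OF links_n[OF mu] links_partition(2)[OF lam] roots roots_distinct(1)] ne by blast
  then have dS: "d \<in> sym_group n" by (simp add: reduced_def)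
  show ?thesis
    using transversal_dominates[OF lam sym_group_inv[OF dS] mu]
      transversal_inv[OF d(2) sym_group_bij[OF dS]] by blast
qed

text \<open>A nonzero product contains a nonzero \<open>alt lam ... sym nu\<close> and a nonzero
  \<open>sym lam ... alt nu\<close>. These force dominance in both directions.\<close>

lemma z_z_zero:
  assumes lam: "is_partition n lam" and nu: "is_partition n nu" and ne: "lam \<noteq> nu"
  shows "z lam * x * z nu = 0"
proof (rule ccontr)
  assume nz: "z lam * x * z nu \<noteq> 0"
  have "z lam * x * z nu = alt lam * (T (row_to_column lam) * sym lam * x * alt nu * T (row_to_column nu)) * sym nu"
    by (simp only: z_def mult.assoc)
  then have "dominates lam (ordered_parts nu)"
    using alt_sym_dominates[OF lam partition_sum[OF nu]] nz by metis
  moreover have "z lam * x * z nu = alt lam * T (row_to_column lam) * (sym lam * x * alt nu) * (T (row_to_column nu) * sym nu)"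
    by (simp only: z_def mult.assoc)
  then have "dominates nu (ordered_parts lam)"
    using sym_alt_dominates[OF nu partition_sum[OF lam]] nz by (metis mult_zero_left mult_zero_right)
  ultimately show False
    using dominates_antisym[OF lam nu] ne by (simp add: ordered_parts_partition[OF lam] ordered_parts_partition[OF nu])
qed

lemma z_z:
  assumes lam: "is_partition n lam"
  shows "\<exists>a. z lam * x * z lam = scale a (z lam)"
proof -
  have "z lam * x * z lam = alt lam * (T (row_to_column lam) * sym lam * x * alt lam * T (row_to_column lam)) * sym lam"
    by (simp only: z_def mult.assoc)
  then show ?thesis using alt_sym[OF lam] by metis
qed

section \<open>Weight vectors and symmetrisers\<close>

lemma T_weight_row:
  assumes w: "gens.weight (row_reading lam) w" and lam: "is_partition n lam" and i: "i \<in> links lam"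
  shows "T (s i) * w = scale q w"
proof -
  obtain k j where kj: "(k, j) \<in> diagram lam" "(k, Suc j) \<in> diagram lam" "i = pos lam (k, j)" "Suc i = pos lam (k, Suc j)"
    using links_pos[OF i] .
  have i': "i - 1 = psum lam k + j" "Suc (i - 1) = psum lam k + Suc j" "Suc (i - 1) = i"
    using kj by (auto simp: pos_def)
  have len: "length (row_reading lam) = n" by (simp add: length_row_reading partition_sum[OF lam])
  have "i < n" using i links_partition[OF lam] by auto
  moreover have "row_reading lam ! (i - 1) = (k, j)" "row_reading lam ! Suc (i - 1) = (k, Suc j)"
    using row_reading_nth[OF kj(1)] row_reading_nth[OF kj(2)] i' by metis+
  ultimately have "T (s (Suc (i - 1))) * w = scale q w"
    using gens.g_adjacent_contents(1)[OF std_row_reading[OF lam] w, of "i - 1"] len i'(3)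
    by (simp add: box_content_def)
  then show ?thesis by (simp only: i'(3))
qed

definition column_reading :: "nat list \<Rightarrow> box list" where
  "column_reading lam = map prod.swap (row_reading (conjugate_partition lam))"

lemma addable_swap: "addable (prod.swap ` D) (prod.swap b) \<longleftrightarrow> addable D b"
  by (cases b) (auto simp: addable_iff)

lemma std_swap_map: "std bs \<Longrightarrow> std (map prod.swap bs)"
  by (induction bs rule: rev_induct) (simp_all add: addable_swap)

lemma column_reading:
  assumes lam: "is_partition n lam"
  shows "std (column_reading lam)" "set (column_reading lam) = diagram lam" "length (column_reading lam) = n"
proof -
  note c = conjugate_partition[OF lam]
  show "std (column_reading lam)" unfolding column_reading_def by (rule std_swap_map[OF std_row_reading[OF c]])
  show "set (column_reading lam) = diagram lam"
    by (simp add: column_reading_def set_row_reading diagram_conjugate[OF lam] image_image)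
  show "length (column_reading lam) = n"
    by (simp add: column_reading_def length_row_reading partition_sum[OF c])
qed

lemma T_weight_column:
  assumes w: "gens.weight (column_reading lam) w" and lam: "is_partition n lam"
    and i: "i \<in> links (conjugate_partition lam)"
  shows "T (s i) * w = scale (- inverse q) w"
proof -
  let ?c = "conjugate_partition lam"
  obtain k j where kj: "(k, j) \<in> diagram ?c" "(k, Suc j) \<in> diagram ?c" "i = pos ?c (k, j)" "Suc i = pos ?c (k, Suc j)"
    using links_pos[OF i] .
  have i': "i - 1 = psum ?c k + j" "Suc (i - 1) = psum ?c k + Suc j" "Suc (i - 1) = i"
    using kj by (auto simp: pos_def)
  have "i < n" using i links_partition[OF lam] by auto
  moreover have len: "length (row_reading ?c) = n" using column_reading(3)[OF lam] by (simp add: column_reading_def)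
  ultimately have "column_reading lam ! (i - 1) = (j, k)" "column_reading lam ! Suc (i - 1) = (Suc j, k)"
    using row_reading_nth[OF kj(1)] row_reading_nth[OF kj(2)] i'
    unfolding column_reading_def by (metis Suc_lessD nth_map swap_simp)+
  then have "T (s (Suc (i - 1))) * w = scale (- inverse q) w"
    using gens.g_adjacent_contents(2)[OF column_reading(1)[OF lam] w, of "i - 1"] column_reading(3)[OF lam] \<open>i < n\<close> i'(3)
    by (simp add: box_content_def)
  then show ?thesis by (simp only: i'(3))
qed

text \<open>Intertwiners lead from \<open>w\<close> to a row reading vector and on to a column
  reading vector. There \<open>sym lam\<close> and \<open>alt lam\<close> act by nonzero Poincare
  polynomials, so both can be inserted at the cost of a scalar, and what stands between them makes a
  multiple of \<open>z lam\<close>.\<close>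

lemma weight_in_ideal:
  assumes bs: "std bs" and w: "gens.weight bs w" and lam: "is_partition n lam" "diagram lam = set bs"
  shows "\<exists>x y. w = x * z lam * (y * w)"
proof -
  let ?P = "poincare q (links lam)" and ?P' = "poincare (- inverse q) (links (conjugate_partition lam))"
  have P: "?P \<noteq> 0" "?P' \<noteq> 0" using poincare_q poincare_q' links_partition[OF lam(1)] by auto
  have len: "length (row_reading lam) = n" by (simp add: length_row_reading partition_sum[OF lam(1)])
  have "gens.linked n bs (row_reading lam)"
    using gens.linked_same_shape[OF bs(1) std_row_reading[OF lam(1)]] lam(2) len by (simp add: set_row_reading)
  then obtain a a' where a: "gens.weight (row_reading lam) (a * w)" "a' * (a * w) = w"
    using gens.linkedE w by metis
  have "gens.linked n (row_reading lam) (column_reading lam)"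
    using gens.linked_same_shape[OF std_row_reading[OF lam(1)] column_reading(1)[OF lam(1)]] column_reading[OF lam(1)]
    by (simp add: set_row_reading)
  then obtain b b' where b: "gens.weight (column_reading lam) (b * (a * w))" "b' * (b * (a * w)) = a * w"
    using gens.linkedE a(1) by metis
  have sym: "sym lam * (a * w) = scale ?P (a * w)"
    by (rule symmetriser_eigen[OF links_partition(1)[OF lam(1)]]) (rule T_weight_row[OF a(1) lam(1)])
  have alt: "alt lam * (b * (a * w)) = scale ?P' (b * (a * w))"
    by (rule symmetriser_eigen[OF links_partition(2)[OF lam(1)]]) (rule T_weight_column[OF b(1) lam(1)])
  obtain c where c: "alt lam * b * sym lam = scale c (z lam)" using alt_sym[OF lam(1)] by blast
  have "scale (?P * ?P') w = a' * (b' * (scale ?P' (b * scale ?P (a * w))))"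
    by (simp add: scale_mult_right b a mult.commute)
  also have "\<dots> = a' * (b' * (alt lam * (b * (sym lam * (a * w)))))"
    unfolding sym using alt by (simp add: scale_mult_right)
  also have "\<dots> = a' * b' * (alt lam * b * sym lam) * (a * w)" by (simp only: mult.assoc)
  also have "\<dots> = scale (?P * ?P') ((scale (c / (?P * ?P')) (a' * b')) * z lam * (a * w))"
    unfolding c using P by (simp add: scale_mult_left scale_mult_right)
  finally have "w = scale (c / (?P * ?P')) (a' * b') * z lam * (a * w)" using P by simp
  then show ?thesis by blast
qed

lemma shape_exists:
  assumes "std bs" "length bs = n"
  obtains lam where "is_partition n lam" "diagram lam = set bs"
  using partition_of_diagram[OF std_young_diagram[OF assms(1)]] std_card[OF assms(1)] assms(2) by auto

text \<open>The unit lies in the sum of the two-sided ideals of the \<open>z lam\<close>, in the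
  form in which it is applied to left multiplication and to arbitrary modules.\<close>

lemma ideal_induct:
  assumes "P 0" "\<And>x y. P x \<Longrightarrow> P y \<Longrightarrow> P (x + y)"
    and z: "\<And>lam x y. is_partition n lam \<Longrightarrow> P (x * z lam * y)"
  shows "P v"
proof (rule gens.weight_induct[of UNIV P])
  fix bs w assume bs: "std bs" "length bs = n" and w: "gens.weight bs w"
  obtain lam where lam: "is_partition n lam" "diagram lam = set bs" using shape_exists[OF bs] .
  obtain x y where "w = x * z lam * (y * w)" using weight_in_ideal[OF bs(1) w lam] by blast
  then show "P w" using z[OF lam(1), of x "y * w"] by simp
qed (use assms in auto)

text \<open>If all \<open>z lam * y * u\<close> vanished, \<open>u\<close> would be killed by every
  two-sided ideal of a Specht generator, the others by orthogonality, and hence by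
  \<open>1\<close>.\<close>

lemma z_generates:
  assumes lam: "is_partition n lam" and u: "u = x * z lam" "u \<noteq> 0"
  obtains y c where "c \<noteq> 0" "z lam * y * u = scale c (z lam)"
proof -
  have "\<exists>y. z lam * y * u \<noteq> 0"
  proof (rule ccontr)
    assume "\<nexists>y. z lam * y * u \<noteq> 0"
    then have zero: "z lam * y * u = 0" for y by blast
    have "v * u = 0" for v
    proof (rule ideal_induct[of "\<lambda>v. v * u = 0"])
      fix nu x' y assume nu: "is_partition n nu"
      have "z nu * y * u = 0"
      proof (cases "nu = lam")
        case False
        then show ?thesis using z_z_zero[OF nu lam, of "y * x"] by (simp add: u(1) mult.assoc)
      qed (simp add: zero)
      then show "x' * z nu * y * u = 0" by (simp add: mult.assoc)
    qed (auto simp: distrib_right)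
    from this[of 1] show False using u(2) by simp
  qed
  then obtain y where y: "z lam * y * u \<noteq> 0" by blast
  obtain c where c: "z lam * y * u = scale c (z lam)"
    using z_z[OF lam, of "y * x"] by (auto simp: u(1) mult.assoc)
  then have "c \<noteq> 0" using y by auto
  then show ?thesis using that c by blast
qed

lemma T_eq_g: "1 \<le> i \<Longrightarrow> T (s i) = T (s (Suc (i - 1)))" by simp

section \<open>Vectors invariant under a Young subgroup\<close>

text \<open>Each linear factor turns the leftmost generator of \<open>Tcyc\<close> into an
  intertwiner and passes the rest of the polynomial on to the preceding Jucys-Murphy element. If the
  generators run out before position \<open>r\<close>, the next factor meets \<open>v\<close> itself
  and kills it.\<close>

lemma ann_Tcyc:
  assumes "r \<le> k" "k < n" "\<And>t. r \<le> t \<Longrightarrow> t \<le> k \<Longrightarrow> gens.X t * v = scale (gens.kap (c t)) v" "j \<le> k - r"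
  shows "gens.ann (gens.X k) (map c [Suc r..<Suc k]) (Tcyc k j * v) =
    (if j = k - r then gens.psi r (k - r) * v else 0)"
  using assms
proof (induction k arbitrary: j)
  case 0
  then show ?case by simp
next
  case (Suc k)
  show ?case
  proof (cases "r = Suc k")
    case True
    then show ?thesis using Suc.prems by simp
  next
    case False
    then have r: "r \<le> k" using Suc.prems by simp
    let ?ys = "map c [Suc r..<Suc k]"
    have ys: "map c [Suc r..<Suc (Suc k)] = ?ys @ [c (Suc k)]" using r by simp
    have X: "gens.X (Suc k) * v = scale (gens.kap (c (Suc k))) v" using Suc.prems by simp
    show ?thesis
    proof (cases j)
      case 0
      have "gens.ann (gens.X (Suc k)) (?ys @ [c (Suc k)]) v = 0"
        unfolding gens.ann_append using X by (simp del: upt_Suc)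
      then show ?thesis unfolding ys using 0 r by simp
    next
      case (Suc j')
      have j': "j' \<le> k - r" using Suc Suc.prems(4) r by simp
      let ?w = "Tcyc k j' * v"
      have comm: "gens.X (Suc k) * Tcyc k j' = Tcyc k j' * gens.X (Suc k)"
      proof (rule Tcyc_commute)
        fix i assume "i < j'"
        then have i: "1 \<le> k - i" using j' by simp
        show "gens.X (Suc k) * T (s (k - i)) = T (s (k - i)) * gens.X (Suc k)"
          unfolding T_eq_g[OF i] using gens.g_X_commute[of "Suc k" "k - i - 1"] i Suc.prems(2) by simp
      qed
      have "gens.X (Suc k) * ?w = Tcyc k j' * (gens.X (Suc k) * v)"
        by (simp only: comm mult.assoc[symmetric])
      then have Xw: "gens.X (Suc k) * ?w = scale (gens.kap (c (Suc k))) ?w"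
        by (simp only: X scale_mult_right)
      have "gens.ann (gens.X (Suc k)) (?ys @ [c (Suc k)]) (Tcyc (Suc k) j * v) =
          gens.ann (gens.X (Suc k)) ?ys (gens.phi k * ?w)"
        unfolding gens.ann_append Suc Tcyc_Suc
        using gens.X_next_g_eigen[OF Suc.prems(2) Xw] by (simp add: mult.assoc del: upt_Suc)
      also have "\<dots> = gens.phi k * gens.ann (gens.X k) ?ys ?w"
        by (rule gens.ann_intertwine[OF gens.X_next_phi[OF Suc.prems(2)]])
      also have "\<dots> = gens.phi k * (if j' = k - r then gens.psi r (k - r) * v else 0)"
        using Suc.IH[OF r _ _ j'] Suc.prems(2,3) by (simp only: Suc_lessD le_SucI)
      also have "\<dots> = (if j = Suc k - r then gens.psi r (Suc k - r) * v else 0)"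
        using r gens.psi_Suc[of r "k - r"] by (simp add: Suc Suc_diff_le mult.assoc)
      finally show ?thesis unfolding ys .
    qed
  qed
qed

text \<open>
  Let \<open>b\<close> be the last box of the first run of consecutive contents. The polynomial in \<open>X k\<close>
  that kills the larger contents annihilates all terms of the coset factorisation except those
  moving \<open>b\<close> to the end, and these all give the same weight vector of the strip with \<open>b\<close> last.
\<close>
lemma strip_symmetriser:
  assumes "std (bs @ cs)" "length (bs @ cs) \<le> n" "sorted_wrt (<) (map box_content cs)"
    and "gens.weight (bs @ cs) v" "v \<noteq> 0"
  shows "symmetriser q {Suc (length bs)..<length (bs @ cs)} * v \<noteq> 0"
  using assms
proof (induction "length cs" arbitrary: cs v rule: less_induct)
  case less
  let ?N = "length bs" and ?m = "length cs"
  show ?case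
  proof (cases "?m \<le> 1")
    case True
    then have "{Suc ?N..<length (bs @ cs)} = {}" by auto
    then show ?thesis using less.prems(5) by (simp only: symmetriser_empty mult_1 not_False_eq_True)
  next
    case False
    define k where "k = ?N + ?m - 1"
    have k: "Suc k = ?N + ?m" "?N < k" "k < n" using False less.prems(2) by (auto simp: k_def)
    let ?c = "\<lambda>t. box_content ((bs @ cs) ! t)"
    let ?Q = "\<lambda>t. Suc t = ?m \<or> box_content (cs ! Suc t) \<noteq> box_content (cs ! t) + 1"
    define t where "t = (LEAST t. ?Q t)"
    have "Suc (?m - 1) = ?m" using False by arith
    then have exQ: "?Q (?m - 1)" by blast
    have Qt: "?Q t" unfolding t_def by (rule LeastI, rule exQ)
    have t_le: "t \<le> ?m - 1" unfolding t_def by (rule Least_le, rule exQ)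
    have before: "box_content (cs ! Suc i) = box_content (cs ! i) + 1" if "i < t" for i
      using not_less_Least[of i ?Q] that by (auto simp: t_def)
    have tm: "t < ?m" using t_le False by simp
    define as b ds where "as = take t cs" and "b = cs ! t" and "ds = drop (Suc t) cs"
    have cs: "cs = as @ b # ds" unfolding as_def b_def ds_def by (rule id_take_nth_drop[OF tm])
    have las: "length as = t" "length ds = ?m - Suc t" using tm by (simp_all add: as_def ds_def)
    define r where "r = ?N + t"
    have r: "?N \<le> r" "r \<le> k" "length (bs @ as) = r" "length ds = k - r" using las tm k by (auto simp: r_def)
    have sorted: "box_content (cs ! i) < box_content (cs ! j)" if "i < j" "j < ?m" for i j
      using sorted_wrt_nth_less[OF less.prems(3), of i j] that by simp
    \<comment> \<open>Contents increase along \<open>cs\<close> and the run stops at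
      \<open>b\<close>, so the next content is larger by at least 2. Hence no box of
      \<open>ds\<close> touches \<open>b\<close>, and \<open>b\<close> can be moved to the
      end.\<close>
    have gap: "box_content b + 1 < box_content d" if "d \<in> set ds" for d
    proof -
      obtain i where i: "i < length ds" "ds ! i = d" using \<open>d \<in> set ds\<close> by (meson in_set_conv_nth)
      have St: "Suc t < ?m" using i las by simp
      have "box_content (cs ! t) + 1 < box_content (cs ! Suc t)"
        using sorted[of t "Suc t"] Qt St by auto
      moreover have "box_content (cs ! Suc t) \<le> box_content (cs ! (Suc t + i))"
      proof (cases "i = 0")
        case False
        moreover have "Suc t + i < ?m" using i(1) las(2) by linarith
        ultimately show ?thesis using sorted[of "Suc t" "Suc t + i"] by simp
      qed simp
      moreover have "cs ! (Suc t + i) = d" using i by (simp add: ds_def)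
      ultimately show ?thesis by (simp add: b_def)
    qed
    have notin: "right b \<notin> set ds" "down b \<notin> set ds" using gap[of "right b"] gap[of "down b"] by auto
    have eq: "bs @ cs = (bs @ as) @ b # ds @ []" by (simp add: cs)
    have mv: "std ((bs @ as) @ ds @ [b]) \<and> (\<forall>v. gens.weight (bs @ cs) v \<longrightarrow>
        gens.weight ((bs @ as) @ ds @ [b]) (gens.psi r (k - r) * v) \<and> (\<exists>a. a * (gens.psi r (k - r) * v) = v))"
      using gens.move_right[of "bs @ as" b ds "[]", folded eq, OF less.prems(1,2) notin] unfolding r .
    then have mv: "std ((bs @ as) @ ds @ [b])" "gens.weight ((bs @ as) @ ds @ [b]) (gens.psi r (k - r) * v)"
      "gens.psi r (k - r) * v \<noteq> 0"
      using less.prems(4,5) by (blast, blast, metis mult_zero_right)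
    let ?v = "gens.psi r (k - r) * v"
    have "symmetriser q {Suc ?N..<length (bs @ (as @ ds))} * ?v \<noteq> 0"
    proof (rule less.hyps)
      show "length (as @ ds) < ?m" using cs by simp
      show "std (bs @ as @ ds)" using mv(1) std_append[of "bs @ as @ ds" "[b]"] by simp
      show "gens.weight (bs @ as @ ds) ?v" using mv(2) gens.weight_append[of "bs @ as @ ds" "[b]"] by simp
      show "sorted_wrt (<) (map box_content (as @ ds))"
        using less.prems(3) by (simp add: cs sorted_wrt_append)
      show "length (bs @ as @ ds) \<le> n" using less.prems(2) by (simp add: cs)
    qed (rule mv(3))
    moreover have "length (bs @ (as @ ds)) = k" using k cs by simp
    ultimately have IH: "symmetriser q {Suc ?N..<k} * ?v \<noteq> 0" by simp
    let ?I = "{Suc ?N..<Suc k}"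
    have I: "?I \<subseteq> {1..<n}" "k \<in> ?I" "?I \<subseteq> {..k}" "{Suc ?N..k} \<subseteq> ?I" "Suc ?N - 1 \<notin> ?I" "Suc ?N \<le> k"
      using k by auto
    have Ik: "?I - {k} = {Suc ?N..<k}" using k by auto
    have X: "gens.X i * v = scale (gens.kap (?c i)) v" if "i \<le> k" for i
      using less.prems(4) that k by (simp add: gens.weight_def)
    have run: "T (s (r - i)) * v = scale q v" if i: "i < t" for i
    proof -
      have e: "r - i - 1 = ?N + (t - i - 1)" "Suc (?N + (t - i - 1)) = ?N + (t - i)" "1 \<le> r - i"
        using i by (auto simp: r_def)
      have "?c (Suc (r - i - 1)) = ?c (r - i - 1) + 1"
        unfolding e(1,2) nth_append_length_plus using before[of "t - i - 1"] i by (simp add: Suc_diff_Suc)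
      moreover have "Suc (r - i - 1) < length (bs @ cs)" using i tm by (simp add: r_def)
      ultimately show ?thesis
        using gens.g_adjacent_contents(1)[OF less.prems(1,4,2), of "r - i - 1"] T_eq_g[OF e(3)] by simp
    qed
    let ?xs = "map ?c [Suc r..<Suc k]"
    let ?p = "gens.ann (gens.X k) ?xs"
    have low: "?p (Tcyc k j * v) = (if j = k - r then ?v else 0)" if "j \<le> k - r" for j
      by (rule ann_Tcyc) (use r k X that in auto)
    \<comment> \<open>Beyond length \<open>k - r\<close> the additional factors are generators
      inside the first run, and these act on \<open>v\<close> by \<open>q\<close>.\<close>
    have high: "Tcyc k (k - r + i) * v = scale (q ^ i) (Tcyc k (k - r) * v)" if "i \<le> t" for i
      using that
    proof (induction i)
      case (Suc i)
      have "k - (k - r + i) = r - i" using r by simp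
      then have "Tcyc k (k - r + Suc i) * v = Tcyc k (k - r + i) * (T (s (r - i)) * v)"
        by (simp add: mult.assoc)
      then show ?case using Suc run[of i] by (simp add: scale_mult_right)
    qed simp
    let ?D = "\<Sum>j\<le>Suc k - Suc ?N. scale (q ^ j) (Tcyc k j)"
    \<comment> \<open>The surviving indices are \<open>k - r + i\<close> with \<open>i\<close> at
      most \<open>t\<close>. Each contributes \<open>?v\<close> with two powers of \<open>q\<close>,
      one from the symmetriser and one from the run, and the total is a power of \<open>q\<close>
      times the \<open>q\<^sup>2\<close>-integer of the run length.\<close>
    have "?p (?D * v) = (\<Sum>j\<le>k - ?N. scale (q ^ j) (?p (Tcyc k j * v)))"
      by (simp add: sum_distrib_right scale_mult_left gens.ann_sum gens.ann_scale del: upt_Suc)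
    also have "\<dots> = (\<Sum>j\<in>(+) (k - r) ` {..t}. scale (q ^ j) (?p (Tcyc k j * v)))"
    proof (rule sum.mono_neutral_right)
      show "(+) (k - r) ` {..t} \<subseteq> {..k - ?N}" using r by (auto simp: r_def)
      show "\<forall>j\<in>{..k - ?N} - (+) (k - r) ` {..t}. scale (q ^ j) (?p (Tcyc k j * v)) = 0"
      proof
        fix j assume j: "j \<in> {..k - ?N} - (+) (k - r) ` {..t}"
        have "j < k - r"
        proof (rule ccontr)
          assume "\<not> j < k - r"
          then have "j = (k - r) + (j - (k - r))" "j - (k - r) \<le> t" using j r by (auto simp: r_def)
          then show False using j by blast
        qed
        then show "scale (q ^ j) (?p (Tcyc k j * v)) = 0" using low[of j] by simp
      qed
    qed simp
    also have "\<dots> = (\<Sum>i\<le>t. scale (q ^ (k - r + i)) (?p (Tcyc k (k - r + i) * v)))"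
      by (simp add: sum.reindex comp_def del: upt_Suc)
    also have "\<dots> = (\<Sum>i\<le>t. scale (q ^ (k - r) * q ^ (2 * i)) ?v)"
    proof (rule sum.cong)
      fix i assume "i \<in> {..t}"
      then have "?p (Tcyc k (k - r + i) * v) = scale (q ^ i) ?v"
        using high[of i] low[of "k - r"] by (simp add: gens.ann_scale del: upt_Suc)
      then show "scale (q ^ (k - r + i)) (?p (Tcyc k (k - r + i) * v)) = scale (q ^ (k - r) * q ^ (2 * i)) ?v"
        by (simp add: power_add mult_2 mult.assoc del: upt_Suc)
    qed simp
    also have "\<dots> = scale (q ^ (k - r) * (\<Sum>i<Suc t. q ^ (2 * i))) ?v"
      by (simp only: scale_sum_left[symmetric] sum_distrib_left[symmetric] lessThan_Suc_atMost)
    finally have pD: "?p (?D * v) = scale (q ^ (k - r) * (\<Sum>i<Suc t. q ^ (2 * i))) ?v" .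
    have comm: "gens.X k * symmetriser q {Suc ?N..<k} = symmetriser q {Suc ?N..<k} * gens.X k"
    proof (rule symmetriser_commute)
      show "{Suc ?N..<k} \<subseteq> {1..<n}" using k by auto
      fix i assume i: "i \<in> {Suc ?N..<k}"
      then have "1 \<le> i" "k \<noteq> i - 1" by auto
      with gens.g_X_commute[of k "i - 1"] i k show "gens.X k * T (s i) = T (s i) * gens.X k"
        unfolding T_eq_g[OF \<open>1 \<le> i\<close>] by simp
    qed
    show ?thesis
    proof
      assume zero: "symmetriser q {Suc ?N..<length (bs @ cs)} * v = 0"
      have "symmetriser q ?I * v = symmetriser q {Suc ?N..<k} * (?D * v)"
        by (simp only: symmetriser_factor[OF I] Ik mult.assoc)
      \<comment> \<open>The polynomial in \<open>X k\<close> commutes with the symmetriser of the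
        smaller interval, so it can act on the coset sum first.\<close>
      then have "?p (symmetriser q {Suc ?N..<k} * (?D * v)) = 0" using zero k by (simp del: upt_Suc)
      then have "symmetriser q {Suc ?N..<k} * scale (q ^ (k - r) * (\<Sum>i<Suc t. q ^ (2 * i))) ?v = 0"
        unfolding gens.ann_intertwine[OF comm] pD .
      moreover have "(\<Sum>i<Suc t. q ^ (2 * i)) \<noteq> 0"
        by (rule quantum_nonzero) (use tm less.prems(2) in auto)
      ultimately show False using IH q_nonzero by (simp only: scale_mult_right scale_eq_0_iff) simp
    qed
  qed
qed

text \<open>Pass to the tableau that reads a smaller shape \<open>lam'\<close> by rows and then the
  strip by contents. Symmetrising over the strip gives a nonzero vector that still has weight
  \<open>row_reading lam'\<close>, so induction applies. The multiplier found there must commute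
  with the later generators, for the invariance on the last part to survive; hence the clause on
  \<open>centralizing\<close>.\<close>

lemma invariant_vector:
  assumes "is_partition (sum_list mu) lam" "\<And>m. m \<in> set mu \<Longrightarrow> 0 < m" "dominates lam (ordered_parts mu)"
    "sum_list mu \<le> n" "std bs" "set bs = diagram lam" "gens.weight bs v" "v \<noteq> 0"
  shows "\<exists>a. gens.centralizing (sum_list mu) a \<and> a * v \<noteq> 0 \<and>
    (\<forall>i\<in>links mu. T (s i) * (a * v) = scale q (a * v))"
  using assms
proof (induction mu arbitrary: lam bs v rule: rev_induct)
  case Nil
  then show ?case by (intro exI[of _ 1]) (auto simp: links_def gens.centralizing_1)
next
  case (snoc m mu)
  let ?N' = "sum_list mu" and ?N = "sum_list (mu @ [m])"
  have lam: "is_partition (?N' + m) lam" and m: "0 < m" using snoc.prems by auto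
  obtain lam' where lam': "is_partition ?N' lam'" "dominates lam' (ordered_parts mu)"
    "diagram lam' \<subseteq> diagram lam"
    "\<And>i j. (i, j) \<in> diagram lam \<Longrightarrow> (i, j) \<notin> diagram lam' \<Longrightarrow> 0 < i \<Longrightarrow> (i - 1, j) \<in> diagram lam'"
    using remove_strip[OF lam m snoc.prems(3)] by blast
  let ?rr = "row_reading lam'"
  have rr: "std ?rr" "set ?rr = diagram lam'" "length ?rr = ?N'"
    using std_row_reading[OF lam'(1)] by (auto simp: set_row_reading length_row_reading partition_sum[OF lam'(1)])
  obtain cs where cs: "set cs = diagram lam - set ?rr" "std (?rr @ cs)" "sorted_wrt (<) (map box_content cs)"
    using strip_list[OF young_diagram_partition[OF lam] finite_diagram rr(1)] lam'(3,4) rr(2) by metis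
  have set_eq: "set (?rr @ cs) = diagram lam" using cs(1) lam'(3) rr(2) by auto
  then have len: "length (?rr @ cs) = ?N"
    using std_card[OF cs(2)] card_diagram[of lam] partition_sum[OF lam] by simp
  have "gens.linked ?N bs (?rr @ cs)"
    using gens.linked_same_shape[OF snoc.prems(5) cs(2)] set_eq snoc.prems(4,6) len by simp
  then obtain a1 a1' where a1: "gens.weight (?rr @ cs) (a1 * v)" "a1' * (a1 * v) = v" "gens.centralizing ?N a1"
    using gens.linkedE snoc.prems(7) by metis
  have v1: "a1 * v \<noteq> 0" using a1(2) snoc.prems(8) by auto
  let ?I = "{Suc ?N'..<?N}"
  let ?x = "symmetriser q ?I"
  have I: "?I \<subseteq> {1..<n}" using snoc.prems(4) by auto
  have v2: "?x * (a1 * v) \<noteq> 0"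
    using strip_symmetriser[OF cs(2) _ cs(3) a1(1) v1] len snoc.prems(4) rr(3) by simp
  have gen: "T (s i) = T (s (Suc (i - 1)))" "Suc (i - 1) < n" "?N' \<le> i - 1" if "i \<in> ?I" for i
    using that I by auto
  have commX: "gens.X j * ?x = ?x * gens.X j" if "j < ?N'" for j
  proof (rule symmetriser_commute[OF I])
    fix i assume "i \<in> ?I"
    from gen[OF this] show "gens.X j * T (s i) = T (s i) * gens.X j"
      using gens.g_X_commute[of j "i - 1"] that by simp
  qed
  have w2: "gens.weight ?rr (?x * (a1 * v))"
    by (rule gens.weight_mult[OF gens.weight_append[OF a1(1)]]) (simp only: commX rr(3))
  have cent: "gens.centralizing ?N ?x"
    unfolding gens.centralizing_def
  proof (intro allI impI conjI)
    fix j assume j: "?N \<le> j"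
    show "T (s (Suc j)) * ?x = ?x * T (s (Suc j))" if "Suc j < n"
    proof (rule symmetriser_commute[OF I])
      fix i assume i: "i \<in> ?I"
      from gen[OF this] show "T (s (Suc j)) * T (s i) = T (s i) * T (s (Suc j))"
        using gens.far_commute_sym[of j "i - 1"] that j i by simp
    qed
    show "gens.X j * ?x = ?x * gens.X j" if "j < n"
    proof (rule symmetriser_commute[OF I])
      fix i assume i: "i \<in> ?I"
      then have "j \<noteq> i - 1" using j by auto
      with gen[OF i] show "gens.X j * T (s i) = T (s i) * gens.X j"
        using gens.g_X_commute[of j "i - 1"] that j i by simp
    qed
  qed
  obtain a2 where a2: "gens.centralizing ?N' a2" "a2 * (?x * (a1 * v)) \<noteq> 0"
    "\<And>i. i \<in> links mu \<Longrightarrow> T (s i) * (a2 * (?x * (a1 * v))) = scale q (a2 * (?x * (a1 * v)))"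
    using snoc.IH[OF lam'(1) _ lam'(2) _ rr(1,2) w2 v2] snoc.prems by auto
  let ?a = "a2 * ?x * a1"
  have av: "?a * v = a2 * (?x * (a1 * v))" by (simp add: mult.assoc)
  have "gens.centralizing ?N ?a"
    using gens.centralizing_mult[OF gens.centralizing_mult[OF gens.centralizing_mono[OF a2(1)] cent] a1(3)] by simp
  moreover have "T (s i) * (?a * v) = scale q (?a * v)" if i: "i \<in> links (mu @ [m])" for i
  proof -
    \<comment> \<open>All partial sums of \<open>mu\<close> remain partial sums of
      \<open>mu @ [m]\<close>, in particular \<open>?N'\<close>; so no link crosses from the earlier
      parts into the last one.\<close>
    have "psum (mu @ [m]) k = psum mu k" if "k \<le> length mu" for k using that by (simp add: psum_def)
    then have "psum mu k \<in> range (psum (mu @ [m]))" for k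
      using psum_length[of mu k] psum_length[of mu "length mu"] by (metis linear rangeI)
    then have "i \<notin> range (psum mu)" using i by (auto simp: links_def)
    moreover from this have "i \<noteq> ?N'" using psum_length[of mu "length mu"] by (metis order_refl rangeI)
    ultimately consider "i \<in> links mu" | "i \<in> ?I"
      using i by (cases "i < ?N'") (auto simp: links_def)
    then show ?thesis
    proof cases
      case 1
      then show ?thesis unfolding av by (rule a2(3))
    next
      case 2
      have c: "T (s i) * a2 = a2 * T (s i)"
        using a2(1) gen[OF 2] unfolding gens.centralizing_def by metis
      have "T (s i) * (?a * v) = a2 * ((T (s i) * ?x) * (a1 * v))"
        unfolding av by (metis c mult.assoc)
      also have "\<dots> = scale q (?a * v)"
        by (simp only: symmetriser_left[OF roots(1) 2 I] scale_mult_left scale_mult_right mult.assoc)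
      finally show ?thesis .
    qed
  qed
  ultimately show ?case using a2(2) av by metis
qed

text \<open>The left ideal of \<open>z lam\<close> contains a nonzero weight vector, and
  orthogonality forces its shape to be \<open>lam\<close>. An invariant multiple of it is reproduced
  by \<open>sym mu\<close> up to a nonzero scalar.\<close>

lemma sym_z_nonzero:
  assumes lam: "is_partition n lam" and mu: "is_composition n mu" and dom: "dominates lam (ordered_parts mu)"
  obtains x where "sym mu * (x * z lam) \<noteq> 0"
proof -
  let ?N = "range (\<lambda>x. x * z lam)"
  have "\<exists>bs w. std bs \<and> length bs = n \<and> gens.weight bs w \<and> w \<in> ?N \<and> w \<noteq> 0"
  proof (rule ccontr)
    assume no: "\<not> ?thesis"
    have "z lam = 0"
    proof (rule gens.weight_induct[of ?N "\<lambda>v. v = 0"])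
      show "a * v \<in> ?N" if "v \<in> ?N" for a v
        using that by (auto simp flip: mult.assoc)
      show "z lam \<in> ?N" using rangeI[of "\<lambda>x. x * z lam" 1] by simp
    qed (use no in auto)
    then show False using z_nonzero[OF lam] by simp
  qed
  then obtain bs w x where bs: "std bs" "length bs = n" and w: "gens.weight bs w" "w = x * z lam" "w \<noteq> 0"
    by blast
  obtain nu where nu: "is_partition n nu" "diagram nu = set bs" using shape_exists[OF bs] .
  have "nu = lam"
  proof (rule ccontr)
    assume ne: "nu \<noteq> lam"
    obtain y y' where "w = y * z nu * (y' * w)" using weight_in_ideal[OF bs(1) w(1) nu] by blast
    also have "\<dots> = y * (z nu * (y' * x) * z lam)" by (simp add: w(2) mult.assoc)
    also have "\<dots> = 0" using z_z_zero[OF nu(1) lam ne] by simp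
    finally show False using w(3) by simp
  qed
  have sum: "sum_list mu = n" using mu by (simp add: is_composition_def)
  obtain a where a: "a * w \<noteq> 0" "\<And>i. i \<in> links mu \<Longrightarrow> T (s i) * (a * w) = scale q (a * w)"
    using invariant_vector[of mu lam bs w] lam mu dom bs w nu(2) \<open>nu = lam\<close> sum
    by (auto simp: is_composition_def)
  have "sym mu * (a * w) = scale (poincare q (links mu)) (a * w)"
    by (rule symmetriser_eigen[OF links_n[OF sum] a(2)])
  then have "sym mu * ((a * x) * z lam) \<noteq> 0"
    using a(1) poincare_q[OF links_n[OF sum]] by (simp add: w(2) mult.assoc)
  then show ?thesis by (rule that)
qed

end

section \<open>Irreducible representations of the parabolic algebra\<close>

text \<open>Elements \<open>e * x * z lam * y * e\<close> act through the single shape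
  \<open>lam\<close>. They carry any nonzero vector of \<open>V lam\<close> to any other, they
  vanish on the other shapes, and together they span the algebra, so in every nonzero module one of
  them acts nontrivially.\<close>

lemma (in generic_hecke) complete_reps:
  fixes mu :: "nat list"
  assumes mu: "is_composition n mu"
  shows "complete_irreducible_reps TYPE('w::ab_group_add) scale
          (parabolic_hecke scale q T mu) (young_idempotent scale q T mu) scale (*)
          {lam. is_partition n lam \<and> dominates lam (ordered_parts mu)}
          (\<lambda>lam. (*) (young_idempotent scale q T mu) ` specht_module scale q T lam)"
proof -
  define e where "e = young_idempotent scale q T mu"
  define A where "A = parabolic_hecke scale q T mu"
  define V where "V lam = (*) e ` specht_module scale q T lam" for lam
  let ?I = "{lam. is_partition n lam \<and> dominates lam (ordered_parts mu)}"
  have sum: "sum_list mu = n" using mu by (simp add: is_composition_def)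
  let ?P = "poincare q (links mu)"
  have P: "?P \<noteq> 0" by (rule poincare_q[OF links_n[OF sum]])
  have e_eq: "e = scale (1 / ?P) (sym mu)"
    by (simp add: e_def young_idempotent_def young_sum_eq[OF sum] poincare_def young_subgroup_eq sum)
  have "sym mu * sym mu = scale ?P (sym mu)"
    by (rule symmetriser_eigen[OF links_n[OF sum]]) (rule symmetriser_left[OF roots(1) _ links_n[OF sum]])
  then have ee: "e * e = e" using P by (simp add: e_eq scale_mult_left scale_mult_right)
  have eex: "e * (e * x) = e * x" for x using ee by (simp flip: mult.assoc)
  have A_eq: "A = range (\<lambda>x. e * x * e)"
    by (auto simp: A_def parabolic_hecke_def e_def)
  have V_eq: "V lam = range (\<lambda>x. e * (x * z lam))" if lam: "is_partition n lam" for lam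
  proof -
    have "specht_module scale q T lam = range (\<lambda>x. x * z lam)"
      using partition_sum[OF lam] partition_sum[OF conjugate_partition[OF lam]]
      by (auto simp: specht_module_def z_def young_sum_eq)
    then show ?thesis by (auto simp: V_def)
  qed
  have eV: "e * x = x" if "is_partition n lam" "x \<in> V lam" for lam x
    using that by (auto simp: V_eq eex)
  have AV: "a * x \<in> V lam" if lam: "is_partition n lam" and ax: "a \<in> A" "x \<in> V lam" for lam a x
  proof -
    obtain a' y where "a = e * a' * e" "x = e * (y * z lam)"
      using ax unfolding A_eq V_eq[OF lam] by blast
    then have "a * x = e * ((a' * e * e * y) * z lam)" by (simp only: mult.assoc)
    then show ?thesis unfolding V_eq[OF lam] by blast
  qed
  have V_sub: "subspace (V lam)" if lam: "is_partition n lam" for lam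
  proof (rule subspaceI)
    show "0 \<in> V lam" unfolding V_eq[OF lam] by (rule range_eqI[of _ _ 0]) simp
    show "x + y \<in> V lam" if "x \<in> V lam" "y \<in> V lam" for x y
      using that unfolding V_eq[OF lam] by (auto simp flip: distrib_left distrib_right)
    show "scale c x \<in> V lam" if x: "x \<in> V lam" for c x
    proof -
      obtain y where "x = e * (y * z lam)" using x unfolding V_eq[OF lam] by blast
      then have "scale c x = e * (scale c y * z lam)" by (simp add: scale_mult_left scale_mult_right)
      then show ?thesis unfolding V_eq[OF lam] by blast
    qed
  qed
  have V_nonzero: "V lam \<noteq> {0} \<longleftrightarrow> lam \<in> ?I" if lam: "is_partition n lam" for lam
  proof
    assume "V lam \<noteq> {0}"
    then obtain x where "e * (x * z lam) \<noteq> 0" using subspace_0[OF V_sub[OF lam]] V_eq[OF lam] by auto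
    then have "sym mu * (x * z lam) \<noteq> 0" by (auto simp: e_eq scale_mult_left)
    moreover have "sym mu * (x * z lam) = (sym mu * x * alt lam) * (T (row_to_column lam) * sym lam)"
      by (simp only: z_def mult.assoc)
    ultimately have "sym mu * x * alt lam \<noteq> 0" by (metis mult_zero_left)
    then show "lam \<in> ?I" using sym_alt_dominates[OF lam sum] lam by simp
  next
    assume "lam \<in> ?I"
    then obtain x where "sym mu * (x * z lam) \<noteq> 0" using sym_z_nonzero[OF lam mu] by auto
    then have "e * (x * z lam) \<noteq> 0" using P by (simp add: e_eq scale_mult_left)
    then show "V lam \<noteq> {0}" unfolding V_eq[OF lam] by blast
  qed
  \<comment> \<open>Multiplication brings \<open>u\<close> back to a multiple of
    \<open>z lam\<close>, from which every vector of \<open>V lam\<close> is reached.\<close>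
  have generate: "\<exists>a\<in>A. x = a * u"
    if lam: "is_partition n lam" and u: "u \<in> V lam" "u \<noteq> 0" and x: "x \<in> V lam" for lam u x
  proof -
    obtain u' where u': "u = (e * u') * z lam" using u(1) V_eq[OF lam] by (auto simp: mult.assoc)
    obtain y c where y: "c \<noteq> 0" "z lam * y * u = scale c (z lam)" using z_generates[OF lam u' u(2)] .
    obtain x' where x': "x = e * (x' * z lam)" using x V_eq[OF lam] by auto
    have "x = e * (x' * scale (inverse c) (z lam * y * u))" using y by (simp add: x')
    also have "\<dots> = (e * scale (inverse c) (x' * z lam * y) * e) * u"
      using eV[OF lam u(1)] by (simp add: scale_mult_left scale_mult_right mult.assoc)
    finally show ?thesis unfolding A_eq by blast
  qed
  have rep: "algebra_rep scale A e scale (V lam) (*)" if lam: "is_partition n lam" for lam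
    unfolding algebra_rep_def
    using vector_space_axioms V_sub[OF lam] AV[OF lam] eV[OF lam]
    by (auto simp: distrib_left distrib_right scale_mult_left scale_mult_right mult.assoc)
  have irred: "irreducible_rep scale A e scale (V lam) (*)" if lam: "lam \<in> ?I" for lam
    unfolding irreducible_rep_def
  proof (intro conjI allI impI)
    have lam': "is_partition n lam" using lam by simp
    show "algebra_rep scale A e scale (V lam) (*)" by (rule rep[OF lam'])
    show "V lam \<noteq> {0}" using V_nonzero[OF lam'] lam by blast
    fix U assume U: "subspace U \<and> U \<subseteq> V lam \<and> (\<forall>a\<in>A. \<forall>v\<in>U. a * v \<in> U)"
    show "U = {0} \<or> U = V lam"
    proof (cases "U = {0}")
      case False
      then obtain u where u: "u \<in> U" "u \<noteq> 0" using U subspace_0 by blast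
      then have "x \<in> U" if "x \<in> V lam" for x using generate[OF lam' _ u(2) that] U by blast
      then show ?thesis using U by blast
    qed simp
  qed
  \<comment> \<open>An isomorphism would transport the action of such an \<open>a\<close>; this is
    what separates the shapes.\<close>
  have separate: "\<exists>a\<in>A. a * u \<noteq> 0 \<and> (\<forall>nu. is_partition n nu \<longrightarrow> nu \<noteq> lam \<longrightarrow> (\<forall>x\<in>V nu. a * x = 0))"
    if lam: "lam \<in> ?I" and u: "u \<in> V lam" "u \<noteq> 0" for lam u
  proof -
    have lam': "is_partition n lam" using lam by simp
    obtain u' where u': "u = (e * u') * z lam" using u(1) V_eq[OF lam'] by (auto simp: mult.assoc)
    obtain y c where y: "c \<noteq> 0" "z lam * y * u = scale c (z lam)" using z_generates[OF lam' u' u(2)] .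
    obtain x where x: "e * (x * z lam) \<noteq> 0"
      using V_nonzero[OF lam'] lam V_eq[OF lam'] subspace_0[OF V_sub[OF lam']] by auto
    let ?a = "e * (x * z lam * y) * e"
    have "?a * u = e * (x * (z lam * y * u))" using eV[OF lam' u(1)] by (simp add: mult.assoc)
    then have "?a * u \<noteq> 0" using x y by (simp add: scale_mult_right)
    moreover have "?a * x' = 0" if nu: "is_partition n nu" "nu \<noteq> lam" and x': "x' \<in> V nu" for nu x'
    proof -
      obtain v where v: "x' = e * (v * z nu)" using x' V_eq[OF nu(1)] by auto
      have "?a * x' = e * (x * (z lam * (y * e * e * v) * z nu))" by (simp add: v mult.assoc)
      then show ?thesis using z_z_zero[OF lam' nu(1) nu(2)[symmetric]] by simp
    qed
    moreover have "?a \<in> A" unfolding A_eq by blast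
    ultimately show ?thesis by blast
  qed
  have distinct: "\<not> isomorphic_reps A scale (V lam) (*) scale (V nu) (*)"
    if lam: "lam \<in> ?I" and nu: "nu \<in> ?I" and ne: "lam \<noteq> nu" for lam nu
  proof
    assume "isomorphic_reps A scale (V lam) (*) scale (V nu) (*)"
    then obtain f where f: "bij_betw f (V lam) (V nu)"
      "\<And>x y. x \<in> V lam \<Longrightarrow> y \<in> V lam \<Longrightarrow> f (x + y) = f x + f y"
      "\<And>a x. a \<in> A \<Longrightarrow> x \<in> V lam \<Longrightarrow> f (a * x) = a * f x"
      unfolding isomorphic_reps_def by blast
    have lam': "is_partition n lam" and nu': "is_partition n nu" using lam nu by auto
    note zero = subspace_0[OF V_sub[OF lam']]
    obtain u where u: "u \<in> V lam" "u \<noteq> 0" using V_nonzero[OF lam'] lam zero by blast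
    obtain a where a: "a \<in> A" "a * u \<noteq> 0" "\<And>x. x \<in> V nu \<Longrightarrow> a * x = 0"
      using separate[OF lam u] nu' ne by blast
    have "f (a * u) = 0" using f(3)[OF a(1) u(1)] a(3) bij_betw_apply[OF f(1) u(1)] by simp
    moreover have "f 0 = 0" using f(2)[OF zero zero] by simp
    ultimately have "a * u = 0"
      using f(1) AV[OF lam' a(1) u(1)] zero by (metis bij_betw_inv_into_left)
    then show False using a(2) by simp
  qed
  have complete: "\<exists>lam\<in>?I. isomorphic_reps A scale (V lam) (*) sw W actW"
    if W: "irreducible_rep scale A e sw W actW"
    for sw :: "'a \<Rightarrow> 'w \<Rightarrow> 'w" and W actW
  proof -
    have R: "algebra_rep scale A e sw W actW" "W \<noteq> {0}"
      and simple: "\<And>U. module.subspace sw U \<Longrightarrow> U \<subseteq> W \<Longrightarrow> (\<And>a v. a \<in> A \<Longrightarrow> v \<in> U \<Longrightarrow> actW a v \<in> U) \<Longrightarrow> U = {0} \<or> U = W"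
      using W unfolding irreducible_rep_def by blast+
    have swv: "vector_space sw" and Wsub: "module.subspace sw W"
      and act_in: "\<And>a w. a \<in> A \<Longrightarrow> w \<in> W \<Longrightarrow> actW a w \<in> W"
      and act_add: "\<And>a v w. a \<in> A \<Longrightarrow> v \<in> W \<Longrightarrow> w \<in> W \<Longrightarrow> actW a (v + w) = actW a v + actW a w"
      and act_plus: "\<And>a b w. a \<in> A \<Longrightarrow> b \<in> A \<Longrightarrow> w \<in> W \<Longrightarrow> actW (a + b) w = actW a w + actW b w"
      and act_scale: "\<And>a c w. a \<in> A \<Longrightarrow> w \<in> W \<Longrightarrow> actW (scale c a) w = sw c (actW a w)"
      and act_mult: "\<And>a b w. a \<in> A \<Longrightarrow> b \<in> A \<Longrightarrow> w \<in> W \<Longrightarrow> actW (a * b) w = actW a (actW b w)"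
      and act_unit: "\<And>w. w \<in> W \<Longrightarrow> actW e w = w"
      using R(1) unfolding algebra_rep_def by blast+
    interpret W: vector_space sw by (rule swv)
    obtain w where w: "w \<in> W" "w \<noteq> 0" using R(2) W.subspace_0[OF Wsub] by blast
    have inA: "e * x * e \<in> A" for x unfolding A_eq by blast
    have eA: "e \<in> A" using inA[of 1] ee by simp
    have act0: "actW 0 w = 0"
    proof -
      have "0 \<in> A" using inA[of 0] by simp
      from act_plus[OF this this w(1)] show ?thesis by simp
    qed
    \<comment> \<open>Otherwise \<open>e\<close>, being a sum of such elements, would kill
      \<open>w\<close>, but it acts as the identity.\<close>
    have "\<exists>lam x y. is_partition n lam \<and> actW (e * (x * z lam * y) * e) w \<noteq> 0"
    proof (rule ccontr)
      assume no: "\<not> ?thesis"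
      have "actW (e * 1 * e) w = 0"
      proof (rule ideal_induct[of "\<lambda>v. actW (e * v * e) w = 0"])
        show "actW (e * 0 * e) w = 0" using act0 by simp
        fix x y assume "actW (e * x * e) w = 0" "actW (e * y * e) w = 0"
        then show "actW (e * (x + y) * e) w = 0"
          using act_plus[OF inA inA w(1), of x y] by (simp add: distrib_left distrib_right)
      qed (use no in blast)
      then show False using act_unit[OF w(1)] w(2) ee by simp
    qed
    then obtain lam x y where lam: "is_partition n lam" and nz: "actW (e * (x * z lam * y) * e) w \<noteq> 0"
      by blast
    have mapA: "v * y * e \<in> A" if v: "v \<in> V lam" for v
      using inA[of "v * y"] eV[OF lam v] by (simp flip: mult.assoc)
    \<comment> \<open>A homomorphism from \<open>V lam\<close> to \<open>W\<close>, nonzero at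
      \<open>?v\<close>. Both modules being simple, it is bijective as in Schur's lemma.\<close>
    define f where "f v = actW (v * y * e) w" for v
    have fW: "f v \<in> W" if "v \<in> V lam" for v unfolding f_def by (rule act_in[OF mapA[OF that] w(1)])
    have f_add: "f (v + v') = f v + f v'" if "v \<in> V lam" "v' \<in> V lam" for v v'
      using act_plus[OF mapA[OF that(1)] mapA[OF that(2)] w(1)] by (simp add: f_def distrib_right)
    have f_scale: "f (scale c v) = sw c (f v)" if "v \<in> V lam" for c v
      using act_scale[OF mapA[OF that] w(1)] by (simp add: f_def scale_mult_left)
    have f_act: "f (a * v) = actW a (f v)" if "a \<in> A" "v \<in> V lam" for a v
      using act_mult[OF that(1) mapA[OF that(2)] w(1)] by (simp add: f_def mult.assoc)
    note V0 = subspace_0[OF V_sub[OF lam]]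
    have f0: "f 0 = 0" using f_add[OF V0 V0] by simp
    let ?v = "e * (x * z lam)"
    have v: "?v \<in> V lam" "f ?v \<noteq> 0" using V_eq[OF lam] nz by (auto simp: f_def mult.assoc)
    then have lamI: "lam \<in> ?I" using V_nonzero[OF lam] f0 by auto
    have "f ` V lam = {0} \<or> f ` V lam = W"
    proof (rule simple)
      show "W.subspace (f ` V lam)"
      proof (rule W.subspaceI)
        show "0 \<in> f ` V lam" using f0 V0 by (metis imageI)
        show "a + b \<in> f ` V lam" if "a \<in> f ` V lam" "b \<in> f ` V lam" for a b
          using that f_add subspace_add[OF V_sub[OF lam]] by (metis (no_types, lifting) imageE imageI)
        show "sw c a \<in> f ` V lam" if "a \<in> f ` V lam" for c a
          using that f_scale subspace_scale[OF V_sub[OF lam]] by (metis (no_types, lifting) imageE imageI)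
      qed
      show "f ` V lam \<subseteq> W" using fW by blast
      show "actW a b \<in> f ` V lam" if "a \<in> A" "b \<in> f ` V lam" for a b
        using that f_act AV[OF lam] by (metis (no_types, lifting) imageE imageI)
    qed
    then have surj: "f ` V lam = W" using v by blast
    \<comment> \<open>A nonzero \<open>u\<close> in the kernel would generate \<open>?v\<close>, on
      which \<open>f\<close> does not vanish.\<close>
    have kernel: "u = 0" if u: "u \<in> V lam" "f u = 0" for u
    proof (rule ccontr)
      assume "u \<noteq> 0"
      then obtain a where a: "a \<in> A" "?v = a * u" using generate[OF lam u(1) _ v(1)] by blast
      have "actW a 0 = 0"
        using act_add[OF a(1) W.subspace_0[OF Wsub] W.subspace_0[OF Wsub]] by simp
      then show False using v(2) f_act[OF a(1) u(1)] a(2) u(2) by simp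
    qed
    have "inj_on f (V lam)"
    proof (rule inj_onI)
      fix u u' assume u: "u \<in> V lam" "u' \<in> V lam" "f u = f u'"
      have d: "u - u' \<in> V lam" by (rule subspace_diff[OF V_sub[OF lam] u(1,2)])
      have "f u = f (u - u') + f u'" using f_add[OF d u(2)] by simp
      then have "u - u' = 0" using u(3) kernel[OF d] by simp
      then show "u = u'" by simp
    qed
    then have "isomorphic_reps A scale (V lam) (*) sw W actW"
      unfolding isomorphic_reps_def using surj f_add f_scale f_act
      by (intro exI[of _ f]) (auto simp: bij_betw_def)
    then show ?thesis using lamI by blast
  qed
  have "complete_irreducible_reps TYPE('w) scale A e scale (*) ?I V"
    unfolding complete_irreducible_reps_def using irred distinct complete by blast
  then show ?thesis unfolding A_def e_def V_def .
qed

section \<open>Both semisimple situations satisfy the genericity assumption\<close>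

lemma generic_quantum_nonzero:
  fixes m :: nat assumes "0 < m"
  shows "(\<Sum>j<m. rational_function_var ^ (2 * j)) \<noteq> 0"
proof -
  have pow: "rational_function_var ^ k = Fract (monom 1 k) 1" for k
    by (induction k) (simp_all add: rational_function_var_def monom_0 One_fract_def pCons_one monom_Suc mult.commute)
  have "(\<Sum>j<m. Fract (monom 1 (2 * j)) 1) = Fract (\<Sum>j<m. monom (1::complex) (2 * j)) 1" for m
    by (induction m) (simp_all add: Zero_fract_def)
  \<comment> \<open>The constant term, coming from \<open>j = 0\<close>, shows that the polynomial
    is nonzero.\<close>
  moreover have "coeff (\<Sum>j<m. monom (1::complex) (2 * j)) 0 = 1"
  proof -
    have "coeff (\<Sum>j<m. monom (1::complex) (2 * j)) 0 = (\<Sum>j<m. if j = 0 then 1 else 0)"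
      unfolding coeff_sum by (rule sum.cong) auto
    then show ?thesis using assms by simp
  qed
  then have "(\<Sum>j<m. monom (1::complex) (2 * j)) \<noteq> 0" by (metis coeff_0 zero_neq_one)
  ultimately show ?thesis by (simp add: pow Zero_fract_def eq_fract)
qed

lemma rational_function_var_nonzero: "rational_function_var \<noteq> 0"
  by (simp add: rational_function_var_def Zero_fract_def eq_fract)

text \<open>A vanishing sum makes \<open>q\<^sup>2\<close> an \<open>m\<close>-th root of unity. Its
  order is not 1, since for \<open>q\<^sup>2 = 1\<close> the sum is \<open>m\<close>, so the order
  lies in the excluded range.\<close>

lemma quantum_nonzero_complex:
  fixes q :: complex
  assumes roots: "\<forall>m\<in>{2..n}. \<not> root_of_unity_of_order m (q\<^sup>2)" and m: "m \<in> {1..n}"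
  shows "(\<Sum>j<m. q ^ (2 * j)) \<noteq> 0"
proof
  assume zero: "(\<Sum>j<m. q ^ (2 * j)) = 0"
  then have zero': "(\<Sum>j<m. (q\<^sup>2) ^ j) = 0" by (simp add: power_mult)
  then have "(q\<^sup>2) ^ m - 1 = 0" using power_diff_1_eq[of "q\<^sup>2" m] by simp
  then have qm: "(q\<^sup>2) ^ m = 1" by simp
  define k where "k = (LEAST k. 0 < k \<and> (q\<^sup>2) ^ k = 1)"
  have ex: "0 < m \<and> (q\<^sup>2) ^ m = 1" using qm m by simp
  have k: "0 < k \<and> (q\<^sup>2) ^ k = 1" unfolding k_def by (rule LeastI, rule ex)
  have km: "k \<le> m" unfolding k_def by (rule Least_le, rule ex)
  have min: "(q\<^sup>2) ^ j \<noteq> 1" if "0 < j" "j < k" for j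
    using not_less_Least[of j "\<lambda>k. 0 < k \<and> (q\<^sup>2) ^ k = 1"] that by (simp add: k_def)
  have "k \<noteq> 1" using k zero' m by auto
  then have "root_of_unity_of_order k (q\<^sup>2)" "k \<in> {2..n}"
    using k km m min by (auto simp: root_of_unity_of_order_def)
  then show False using roots by blast
qed

lemma length_le_sum_list: "(\<And>m. m \<in> set mu \<Longrightarrow> (0::nat) < m) \<Longrightarrow> length mu \<le> sum_list mu"
proof (induction mu)
  case (Cons m mu)
  then have "length mu \<le> sum_list mu" "0 < m" by auto
  then show ?case by simp
qed simp

theorem corollary5p10:
  fixes n :: nat and mu :: "nat list"
  assumes "is_composition n mu" and "length mu > 1"
  shows
    "(\<forall>(scale :: complex poly fract \<Rightarrow> 'h1::ring_1 \<Rightarrow> 'h1) T.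
        hecke_algebra scale n rational_function_var T \<longrightarrow>
        complete_irreducible_reps TYPE('w1::ab_group_add) scale
          (parabolic_hecke scale rational_function_var T mu)
          (young_idempotent scale rational_function_var T mu)
          scale (*)
          {lam. is_partition n lam \<and> dominates lam (ordered_parts mu)}
          (\<lambda>lam. (*) (young_idempotent scale rational_function_var T mu)
                   ` specht_module scale rational_function_var T lam))
     \<and>
     (\<forall>(q::complex) (scale :: complex \<Rightarrow> 'h2::ring_1 \<Rightarrow> 'h2) T.
        q \<noteq> 0 \<longrightarrow> (\<forall>m\<in>{2..n}. \<not> root_of_unity_of_order m (q\<^sup>2)) \<longrightarrow>
        hecke_algebra scale n q T \<longrightarrow>
        complete_irreducible_reps TYPE('w2::ab_group_add) scale
          (parabolic_hecke scale q T mu)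
          (young_idempotent scale q T mu)
          scale (*)
          {lam. is_partition n lam \<and> dominates lam (ordered_parts mu)}
          (\<lambda>lam. (*) (young_idempotent scale q T mu) ` specht_module scale q T lam))"
proof (intro conjI allI impI)
  have n: "2 \<le> n" using length_le_sum_list[of mu] assms by (auto simp: is_composition_def)
  fix scale :: "complex poly fract \<Rightarrow> 'h1 \<Rightarrow> 'h1" and T
  assume "hecke_algebra scale n rational_function_var T"
  then interpret generic_hecke scale n rational_function_var T
    by (intro generic_hecke.intro generic_hecke_axioms.intro)
       (use n rational_function_var_nonzero generic_quantum_nonzero in auto)
  show "complete_irreducible_reps TYPE('w1) scale
          (parabolic_hecke scale rational_function_var T mu)
          (young_idempotent scale rational_function_var T mu)
          scale (*)
          {lam. is_partition n lam \<and> dominates lam (ordered_parts mu)}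
          (\<lambda>lam. (*) (young_idempotent scale rational_function_var T mu)
                   ` specht_module scale rational_function_var T lam)"
    by (rule complete_reps[OF assms(1)])
next
  have n: "2 \<le> n" using length_le_sum_list[of mu] assms by (auto simp: is_composition_def)
  fix q :: complex and scale :: "complex \<Rightarrow> 'h2 \<Rightarrow> 'h2" and T
  assume q: "q \<noteq> 0" "\<forall>m\<in>{2..n}. \<not> root_of_unity_of_order m (q\<^sup>2)" and "hecke_algebra scale n q T"
  then interpret generic_hecke scale n q T
    by (intro generic_hecke.intro generic_hecke_axioms.intro)
       (use n quantum_nonzero_complex in auto)
  show "complete_irreducible_reps TYPE('w2) scale
          (parabolic_hecke scale q T mu)
          (young_idempotent scale q T mu)
          scale (*)
          {lam. is_partition n lam \<and> dominates lam (ordered_parts mu)}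
          (\<lambda>lam. (*) (young_idempotent scale q T mu) ` specht_module scale q T lam)"
    by (rule complete_reps[OF assms(1)])
qed

end
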